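(* Let $n\ge 2$ be an integer. There exist two MASAs of the Cuntz algebra $\mathcal{O}_n$ which are outer but not inner conjugate. In fact, there exists an uncountable family of MASAs in $\mathcal{O}_n$, indexed by the cosets $\mathcal{U}(\mathcal{F}_n^1)/\mathcal{N}_{\mathcal{F}_n^1}(\mathcal{D}_n^1)$, such that each of them is outer conjugate to $\mathcal{D}_n$ but no two of them are inner conjugate.
   Context: $\mathcal{O}_n$ ($n\ge 2$) is the Cuntz algebra, the unital simple $C^*$-algebra generated by isometries $S_1,\dots,S_n$ with $\sum_{i=1}^n S_iS_i^*=1$. For a word $\mu=(\mu_1,\dots,\mu_k)$ in $\{1,\dots,n\}$, $|\mu|=k$, $S_\mu=S_{\mu_1}\cdots S_{\mu_k}$ and $P_\mu=S_\mu S_\mu^*$ (for the empty word, $S_\mu=1$). $\mathcal{F}_n^1=\operatorname{span}\{S_iS_j^*:1\le i,j\le n\}\cong M_n(\mathbb{C})$. The diagonal $\mathcal{D}_n$ is the $C^*$-subalgebra of $\mathcal{O}_n$ generated by all projections $P_\mu$; it is a maximal abelian subalgebra (MASA) of $\mathcal{O}_n$, and $\mathcal{D}_n^1=\mathcal{D}_n\cap\mathcal{F}_n^1$. $\mathcal{U}(A)$ denotes the unitary group of $A$ and $\mathcal{N}_B(A)=\{u\in\mathcal{U}(B):uAu^*=A\}$. Two MASAs $A_1,A_2$ of $B$ are inner conjugate if there is $u\in\mathcal{U}(B)$ with $uA_1u^*=A_2$; they are outer conjugate if some outer (i.e. not inner) automorphism $\alpha$ of $B$ satisfies $\alpha(A_1)=A_2$.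 "Outer but not inner conjugate" means that one is mapped onto the other by an outer automorphism but by no inner automorphism. *)

theory Defs
  imports Complex_Main "HOL-Library.Countable_Set"
begin

class scaleC =
  fixes scaleC :: "complex \<Rightarrow> 'a \<Rightarrow> 'a" (infixr "*\<^sub>C" 75)

class star =
  fixes star :: "'a \<Rightarrow> 'a"

text \<open>Unital nonzero C*-algebras, with the real scalar multiplication of the library classes
  required to be the restriction of the complex one.\<close>

class cstar_algebra = real_normed_algebra_1 + banach + scaleC + star +
  assumes scaleC_add_right: "a *\<^sub>C (x + y) = a *\<^sub>C x + a *\<^sub>C y"
    and scaleC_add_left: "(a + b) *\<^sub>C x = a *\<^sub>C x + b *\<^sub>C x"
    and scaleC_scaleC: "a *\<^sub>C b *\<^sub>C x = (a * b) *\<^sub>C x"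
    and scaleC_one: "1 *\<^sub>C x = x"
    and scaleR_scaleC: "r *\<^sub>R x = complex_of_real r *\<^sub>C x"
    and mult_scaleC_left: "(a *\<^sub>C x) * y = a *\<^sub>C (x * y)"
    and mult_scaleC_right: "x * (a *\<^sub>C y) = a *\<^sub>C (x * y)"
    and norm_scaleC: "norm (a *\<^sub>C x) = cmod a * norm x"
    and star_add: "star (x + y) = star x + star y"
    and star_scaleC: "star (a *\<^sub>C x) = cnj a *\<^sub>C star x"
    and star_mult: "star (x * y) = star y * star x"
    and star_star: "star (star x) = x"
    and cstar_identity: "norm (star x * x) = (norm x)\<^sup>2"

global_interpretation complex_vector:
  vector_space "scaleC :: complex \<Rightarrow> 'a \<Rightarrow> 'a::cstar_algebra"
  defines cspan = complex_vector.span
  by unfold_locales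
    (simp_all add: scaleC_add_right scaleC_add_left scaleC_scaleC scaleC_one)

text \<open>Algebras are represented by carrier sets inside an ambient unital C*-algebra; a subalgebra
  is not required to contain the ambient unit.\<close>

definition cstar_subalgebra :: "'a::cstar_algebra set \<Rightarrow> bool" where
  "cstar_subalgebra A \<longleftrightarrow>
     0 \<in> A \<and> (\<forall>x\<in>A. \<forall>y\<in>A. x + y \<in> A) \<and> (\<forall>c. \<forall>x\<in>A. c *\<^sub>C x \<in> A) \<and>
     (\<forall>x\<in>A. \<forall>y\<in>A. x * y \<in> A) \<and> (\<forall>x\<in>A. star x \<in> A) \<and> closed A"

definition cstar_generated :: "'a::cstar_algebra set \<Rightarrow> 'a set" where
  "cstar_generated X = cstar_subalgebra hull X"

definition closed_two_sided_ideal :: "'a::cstar_algebra set \<Rightarrow> 'a set \<Rightarrow> bool" where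
  "closed_two_sided_ideal B J \<longleftrightarrow>
     J \<subseteq> B \<and> 0 \<in> J \<and> (\<forall>x\<in>J. \<forall>y\<in>J. x + y \<in> J) \<and> (\<forall>c. \<forall>x\<in>J. c *\<^sub>C x \<in> J) \<and>
     (\<forall>b\<in>B. \<forall>x\<in>J. b * x \<in> J \<and> x * b \<in> J) \<and> closed J"

definition simple_cstar_algebra :: "'a::cstar_algebra set \<Rightarrow> bool" where
  "simple_cstar_algebra B \<longleftrightarrow>
     cstar_subalgebra B \<and> B \<noteq> {0} \<and>
     (\<forall>J. closed_two_sided_ideal B J \<longrightarrow> J = {0} \<or> J = B)"

definition unitaries :: "'a::cstar_algebra set \<Rightarrow> 'a set" where
  "unitaries A = {u \<in> A. star u * u = 1 \<and> u * star u = 1}"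

definition conj_by :: "'a::cstar_algebra \<Rightarrow> 'a \<Rightarrow> 'a" where
  "conj_by u x = u * x * star u"

definition unitary_normalizer :: "'a::cstar_algebra set \<Rightarrow> 'a set \<Rightarrow> 'a set" where
  "unitary_normalizer B A = {u \<in> unitaries B. conj_by u ` A = A}"

definition abelian_cstar_subalgebra_of :: "'a::cstar_algebra set \<Rightarrow> 'a set \<Rightarrow> bool" where
  "abelian_cstar_subalgebra_of B A \<longleftrightarrow>
     cstar_subalgebra A \<and> A \<subseteq> B \<and> (\<forall>x\<in>A. \<forall>y\<in>A. x * y = y * x)"

definition masa :: "'a::cstar_algebra set \<Rightarrow> 'a set \<Rightarrow> bool" where
  "masa B A \<longleftrightarrow> abelian_cstar_subalgebra_of B A \<and>
     (\<forall>A'. abelian_cstar_subalgebra_of B A' \<and> A \<subseteq> A' \<longrightarrow> A' = A)"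

text \<open>Maps on a carrier are total functions; their values off the carrier are irrelevant.\<close>

definition cstar_automorphism :: "'a::cstar_algebra set \<Rightarrow> ('a \<Rightarrow> 'a) \<Rightarrow> bool" where
  "cstar_automorphism B \<alpha> \<longleftrightarrow>
     bij_betw \<alpha> B B \<and>
     (\<forall>x\<in>B. \<forall>y\<in>B. \<alpha> (x + y) = \<alpha> x + \<alpha> y) \<and> (\<forall>c. \<forall>x\<in>B. \<alpha> (c *\<^sub>C x) = c *\<^sub>C \<alpha> x) \<and>
     (\<forall>x\<in>B. \<forall>y\<in>B. \<alpha> (x * y) = \<alpha> x * \<alpha> y) \<and> (\<forall>x\<in>B. \<alpha> (star x) = star (\<alpha> x))"

definition inner_automorphism :: "'a::cstar_algebra set \<Rightarrow> ('a \<Rightarrow> 'a) \<Rightarrow> bool" where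
  "inner_automorphism B \<alpha> \<longleftrightarrow>
     cstar_automorphism B \<alpha> \<and> (\<exists>u\<in>unitaries B. \<forall>x\<in>B. \<alpha> x = conj_by u x)"

definition outer_automorphism :: "'a::cstar_algebra set \<Rightarrow> ('a \<Rightarrow> 'a) \<Rightarrow> bool" where
  "outer_automorphism B \<alpha> \<longleftrightarrow> cstar_automorphism B \<alpha> \<and> \<not> inner_automorphism B \<alpha>"

definition inner_conjugate :: "'a::cstar_algebra set \<Rightarrow> 'a set \<Rightarrow> 'a set \<Rightarrow> bool" where
  "inner_conjugate B A1 A2 \<longleftrightarrow> (\<exists>u\<in>unitaries B. conj_by u ` A1 = A2)"

definition outer_conjugate :: "'a::cstar_algebra set \<Rightarrow> 'a set \<Rightarrow> 'a set \<Rightarrow> bool" where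
  "outer_conjugate B A1 A2 \<longleftrightarrow> (\<exists>\<alpha>. outer_automorphism B \<alpha> \<and> \<alpha> ` A1 = A2)"

text \<open>By Cuntz's uniqueness theorem the relations below determine \<open>B\<close> up to isomorphism, so
  quantifying over all such \<open>n\<close>, \<open>S\<close>, \<open>B\<close> quantifies over all realizations of the Cuntz
  algebra. Since \<open>star (S 1) * S 1 = 1\<close>, the algebra \<open>B\<close> contains the ambient unit.\<close>

definition is_cuntz_algebra :: "nat \<Rightarrow> (nat \<Rightarrow> 'a::cstar_algebra) \<Rightarrow> 'a set \<Rightarrow> bool" where
  "is_cuntz_algebra n S B \<longleftrightarrow>
     (\<forall>i\<in>{1..n}. star (S i) * S i = 1) \<and>
     (\<Sum>i=1..n. S i * star (S i)) = 1 \<and>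
     B = cstar_generated (S ` {1..n}) \<and>
     simple_cstar_algebra B"

definition word_isometry :: "(nat \<Rightarrow> 'a::cstar_algebra) \<Rightarrow> nat list \<Rightarrow> 'a" where
  "word_isometry S \<mu> = prod_list (map S \<mu>)"

definition word_projection :: "(nat \<Rightarrow> 'a::cstar_algebra) \<Rightarrow> nat list \<Rightarrow> 'a" where
  "word_projection S \<mu> = word_isometry S \<mu> * star (word_isometry S \<mu>)"

definition cuntz_F1 :: "nat \<Rightarrow> (nat \<Rightarrow> 'a::cstar_algebra) \<Rightarrow> 'a set" where
  "cuntz_F1 n S = cspan {S i * star (S j) | i j. i \<in> {1..n} \<and> j \<in> {1..n}}"

definition cuntz_diagonal :: "nat \<Rightarrow> (nat \<Rightarrow> 'a::cstar_algebra) \<Rightarrow> 'a set" where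
  "cuntz_diagonal n S = cstar_generated (word_projection S ` lists {1..n})"

definition cuntz_D1 :: "nat \<Rightarrow> (nat \<Rightarrow> 'a::cstar_algebra) \<Rightarrow> 'a set" where
  "cuntz_D1 n S = cuntz_diagonal n S \<inter> cuntz_F1 n S"

definition left_cosets :: "'a::cstar_algebra set \<Rightarrow> 'a set \<Rightarrow> 'a set set" where
  "left_cosets G H = {(\<lambda>h. u * h) ` H | u. u \<in> G}"

definition cuntz_cosets :: "nat \<Rightarrow> (nat \<Rightarrow> 'a::cstar_algebra) \<Rightarrow> 'a set set" where
  "cuntz_cosets n S =
     left_cosets (unitaries (cuntz_F1 n S)) (unitary_normalizer (cuntz_F1 n S) (cuntz_D1 n S))"

end

theory Submission imports Defs "HOL-Analysis.Analysis" begin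

text \<open>
  Write \<open>\<phi>(y) = \<Sum>\<^sub>i S\<^sub>i y S\<^sub>i\<^sup>*\<close>. A unitary \<open>u\<close> of \<open>F\<^sup>1\<close> defines an automorphism
  \<open>\<lambda>\<^sub>u\<close> with \<open>\<lambda>\<^sub>u(S\<^sub>i) = u S\<^sub>i\<close>; the family consists of the MASAs \<open>\<lambda>\<^sub>u(D)\<close>.
  On a homogeneous polynomial \<open>\<lambda>\<^sub>u\<close> is multiplication by unitaries on both sides, hence
  isometric. A polynomial of degree at most \<open>M\<close> has \<open>2 M + 1\<close> homogeneous components, each of no
  larger norm, so \<open>\<lambda>\<^sub>u\<close> changes its norm by a factor of at most \<open>2 M + 1\<close>, and by
  \<open>\<parallel>x\<parallel> ^ (2 N) = \<parallel>(x\<^sup>* x) ^ N\<parallel>\<close> the factor is in fact \<open>1\<close>. No spectral theory is involved.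

  \<open>D\<close> is maximal because an element of \<open>D'\<close> differs from its expectation by an element whose
  matrix coefficients along aperiodic infinite words all vanish; such elements form a proper ideal.

  If a unitary \<open>w\<close> maps \<open>\<lambda>\<^sub>u(D)\<close> onto \<open>\<lambda>\<^sub>v(D)\<close>, a nonzero homogeneous component of \<open>w\<close>
  almost intertwines \<open>\<phi>\<^sup>j\<close> with \<open>\<phi>\<^bsup>j + m\<^esup>\<close> as \<open>j\<close> grows, which forces \<open>u D\<^sup>1 u\<^sup>*\<close> and
  \<open>v D\<^sup>1 v\<^sup>*\<close> to commute; both being maximal abelian in \<open>F\<^sup>1\<close>, they coincide and
  \<open>v\<^sup>* u\<close> normalizes \<open>D\<^sup>1\<close>. For \<open>u\<close> in the normalizer itself, the automorphism \<open>S\<^sub>i \<mapsto> - S\<^sub>i\<close>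
  is outer and fixes \<open>D\<close> pointwise.
\<close>

section \<open>C*-algebra preliminaries\<close>

lemma scaleC_minus1: "(- 1) *\<^sub>C x = - (x::'a::cstar_algebra)"
  by (simp add: complex_vector.scale_minus_left scaleC_one)

lemma star_zero [simp]: "star (0::'a::cstar_algebra) = 0"
  using star_scaleC[of 0 "0::'a"] by simp

lemma star_one [simp]: "star (1::'a::cstar_algebra) = 1"
proof -
  have "star (star (1::'a) * 1) = star 1 * star (star (1::'a))"
    by (rule star_mult)
  then show ?thesis by (simp add: star_star)
qed

lemma star_minus: "star (- x) = - star (x::'a::cstar_algebra)"
  using star_scaleC[of "-1" x] by (simp add: scaleC_minus1)

lemma star_diff: "star (x - y) = star x - star (y::'a::cstar_algebra)"
  using star_add[of x "- y"] by (simp add: star_minus)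

lemma star_sum: "star (sum f A) = (\<Sum>i\<in>A. star (f i :: 'a::cstar_algebra))"
  by (induction A rule: infinite_finite_induct) (simp_all add: star_add)

lemma star_power: "star (x ^ k) = star (x::'a::cstar_algebra) ^ k"
  by (induction k) (simp_all add: star_mult power_commutes)

lemmas star_simps = star_add star_minus star_diff star_sum star_scaleC star_mult star_star star_power

lemma norm_star [simp]: "norm (star x) = norm (x::'a::cstar_algebra)"
proof -
  have le: "norm y \<le> norm (star y)" for y :: 'a
  proof (cases "norm y = 0")
    case False
    have "norm y * norm y \<le> norm (star y) * norm y"
      using norm_mult_ineq[of "star y" y] by (simp add: cstar_identity power2_eq_square)
    then show ?thesis using False by simp
  qed simp
  show ?thesis using le[of x] le[of "star x"] by (simp add: star_star)
qed

lemma bounded_linear_star: "bounded_linear (star :: 'a::cstar_algebra \<Rightarrow> 'a)"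
  by (rule bounded_linear_intro[where K = 1])
    (simp_all add: star_add scaleR_scaleC star_scaleC)

lemma bounded_linear_scaleC: "bounded_linear (\<lambda>x::'a::cstar_algebra. c *\<^sub>C x)"
  by (rule bounded_linear_intro[where K = "cmod c"])
    (simp_all add: scaleC_add_right scaleR_scaleC scaleC_scaleC norm_scaleC mult.commute)

lemmas tendsto_star [tendsto_intros] = bounded_linear.tendsto[OF bounded_linear_star]
lemmas tendsto_scaleC [tendsto_intros] = bounded_linear.tendsto[OF bounded_linear_scaleC]

lemma norm_isometry: "star v * v = 1 \<Longrightarrow> norm (v::'a::cstar_algebra) = 1"
  using cstar_identity[of v] by (simp add: power2_eq_1_iff norm_not_less_zero)
    (metis norm_ge_zero not_one_le_zero neg_0_le_iff_le order.trans)

lemma norm_compress_le: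
  fixes p q x :: "'a::cstar_algebra"
  assumes "norm p \<le> 1" "norm q \<le> 1"
  shows "norm (star p * x * q) \<le> norm x"
proof -
  have "norm (star p * x * q) \<le> norm (star p) * norm x * norm q"
    by (meson norm_mult_ineq norm_ge_zero mult_right_mono order_trans)
  also have "\<dots> \<le> 1 * norm x * 1"
    using assms by (intro mult_mono) auto
  finally show ?thesis by simp
qed

lemma norm_one_compl_projection:
  fixes p :: "'a::cstar_algebra"
  assumes "star p = p" "p * p = p"
  shows "norm (1 - p) \<le> 1"
proof -
  have "star (1 - p) * (1 - p) = 1 - p"
    using assms by (simp add: star_diff algebra_simps)
  then have "norm (1 - p) = (norm (1 - p))\<^sup>2"
    by (metis cstar_identity)
  then have "norm (1 - p) = 0 \<or> norm (1 - p) = 1"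
    by (simp add: power2_eq_square)
  then show ?thesis by auto
qed

lemma scaleC_ii_square: "(\<i> *\<^sub>C x) * (\<i> *\<^sub>C x) = - (x * (x::'a::cstar_algebra))"
  by (simp add: mult_scaleC_left mult_scaleC_right scaleC_scaleC scaleC_minus1)

lemma scaleR_num:
  fixes x :: "'a::real_vector"
  shows "2 *\<^sub>R x = x + x" "3 *\<^sub>R x = x + x + x" "4 *\<^sub>R x = x + x + x + x"
    "6 *\<^sub>R x = x + x + x + x + x + x"
  using scaleR_add_left[of 1 1 x] scaleR_add_left[of 2 1 x] scaleR_add_left[of 2 2 x]
    scaleR_add_left[of 4 2 x]
  by simp_all

lemma norm_mult_le_1: "norm x \<le> 1 \<Longrightarrow> norm y \<le> 1 \<Longrightarrow> norm (x * y) \<le> 1"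
  for x y :: "'a::real_normed_algebra"
  using norm_mult_ineq[of x y] mult_le_one[of "norm x" "norm y"] by simp

text \<open>The conclusion says that \<open>1\<close> is an extreme point of the unit ball. The map
  \<open>b \<mapsto> (3 b + b\<^sup>3) / 2\<close> preserves the hypotheses, because \<open>1 + (3 b + b\<^sup>3) / 2\<close> is the convex
  combination of \<open>(1 + b)\<^sup>3\<close> and \<open>(1 \<plusminus> \<i> b)\<^sup>3\<close> with weights \<open>1/2\<close>, \<open>1/4\<close>, \<open>1/4\<close>, and it expands
  norms by a factor of at least \<open>11/8\<close>; but the norms stay bounded.\<close>

lemma selfadjoint_eq_0:
  fixes b :: "'a::cstar_algebra"
  assumes "star b = b" "norm (1 + b) \<le> 1" "norm (1 - b) \<le> 1"
  shows "b = 0"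
proof -
  define K where "K = {b::'a. star b = b \<and> norm (1 + b) \<le> 1 \<and> norm (1 - b) \<le> 1}"
  define g where "g b = (1/2) *\<^sub>R (3 *\<^sub>R b + b * b * b)" for b :: 'a
  have half: "norm b \<le> 1/2" if "b \<in> K" for b
  proof -
    have e: "4 *\<^sub>R b = (1 + b) * (1 + b) - (1 - b) * (1 - b)"
      by (simp add: algebra_simps scaleR_num)
    have "norm ((1 + b) * (1 + b)) \<le> 1" "norm ((1 - b) * (1 - b)) \<le> 1"
      using that unfolding K_def by (auto intro: norm_mult_le_1)
    then have "norm (4 *\<^sub>R b) \<le> 2"
      unfolding e by (intro order_trans[OF norm_triangle_ineq4]) auto
    then show ?thesis by simp
  qed
  have key: "norm (1 + g b) \<le> 1" if "star b = b" "norm (1 + b) \<le> 1" "norm (1 - b) \<le> 1" for b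
  proof -
    have n2: "norm (x * x) \<le> 1" "norm (x * x * x) \<le> 1" if "norm x \<le> 1" for x :: 'a
      using that by (auto intro!: norm_mult_le_1)
    have e1: "2 *\<^sub>R (1 + b * b) = (1 + b) * (1 + b) + (1 - b) * (1 - b)"
      by (simp add: algebra_simps scaleR_2)
    have "norm (2 *\<^sub>R (1 + b * b)) \<le> 1 + 1"
      unfolding e1 using that by (intro norm_triangle_mono n2(1))
    then have b2: "norm (1 + b * b) \<le> 1" by simp
    define c where "c = \<i> *\<^sub>C b"
    have cc: "c * c = - (b * b)" unfolding c_def by (rule scaleC_ii_square)
    have sc: "star c = - c"
      using that(1) by (simp add: c_def star_scaleC complex_vector.scale_minus_left)
    have "star (1 + c) * (1 + c) = 1 + b * b" "star (1 - c) * (1 - c) = 1 + b * b"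
      by (simp_all add: star_simps sc algebra_simps cc)
    then have "(norm (1 + c))\<^sup>2 \<le> 1" "(norm (1 - c))\<^sup>2 \<le> 1"
      using b2 by (simp_all only: cstar_identity[symmetric])
    then have c1: "norm (1 + c) \<le> 1" "norm (1 - c) \<le> 1"
      by (simp_all add: abs_square_le_1)
    have e: "4 *\<^sub>R (1 + g b) = 2 *\<^sub>R ((1 + b) * (1 + b) * (1 + b))
        + ((1 + c) * (1 + c) * (1 + c) + (1 - c) * (1 - c) * (1 - c))" (is "_ = _ + ?r")
    proof -
      have c3: "?r = 2 *\<^sub>R 1 + 6 *\<^sub>R (c * c)"
        by (simp add: algebra_simps scaleR_num)
      show ?thesis unfolding c3 cc g_def
        by (simp add: algebra_simps scaleR_num)
    qed
    have "norm (4 *\<^sub>R (1 + g b)) \<le> 2 * 1 + (1 + 1)"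
      unfolding e using n2(2)[OF that(2)] n2(2)[OF c1(1)] n2(2)[OF c1(2)]
      by (intro norm_triangle_mono) auto
    then show ?thesis by simp
  qed
  have gK: "g b \<in> K" if "b \<in> K" for b
  proof -
    have "star (g b) = g b"
      using that by (simp add: K_def g_def scaleR_scaleC star_simps algebra_simps)
    moreover have "g (- b) = - g b" by (simp add: g_def algebra_simps)
    moreover have "norm (1 + g (- b)) \<le> 1"
      using that by (intro key) (auto simp: K_def star_minus)
    ultimately show ?thesis using that key[of b] by (simp add: K_def)
  qed
  have grow: "norm (g b) \<ge> 11/8 * norm b" if "b \<in> K" for b
  proof -
    have h: "norm b \<le> 1/2" by (rule half[OF that])
    have "norm (b * b * b) \<le> norm b * norm b * norm b"
      by (meson norm_mult_ineq norm_ge_zero mult_right_mono order_trans)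
    also have "\<dots> \<le> (1/2) * (1/2) * norm b"
      using h by (intro mult_mono) auto
    finally have "norm (b * b * b) \<le> 1/4 * norm b" by simp
    moreover have "norm (3 *\<^sub>R b) - norm (b * b * b) \<le> norm (3 *\<^sub>R b + b * b * b)"
      by (rule norm_diff_ineq)
    ultimately show ?thesis by (simp add: g_def)
  qed
  have it: "(g ^^ k) b \<in> K \<and> norm ((g ^^ k) b) \<ge> (11/8) ^ k * norm b" for k
  proof (induction k)
    case 0 then show ?case using assms by (simp add: K_def)
  next
    case (Suc k)
    then have "norm (g ((g ^^ k) b)) \<ge> 11/8 * ((11/8) ^ k * norm b)"
      using grow[of "(g ^^ k) b"] by linarith
    then show ?case using Suc gK by simp
  qed
  show ?thesis
  proof (rule ccontr)
    assume "b \<noteq> 0"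
    then obtain k where "1 / norm b < (11/8) ^ k"
      using real_arch_pow[of "11/8" "1 / norm b"] by auto
    then have "1 < (11/8) ^ k * norm b" using \<open>b \<noteq> 0\<close> by (simp add: field_simps)
    then show False using it[of k] half[of "(g ^^ k) b"] by linarith
  qed
qed

section \<open>The shift and the homogeneous elements\<close>

lemma cstar_generated_superset: "X \<subseteq> cstar_generated X"
  unfolding cstar_generated_def by (rule hull_subset)

lemma cstar_generated_least: "X \<subseteq> A \<Longrightarrow> cstar_subalgebra A \<Longrightarrow> cstar_generated X \<subseteq> A"
  unfolding cstar_generated_def by (rule hull_minimal)

lemma cstar_subalgebra_Inter:
  assumes "\<forall>A\<in>T. cstar_subalgebra A"
  shows "cstar_subalgebra (\<Inter>T)"
proof -
  have *: "0 \<in> A" "x \<in> A \<Longrightarrow> y \<in> A \<Longrightarrow> x + y \<in> A" "x \<in> A \<Longrightarrow> c *\<^sub>C x \<in> A"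
    "x \<in> A \<Longrightarrow> y \<in> A \<Longrightarrow> x * y \<in> A" "x \<in> A \<Longrightarrow> star x \<in> A" "closed A"
    if "A \<in> T" for A c x y
    using assms that by (simp_all add: cstar_subalgebra_def)
  show ?thesis
    unfolding cstar_subalgebra_def by (intro conjI ballI allI closed_Inter InterI) (simp_all add: *)
qed

lemma cstar_subalgebra_generated: "cstar_subalgebra (cstar_generated X)"
  unfolding cstar_generated_def by (rule hull_in[where S = cstar_subalgebra]) (rule cstar_subalgebra_Inter)

lemma word_isometry_simps [simp]:
  "word_isometry S [] = 1"
  "word_isometry S (i # \<mu>) = S i * word_isometry S \<mu>"
  "word_isometry S (\<mu> @ \<nu>) = word_isometry S \<mu> * word_isometry S \<nu>"
  by (simp_all add: word_isometry_def)

locale cuntz_family =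
  fixes n :: nat and S :: "nat \<Rightarrow> 'a::cstar_algebra" and B :: "'a set"
  assumes n_ge_2: "2 \<le> n" and cuntz: "is_cuntz_algebra n S B"
begin

definition idx :: "nat set" where "idx = {1..n}"

lemma idx [simp]: "finite idx" "card idx = n" "1 \<in> idx" "Suc 0 \<in> idx" "2 \<in> idx"
  using n_ge_2 by (simp_all add: idx_def)

lemma isometry [simp]: "i \<in> idx \<Longrightarrow> star (S i) * S i = 1"
  and sum_ranges: "(\<Sum>i\<in>idx. S i * star (S i)) = 1"
  and B_eq: "B = cstar_generated (S ` idx)"
  and simple: "simple_cstar_algebra B"
  using cuntz unfolding is_cuntz_algebra_def idx_def by blast+

lemma isometry_assoc [simp]: "i \<in> idx \<Longrightarrow> star (S i) * (S i * x) = x"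
  by (simp flip: mult.assoc)

lemma subalgebra_B: "cstar_subalgebra B"
  unfolding B_eq by (rule cstar_subalgebra_generated)

lemma B_closed_under:
  "0 \<in> B" "x \<in> B \<Longrightarrow> y \<in> B \<Longrightarrow> x + y \<in> B" "x \<in> B \<Longrightarrow> c *\<^sub>C x \<in> B"
  "x \<in> B \<Longrightarrow> y \<in> B \<Longrightarrow> x * y \<in> B" "x \<in> B \<Longrightarrow> star x \<in> B"
  and closed_B: "closed B"
  using subalgebra_B by (simp_all add: cstar_subalgebra_def)

lemma B_generator: "i \<in> idx \<Longrightarrow> S i \<in> B"
  using cstar_generated_superset[of "S ` idx"] by (auto simp: B_eq)

lemma B_one: "1 \<in> B"
proof -
  have "star (S 1) * S 1 \<in> B" by (intro B_closed_under(4,5) B_generator idx)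
  then show ?thesis by simp
qed

lemma B_diff: "x \<in> B \<Longrightarrow> y \<in> B \<Longrightarrow> x - y \<in> B"
  using B_closed_under(2)[OF _ B_closed_under(3), of x y "-1"] by (simp add: scaleC_minus1)

lemma B_sum: "(\<And>i. i \<in> I \<Longrightarrow> f i \<in> B) \<Longrightarrow> sum f I \<in> B"
  by (induction I rule: infinite_finite_induct) (simp_all add: B_closed_under(1,2))

lemmas B_intros = B_closed_under B_generator B_one B_diff B_sum

text \<open>Orthogonality of the ranges is not among the Cuntz relations; it is forced by the
  C*-identity: \<open>a = S\<^sub>i\<^sup>* P\<^sub>j S\<^sub>i\<close> and the sum \<open>- a\<close> of the remaining compressions
  are both positive.\<close>

lemma orthogonal:
  assumes i: "i \<in> idx" and j: "j \<in> idx" and "i \<noteq> j"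
  shows "star (S i) * S j = 0"
proof -
  define P where "P l = S l * star (S l)" for l
  define a where "a l = star (S i) * P l * S i" for l
  have P: "star (P l) = P l" "P l * P l = P l" if "l \<in> idx" for l
    using that by (simp_all add: P_def star_simps mult.assoc)
  have a1: "norm (1 - a l) \<le> 1" if "l \<in> idx" for l
  proof -
    have "1 - a l = star (S i) * (1 - P l) * S i"
      using i by (simp add: a_def algebra_simps)
    then show ?thesis
      using norm_compress_le[of "S i" "S i" "1 - P l"] norm_isometry[OF isometry[OF i]]
        norm_one_compl_projection[OF P[OF that]] by simp
  qed
  have ai: "a i = 1" using i by (simp add: a_def P_def mult.assoc)
  define m where "m = n - 2"
  let ?I = "idx - {i} - {j}"
  have card: "card ?I = m" using assms by (simp add: m_def)
  have "(\<Sum>l\<in>idx. a l) = star (S i) * (\<Sum>l\<in>idx. P l) * S i"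
    by (simp add: a_def sum_distrib_left sum_distrib_right)
  also have "\<dots> = 1" using i by (simp add: P_def sum_ranges)
  finally have "a i + (a j + sum a ?I) = 1"
    using assms by (subst sum.remove[symmetric], simp, simp)+
  then have neg: "sum a ?I = - a j" unfolding ai by (simp add: eq_neg_iff_add_eq_0 add.commute)
  have "norm (\<Sum>l\<in>?I. 1 - a l) \<le> real (card ?I) * 1"
    by (rule sum_norm_bound) (auto intro: a1)
  then have m: "norm (of_nat m + a j) \<le> m"
    by (simp add: sum_subtractf neg card)
  have "a j = 0"
  proof (cases "m = 0")
    case True then show ?thesis using m by simp
  next
    case False
    define b where "b = (1 / m) *\<^sub>R a j"
    have "star b = b"
      by (simp add: b_def a_def P_def scaleR_scaleC star_simps mult.assoc)
    moreover have "norm (1 + b) \<le> 1"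
    proof -
      have r: "(of_nat m :: 'a) = real m *\<^sub>R 1" by (simp add: scaleR_conv_of_real)
      have "1 + b = (1 / m) *\<^sub>R (of_nat m + a j)"
        using False unfolding b_def r by (simp add: scaleR_add_right)
      then have "norm (1 + b) = (1 / m) * norm (of_nat m + a j)" by (simp only: norm_scaleR) simp
      also have "\<dots> \<le> (1 / m) * m" using m by (intro mult_left_mono) auto
      finally show ?thesis using False by simp
    qed
    moreover have "norm (1 - b) \<le> 1"
    proof -
      have "1 - b = (1 - 1 / m) *\<^sub>R 1 + (1 / m) *\<^sub>R (1 - a j)"
        by (simp add: b_def algebra_simps)
      also have "norm \<dots> \<le> (1 - 1 / m) * 1 + (1 / m) * 1"
        using False a1[OF j] by (intro norm_triangle_mono) (auto simp: divide_simps)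
      finally show ?thesis by simp
    qed
    ultimately have "b = 0" by (rule selfadjoint_eq_0)
    then show ?thesis using False by (simp add: b_def)
  qed
  then have "star (star (star (S i) * S j)) * star (star (S i) * S j) = 0"
    by (simp add: a_def P_def star_simps mult.assoc)
  then have "norm (star (star (S i) * S j)) = 0"
    using cstar_identity[of "star (star (S i) * S j)"] by simp
  then show ?thesis by simp
qed

lemma S_star_S: "i \<in> idx \<Longrightarrow> j \<in> idx \<Longrightarrow> star (S i) * S j = (if i = j then 1 else 0)"
  using orthogonal by auto

lemma S_star_S_assoc:
  "i \<in> idx \<Longrightarrow> j \<in> idx \<Longrightarrow> star (S i) * (S j * x) = (if i = j then x else 0)"
  using S_star_S[of i j] by (simp flip: mult.assoc)

definition words :: "nat \<Rightarrow> nat list set" where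
  "words k = {\<mu>. set \<mu> \<subseteq> idx \<and> length \<mu> = k}"

lemma words_0 [simp]: "words 0 = {[]}"
  by (auto simp: words_def)

lemma finite_words [simp]: "finite (words k)"
  unfolding words_def by (rule finite_lists_length_eq) (rule idx)

lemma Cons_in_words [simp]: "i # \<mu> \<in> words (Suc k) \<longleftrightarrow> i \<in> idx \<and> \<mu> \<in> words k"
  by (auto simp: words_def)

lemma words_SucE:
  assumes "\<mu> \<in> words (Suc k)"
  obtains i \<nu> where "\<mu> = i # \<nu>" "i \<in> idx" "\<nu> \<in> words k"
  using assms by (cases \<mu>) (auto simp: words_def)

lemma sum_words_Suc: "(\<Sum>\<mu>\<in>words (Suc k). f \<mu>) = (\<Sum>i\<in>idx. \<Sum>\<mu>\<in>words k. f (i # \<mu>))"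
proof -
  have "(\<Sum>i\<in>idx. \<Sum>\<mu>\<in>words k. f (i # \<mu>)) = (\<Sum>(i, \<mu>)\<in>idx \<times> words k. f (i # \<mu>))"
    by (rule sum.cartesian_product)
  also have "\<dots> = (\<Sum>\<mu>\<in>words (Suc k). f \<mu>)"
    by (rule sum.reindex_bij_witness[where i = "\<lambda>\<mu>. (hd \<mu>, tl \<mu>)" and j = "\<lambda>(i, \<mu>). i # \<mu>"])
      (auto elim!: words_SucE)
  finally show ?thesis ..
qed

abbreviation sw :: "nat list \<Rightarrow> 'a" where "sw \<equiv> word_isometry S"

lemma B_word: "\<mu> \<in> words k \<Longrightarrow> sw \<mu> \<in> B"
  by (induction \<mu> arbitrary: k) (auto simp: words_def intro!: B_intros)

lemma word_star_word:
  "\<mu> \<in> words k \<Longrightarrow> \<nu> \<in> words k \<Longrightarrow> star (sw \<mu>) * sw \<nu> = (if \<mu> = \<nu> then 1 else 0)"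
proof (induction k arbitrary: \<mu> \<nu>)
  case (Suc k)
  obtain i \<mu>' where \<mu>: "\<mu> = i # \<mu>'" "i \<in> idx" "\<mu>' \<in> words k"
    using Suc.prems(1) by (rule words_SucE)
  obtain j \<nu>' where \<nu>: "\<nu> = j # \<nu>'" "j \<in> idx" "\<nu>' \<in> words k"
    using Suc.prems(2) by (rule words_SucE)
  show ?case using Suc.IH[OF \<mu>(3) \<nu>(3)] \<mu>(1,2) \<nu>(1,2)
    by (auto simp: star_simps mult.assoc S_star_S_assoc)
qed simp

lemma word_star_word_assoc:
  "\<mu> \<in> words k \<Longrightarrow> \<nu> \<in> words k \<Longrightarrow> star (sw \<mu>) * (sw \<nu> * x) = (if \<mu> = \<nu> then x else 0)"
  using word_star_word[of \<mu> k \<nu>] by (simp flip: mult.assoc)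

lemma norm_word: "\<mu> \<in> words k \<Longrightarrow> norm (sw \<mu>) = 1"
  by (rule norm_isometry) (simp add: word_star_word)

definition shift :: "'a \<Rightarrow> 'a" where
  "shift y = (\<Sum>i\<in>idx. S i * y * star (S i))"

abbreviation sh :: "nat \<Rightarrow> 'a \<Rightarrow> 'a" where "sh k \<equiv> shift ^^ k"

lemma shift_S: "i \<in> idx \<Longrightarrow> shift y * S i = S i * y"
proof -
  assume i: "i \<in> idx"
  have "shift y * S i = (\<Sum>j\<in>idx. if j = i then S j * y else 0)"
    unfolding shift_def sum_distrib_right
    by (rule sum.cong) (auto simp: mult.assoc S_star_S i orthogonal)
  also have "\<dots> = S i * y" using i by (simp add: sum.delta)
  finally show ?thesis .
qed

lemma star_shift: "star (shift y) = shift (star y)"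
  by (simp add: shift_def star_simps mult.assoc)

lemma S_star_shift: "i \<in> idx \<Longrightarrow> star (S i) * shift y = y * star (S i)"
  using arg_cong[OF shift_S[of i "star y"], of star] by (simp add: star_simps star_shift)

lemma shift_one: "shift 1 = 1"
  by (simp add: shift_def sum_ranges)

lemma shift_mult: "shift (x * y) = shift x * shift y"
proof -
  have "shift x * shift y = (\<Sum>i\<in>idx. shift x * S i * y * star (S i))"
    by (simp add: shift_def[of y] sum_distrib_left mult.assoc)
  also have "\<dots> = shift (x * y)"
    unfolding shift_def[of "x * y"] by (rule sum.cong) (simp_all add: shift_S mult.assoc)
  finally show ?thesis ..
qed

lemma shift_add: "shift (x + y) = shift x + shift y"
  by (simp add: shift_def distrib_left distrib_right sum.distrib)

lemma shift_scaleC: "shift (c *\<^sub>C x) = c *\<^sub>C shift x"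
  by (simp add: shift_def mult_scaleC_left mult_scaleC_right complex_vector.scale_sum_right)

lemma shift_diff: "shift (x - y) = shift x - shift y"
  by (simp add: shift_def algebra_simps sum_subtractf)

lemma shift_zero: "shift 0 = 0"
  by (simp add: shift_def)

lemma sh_hom:
  "sh k 1 = 1" "sh k 0 = 0" "sh k (x * y) = sh k x * sh k y" "sh k (x + y) = sh k x + sh k y"
  "sh k (x - y) = sh k x - sh k y" "sh k (c *\<^sub>C x) = c *\<^sub>C sh k x" "star (sh k x) = sh k (star x)"
  by (induction k)
    (simp_all add: shift_one shift_zero shift_mult shift_add shift_diff shift_scaleC star_shift)

lemma sh_sh: "sh j (sh k x) = sh (j + k) x"
  by (simp add: funpow_add)

lemma sh_word: "\<mu> \<in> words k \<Longrightarrow> sh k y * sw \<mu> = sw \<mu> * y"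
proof (induction k arbitrary: \<mu>)
  case (Suc k)
  from Suc.prems obtain i \<nu> where \<mu>: "\<mu> = i # \<nu>" "i \<in> idx" "\<nu> \<in> words k" by (rule words_SucE)
  have "sh (Suc k) y * sw \<mu> = shift (sh k y) * S i * sw \<nu>" by (simp add: \<mu>(1) mult.assoc)
  also have "\<dots> = S i * (sh k y * sw \<nu>)" by (simp add: shift_S \<mu>(2) flip: mult.assoc)
  also have "\<dots> = sw \<mu> * y" using Suc.IH[OF \<mu>(3)] by (simp add: \<mu>(1) mult.assoc)
  finally show ?case .
qed simp

lemma word_star_sh: "\<mu> \<in> words k \<Longrightarrow> star (sw \<mu>) * sh k y = y * star (sw \<mu>)"
  using arg_cong[OF sh_word[of \<mu> k "star y"], of star] by (simp add: star_simps sh_hom)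

lemma sum_word_projections: "(\<Sum>\<mu>\<in>words k. sw \<mu> * star (sw \<mu>)) = 1"
proof (induction k)
  case (Suc k)
  have "(\<Sum>\<mu>\<in>words (Suc k). sw \<mu> * star (sw \<mu>))
      = (\<Sum>i\<in>idx. S i * (\<Sum>\<mu>\<in>words k. sw \<mu> * star (sw \<mu>)) * star (S i))"
    by (simp add: sum_words_Suc sum_distrib_left sum_distrib_right star_simps mult.assoc)
  then show ?case by (simp add: Suc sum_ranges)
qed simp

lemma word_expansion:
  "x = (\<Sum>\<mu>\<in>words a. \<Sum>\<nu>\<in>words b. sw \<mu> * (star (sw \<mu>) * x * sw \<nu>) * star (sw \<nu>))"
proof -
  have "x = (\<Sum>\<mu>\<in>words a. sw \<mu> * star (sw \<mu>)) * x * (\<Sum>\<nu>\<in>words b. sw \<nu> * star (sw \<nu>))"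
    by (simp add: sum_word_projections)
  also have "\<dots> = (\<Sum>\<mu>\<in>words a. \<Sum>\<nu>\<in>words b. sw \<mu> * (star (sw \<mu>) * x * sw \<nu>) * star (sw \<nu>))"
    by (simp add: sum_distrib_left sum_distrib_right mult.assoc) (rule sum.swap)
  finally show ?thesis .
qed

definition scalars :: "'a set" where "scalars = range (\<lambda>c. c *\<^sub>C 1)"

lemma scalarsI: "x = c *\<^sub>C 1 \<Longrightarrow> x \<in> scalars"
  by (simp add: scalars_def)

lemma scalarsE: "x \<in> scalars \<Longrightarrow> (\<And>c. x = c *\<^sub>C 1 \<Longrightarrow> P) \<Longrightarrow> P"
  by (auto simp: scalars_def)

lemma scalars_closed_under:
  "0 \<in> scalars" "x \<in> scalars \<Longrightarrow> y \<in> scalars \<Longrightarrow> x + y \<in> scalars"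
  "x \<in> scalars \<Longrightarrow> y \<in> scalars \<Longrightarrow> x * y \<in> scalars" "x \<in> scalars \<Longrightarrow> star x \<in> scalars"
  "x \<in> scalars \<Longrightarrow> c *\<^sub>C x \<in> scalars"
proof -
  show "0 \<in> scalars" by (rule scalarsI[of _ 0]) simp
  show "x + y \<in> scalars" if "x \<in> scalars" "y \<in> scalars"
    using that by (elim scalarsE) (rule scalarsI, simp only: scaleC_add_left[symmetric])
  show "x * y \<in> scalars" if "x \<in> scalars" "y \<in> scalars"
    using that by (elim scalarsE) (rule scalarsI, simp only: mult_scaleC_left scaleC_scaleC mult_1_left)
  show "star x \<in> scalars" if "x \<in> scalars"
    using that by (elim scalarsE) (rule scalarsI, simp only: star_scaleC star_one)
  show "c *\<^sub>C x \<in> scalars" if "x \<in> scalars"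
    using that by (elim scalarsE) (rule scalarsI, simp only: scaleC_scaleC)
qed

lemma one_in_scalars: "1 \<in> scalars"
  by (rule scalarsI[of _ 1]) (simp add: scaleC_one)

lemma scalars_sum: "(\<And>i. i \<in> I \<Longrightarrow> f i \<in> scalars) \<Longrightarrow> sum f I \<in> scalars"
  by (induction I rule: infinite_finite_induct) (auto intro: scalars_closed_under)

lemma scalars_commute: "c \<in> scalars \<Longrightarrow> c * x = x * c"
  by (auto simp: scalars_def mult_scaleC_left mult_scaleC_right)

text \<open>The span of the \<open>S\<^sub>\<mu> S\<^sub>\<nu>\<^sup>*\<close> with \<open>|\<mu>| = a\<close> and \<open>|\<nu>| = b\<close>, described by the
  matrix coefficients of its elements.\<close>

definition hom :: "nat \<Rightarrow> nat \<Rightarrow> 'a set" where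
  "hom a b = {x. \<forall>\<mu>\<in>words a. \<forall>\<nu>\<in>words b. star (sw \<mu>) * x * sw \<nu> \<in> scalars}"

lemma homD: "x \<in> hom a b \<Longrightarrow> \<mu> \<in> words a \<Longrightarrow> \<nu> \<in> words b \<Longrightarrow> star (sw \<mu>) * x * sw \<nu> \<in> scalars"
  by (simp add: hom_def)

lemma hom_subset_B: "hom a b \<subseteq> B"
proof
  fix x assume x: "x \<in> hom a b"
  have c: "c \<in> scalars \<Longrightarrow> c \<in> B" for c by (auto simp: scalars_def intro!: B_intros)
  have "(\<Sum>\<mu>\<in>words a. \<Sum>\<nu>\<in>words b. sw \<mu> * (star (sw \<mu>) * x * sw \<nu>) * star (sw \<nu>)) \<in> B"
    by (intro B_sum B_closed_under(4)[OF B_closed_under(4)[OF B_word c[OF homD[OF x]]]]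
        B_closed_under(5)[OF B_word])
  then show "x \<in> B" by (simp only: word_expansion[symmetric])
qed

lemma hom_intertwines:
  assumes "x \<in> hom a b"
  shows "x * sh b y = sh a y * x"
proof -
  have "x * sh b y =
      (\<Sum>\<mu>\<in>words a. \<Sum>\<nu>\<in>words b. sw \<mu> * (star (sw \<mu>) * x * sw \<nu>) * (star (sw \<nu>) * sh b y))"
    by (subst word_expansion[where x = x and a = a and b = b]) (simp only: sum_distrib_right mult.assoc)
  also have "\<dots> =
      (\<Sum>\<mu>\<in>words a. \<Sum>\<nu>\<in>words b. sh a y * (sw \<mu> * (star (sw \<mu>) * x * sw \<nu>) * star (sw \<nu>)))"
  proof (intro sum.cong refl)
    fix \<mu> \<nu> assume \<mu>: "\<mu> \<in> words a" and \<nu>: "\<nu> \<in> words b"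
    let ?c = "star (sw \<mu>) * x * sw \<nu>"
    have "sw \<mu> * ?c * (star (sw \<nu>) * sh b y) = sw \<mu> * (?c * y) * star (sw \<nu>)"
      by (simp add: word_star_sh[OF \<nu>] mult.assoc)
    also have "?c * y = y * ?c" by (rule scalars_commute[OF homD[OF assms \<mu> \<nu>]])
    also have "sw \<mu> * (y * ?c) = sh a y * sw \<mu> * ?c" by (simp add: sh_word[OF \<mu>] mult.assoc)
    finally show "sw \<mu> * ?c * (star (sw \<nu>) * sh b y) = sh a y * (sw \<mu> * ?c * star (sw \<nu>))"
      by (simp add: mult.assoc)
  qed
  also have "\<dots> = sh a y * x"
    by (simp only: sum_distrib_left[symmetric] word_expansion[symmetric])
  finally show ?thesis .
qed

lemma hom_intertwines_shifted: "x \<in> hom a b \<Longrightarrow> x * sh (b + t) y = sh (a + t) y * x"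
  using hom_intertwines[of x a b "sh t y"] by (simp add: sh_sh)

lemma hom_star:
  assumes "x \<in> hom a b"
  shows "star x \<in> hom b a"
  unfolding hom_def
proof (intro CollectI ballI)
  fix \<mu> \<nu> assume "\<mu> \<in> words b" "\<nu> \<in> words a"
  then have "star (star (sw \<nu>) * x * sw \<mu>) \<in> scalars"
    by (intro scalars_closed_under(4) homD[OF assms])
  then show "star (sw \<mu>) * star x * sw \<nu> \<in> scalars"
    by (simp add: star_simps mult.assoc)
qed

lemma hom_add: "x \<in> hom a b \<Longrightarrow> y \<in> hom a b \<Longrightarrow> x + y \<in> hom a b"
  by (simp add: hom_def distrib_left distrib_right scalars_closed_under)

lemma hom_zero: "0 \<in> hom a b"
  by (simp add: hom_def scalars_closed_under)

lemma hom_scaleC: "x \<in> hom a b \<Longrightarrow> c *\<^sub>C x \<in> hom a b"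
  by (simp add: hom_def mult_scaleC_left mult_scaleC_right scalars_closed_under)

lemma hom_mult:
  assumes x: "x \<in> hom a b" and y: "y \<in> hom b c"
  shows "x * y \<in> hom a c"
  unfolding hom_def
proof (intro CollectI ballI)
  fix \<mu> \<nu> assume \<mu>: "\<mu> \<in> words a" and \<nu>: "\<nu> \<in> words c"
  have "star (sw \<mu>) * (x * y) * sw \<nu>
      = star (sw \<mu>) * x * (\<Sum>\<beta>\<in>words b. sw \<beta> * star (sw \<beta>)) * y * sw \<nu>"
    by (simp add: sum_word_projections mult.assoc)
  also have "\<dots> = (\<Sum>\<beta>\<in>words b. (star (sw \<mu>) * x * sw \<beta>) * (star (sw \<beta>) * y * sw \<nu>))"
    by (simp add: sum_distrib_left sum_distrib_right mult.assoc)
  also have "\<dots> \<in> scalars"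
    using \<mu> \<nu> by (intro scalars_sum scalars_closed_under homD[OF x] homD[OF y])
  finally show "star (sw \<mu>) * (x * y) * sw \<nu> \<in> scalars" .
qed

lemma words_snocE:
  assumes "\<mu> \<in> words (Suc k)"
  obtains i \<nu> where "\<mu> = \<nu> @ [i]" "i \<in> idx" "\<nu> \<in> words k"
  using assms by (cases \<mu> rule: rev_cases) (auto simp: words_def)

lemma hom_Suc:
  assumes x: "x \<in> hom a b"
  shows "x \<in> hom (Suc a) (Suc b)"
  unfolding hom_def
proof (intro CollectI ballI)
  fix \<mu> \<nu> assume \<mu>: "\<mu> \<in> words (Suc a)" and \<nu>: "\<nu> \<in> words (Suc b)"
  obtain i \<alpha> where i: "\<mu> = \<alpha> @ [i]" "i \<in> idx" "\<alpha> \<in> words a" using \<mu> by (rule words_snocE)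
  obtain j \<beta> where j: "\<nu> = \<beta> @ [j]" "j \<in> idx" "\<beta> \<in> words b" using \<nu> by (rule words_snocE)
  let ?c = "star (sw \<alpha>) * x * sw \<beta>"
  have c: "?c \<in> scalars" using i j by (intro homD[OF x])
  have "star (sw \<mu>) * x * sw \<nu> = star (S i) * (?c * S j)"
    using i(1) j(1) by (simp add: star_simps mult.assoc)
  also have "?c * S j = S j * ?c" by (rule scalars_commute[OF c])
  also have "star (S i) * (S j * ?c) = star (S i) * S j * ?c" by (rule mult.assoc[symmetric])
  also have "\<dots> \<in> scalars"
    using i(2) j(2) c by (simp add: S_star_S scalars_closed_under(1))
  finally show "star (sw \<mu>) * x * sw \<nu> \<in> scalars" .
qed

lemma hom_raise: "x \<in> hom a b \<Longrightarrow> x \<in> hom (a + t) (b + t)"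
  by (induction t) (auto intro: hom_Suc)

lemma word_hom: "\<mu> \<in> words k \<Longrightarrow> sw \<mu> \<in> hom k 0"
  unfolding hom_def by (auto simp: word_star_word scalars_closed_under(1) one_in_scalars)

lemma S_hom: "i \<in> idx \<Longrightarrow> S i \<in> hom 1 0"
  using word_hom[of "[i]" 1] by simp

lemma one_hom: "1 \<in> hom a a"
  unfolding hom_def by (auto simp: word_star_word scalars_closed_under(1) one_in_scalars)

lemma sh_hom_Suc: "x \<in> hom a b \<Longrightarrow> sh k x \<in> hom (a + k) (b + k)"
proof (induction k)
  case (Suc k)
  then have x: "sh k x \<in> hom (a + k) (b + k)" by simp
  have "star (sw \<mu>) * shift (sh k x) * sw \<nu> \<in> scalars"
    if m: "\<mu> \<in> words (Suc (a + k))" "\<nu> \<in> words (Suc (b + k))" for \<mu> \<nu>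
  proof -
    obtain i \<alpha> where i: "\<mu> = i # \<alpha>" "i \<in> idx" "\<alpha> \<in> words (a + k)" using m(1) by (rule words_SucE)
    obtain j \<beta> where j: "\<nu> = j # \<beta>" "j \<in> idx" "\<beta> \<in> words (b + k)" using m(2) by (rule words_SucE)
    have "star (sw \<mu>) * shift (sh k x) * sw \<nu> = star (sw \<alpha>) * (star (S i) * (shift (sh k x) * S j)) * sw \<beta>"
      using i(1) j(1) by (simp add: star_simps mult.assoc)
    also have "\<dots> = (if i = j then star (sw \<alpha>) * sh k x * sw \<beta> else 0)"
      using i(2) j(2) by (simp add: shift_S S_star_S_assoc mult.assoc)
    finally show ?thesis using homD[OF x i(3) j(3)] by (simp add: scalars_closed_under(1))
  qed
  then show ?case by (simp add: hom_def)
qed simp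

end

lemma closed_null:
  fixes L :: "nat \<Rightarrow> 'a::real_normed_vector \<Rightarrow> 'b::real_normed_vector"
  assumes C: "closed C"
    and lip: "\<And>k x y. x \<in> C \<Longrightarrow> y \<in> C \<Longrightarrow> norm (L k x - L k y) \<le> K * norm (x - y)"
  shows "closed {x \<in> C. (\<lambda>k. L k x) \<longlonglongrightarrow> 0}"
  unfolding closed_sequential_limits
proof (intro allI impI, elim conjE)
  fix X l assume X: "\<forall>i. X i \<in> {x \<in> C. (\<lambda>k. L k x) \<longlonglongrightarrow> 0}" and l: "X \<longlonglongrightarrow> l"
  have lC: "l \<in> C" using C X l unfolding closed_sequential_limits by blast
  have "(\<lambda>k. L k l) \<longlonglongrightarrow> 0"
  proof (rule LIMSEQ_I)
    fix e :: real assume e: "e > 0"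
    have "(\<lambda>i. K * norm (l - X i)) \<longlonglongrightarrow> K * norm (l - l)" by (intro tendsto_intros l)
    then have "\<forall>\<^sub>F i in sequentially. K * norm (l - X i) < e / 2"
      using e by (intro order_tendstoD(2)) auto
    then obtain i where i: "K * norm (l - X i) < e / 2" by (auto simp: eventually_sequentially)
    have "(\<lambda>k. L k (X i)) \<longlonglongrightarrow> 0" using X by auto
    then obtain N where N: "\<And>k. k \<ge> N \<Longrightarrow> norm (L k (X i)) < e / 2"
      using LIMSEQ_D[of "\<lambda>k. L k (X i)" 0 "e / 2"] e by auto
    have "norm (L k l) < e" if "k \<ge> N" for k
    proof -
      have "norm (L k l) \<le> norm (L k l - L k (X i)) + norm (L k (X i))"
        by (metis diff_add_cancel norm_triangle_ineq)
      also have "norm (L k l - L k (X i)) \<le> K * norm (l - X i)" using lC X by (intro lip) auto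
      finally show ?thesis using i N[OF that] by linarith
    qed
    then show "\<exists>N. \<forall>k\<ge>N. norm (L k l - 0) < e" by auto
  qed
  then show "l \<in> {x \<in> C. (\<lambda>k. L k x) \<longlonglongrightarrow> 0}" using lC by simp
qed

lemma closed_convergent:
  fixes L :: "nat \<Rightarrow> 'a::real_normed_vector \<Rightarrow> 'b::banach"
  assumes C: "closed C"
    and lip: "\<And>k x y. x \<in> C \<Longrightarrow> y \<in> C \<Longrightarrow> norm (L k x - L k y) \<le> K * norm (x - y)"
  shows "closed {x \<in> C. convergent (\<lambda>k. L k x)}"
  unfolding closed_sequential_limits
proof (intro allI impI, elim conjE)
  fix X l assume X: "\<forall>i. X i \<in> {x \<in> C. convergent (\<lambda>k. L k x)}" and l: "X \<longlonglongrightarrow> l"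
  have lC: "l \<in> C" using C X l unfolding closed_sequential_limits by blast
  have "Cauchy (\<lambda>k. L k l)"
  proof (rule CauchyI)
    fix e :: real assume e: "e > 0"
    have "(\<lambda>i. K * norm (l - X i)) \<longlonglongrightarrow> K * norm (l - l)" by (intro tendsto_intros l)
    then have "\<forall>\<^sub>F i in sequentially. K * norm (l - X i) < e / 3"
      using e by (intro order_tendstoD(2)) auto
    then obtain i where i: "K * norm (l - X i) < e / 3" by (auto simp: eventually_sequentially)
    have "Cauchy (\<lambda>k. L k (X i))" using X by (auto intro: convergent_Cauchy)
    then obtain N where N: "\<And>j k. j \<ge> N \<Longrightarrow> k \<ge> N \<Longrightarrow> norm (L j (X i) - L k (X i)) < e / 3"
      using CauchyD[of "\<lambda>k. L k (X i)" "e / 3"] e by auto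
    have "norm (L j l - L k l) < e" if "j \<ge> N" "k \<ge> N" for j k
    proof -
      have b: "norm (L m l - L m (X i)) < e / 3" for m
        using lip[of l "X i" m] lC X i by force
      have "L j l - L k l = (L j l - L j (X i)) + (L j (X i) - L k (X i)) - (L k l - L k (X i))"
        by simp
      then have "norm (L j l - L k l)
          \<le> norm (L j l - L j (X i)) + norm (L j (X i) - L k (X i)) + norm (L k l - L k (X i))"
        by (metis (no_types) norm_triangle_ineq4 norm_triangle_ineq add_right_mono order_trans)
      then show ?thesis using b[of j] b[of k] N[OF that] by linarith
    qed
    then show "\<exists>N. \<forall>j\<ge>N. \<forall>k\<ge>N. norm (L j l - L k l) < e" by blast
  qed
  then show "l \<in> {x \<in> C. convergent (\<lambda>k. L k x)}" using lC by (simp add: Cauchy_convergent)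
qed

lemma compress_lipschitz:
  fixes p q x y :: "'a::cstar_algebra"
  assumes "norm p \<le> 1" "norm q \<le> 1"
  shows "norm (star p * x * q - star p * y * q) \<le> norm (x - y)"
  using norm_compress_le[OF assms, of "x - y"] by (simp add: algebra_simps)

lemma closureI_seq: "(\<And>i. X i \<in> A) \<Longrightarrow> X \<longlonglongrightarrow> x \<Longrightarrow> x \<in> closure A"
  for x :: "'a::metric_space"
  unfolding closure_sequential by blast

lemma cstar_subalgebra_closure:
  fixes A :: "'a::cstar_algebra set"
  assumes "0 \<in> A" and add: "\<And>x y. x \<in> A \<Longrightarrow> y \<in> A \<Longrightarrow> x + y \<in> A"
    and scale: "\<And>c x. x \<in> A \<Longrightarrow> c *\<^sub>C x \<in> A" and mult: "\<And>x y. x \<in> A \<Longrightarrow> y \<in> A \<Longrightarrow> x * y \<in> A"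
    and star: "\<And>x. x \<in> A \<Longrightarrow> star x \<in> A"
  shows "cstar_subalgebra (closure A)"
  unfolding cstar_subalgebra_def
proof (intro conjI ballI allI)
  show "0 \<in> closure A" using assms(1) closure_subset by blast
next
  fix x y assume x: "x \<in> closure A" and y: "y \<in> closure A"
  obtain X where X: "\<And>i. X i \<in> A" "X \<longlonglongrightarrow> x" using x unfolding closure_sequential by blast
  obtain Y where Y: "\<And>i. Y i \<in> A" "Y \<longlonglongrightarrow> y" using y unfolding closure_sequential by blast
  show "x + y \<in> closure A"
    using add[OF X(1) Y(1)] tendsto_add[OF X(2) Y(2)] by (rule closureI_seq)
  show "x * y \<in> closure A"
    using mult[OF X(1) Y(1)] tendsto_mult[OF X(2) Y(2)] by (rule closureI_seq)
next
  fix c x assume "x \<in> closure A"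
  then obtain X where X: "\<And>i. X i \<in> A" "X \<longlonglongrightarrow> x" unfolding closure_sequential by blast
  show "c *\<^sub>C x \<in> closure A"
    using scale[OF X(1)] tendsto_scaleC[OF X(2)] by (rule closureI_seq)
next
  fix x assume "x \<in> closure A"
  then obtain X where X: "\<And>i. X i \<in> A" "X \<longlonglongrightarrow> x" unfolding closure_sequential by blast
  show "star x \<in> closure A"
    using star[OF X(1)] tendsto_star[OF X(2)] by (rule closureI_seq)
qed simp

context cuntz_family
begin

text \<open>\<open>1\<^sup>k 2\<close> differs from each of its first \<open>k\<close> proper shifts, which makes compression by
  the (shifted) isometry \<open>S\<^sub>1\<^sup>k S\<^sub>2\<close> isolate a single degree of homogeneity.\<close>

definition probe :: "nat \<Rightarrow> 'a" where "probe k = S (Suc 0) ^ k * S 2"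

lemma S_power: "S (Suc 0) ^ j = sw (replicate j (Suc 0))"
  by (induction j) simp_all

lemma replicate_words: "replicate j (Suc 0) \<in> words j"
  by (auto simp: words_def)

lemma S_power_isometry: "star (S (Suc 0)) ^ j * S (Suc 0) ^ j = 1"
  using word_star_word[OF replicate_words replicate_words, of j]
  by (simp flip: S_power star_power)

lemma probe_isometry: "star (probe k) * probe k = 1"
proof -
  have "star (probe k) * probe k = star (S 2) * (star (S (Suc 0)) ^ k * S (Suc 0) ^ k) * S 2"
    by (simp add: probe_def star_simps mult.assoc)
  then show ?thesis by (simp add: S_power_isometry)
qed

lemma norm_sh_probe: "norm (sh j (probe k)) = 1"
  by (rule norm_isometry) (simp add: sh_hom probe_isometry flip: sh_hom(3))

lemma probe_orthogonal:
  assumes "1 \<le> j" "j \<le> k"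
  shows "star (probe k) * sh j (probe k) = 0"
proof -
  have s: "star (S (Suc 0)) ^ j * sh j y = y * star (S (Suc 0)) ^ j" for y
    using word_star_sh[OF replicate_words, of j y] by (simp flip: S_power star_power)
  have p: "star (S (Suc 0)) ^ k = star (S (Suc 0)) ^ (k - j) * star (S (Suc 0)) ^ j"
    using assms by (simp only: power_add[symmetric] le_add_diff_inverse2)
  have q: "S (Suc 0) ^ k = S (Suc 0) ^ (k - j) * (S (Suc 0) * S (Suc 0) ^ (j - 1))"
    using assms by (simp only: power_add[symmetric] power_Suc[symmetric]) simp
  have "star (probe k) * sh j (probe k)
      = star (S 2) * star (S (Suc 0)) ^ (k - j) * (star (S (Suc 0)) ^ j * sh j (probe k))"
    by (simp add: probe_def star_simps p mult.assoc)
  also have "\<dots> = star (S 2) * (star (S (Suc 0)) ^ (k - j) * S (Suc 0) ^ (k - j)) * S (Suc 0) * S (Suc 0) ^ (j - 1) * S 2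
      * star (S (Suc 0)) ^ j"
    by (simp only: s) (simp add: probe_def q mult.assoc)
  also have "\<dots> = 0" by (simp add: S_power_isometry orthogonal)
  finally show ?thesis .
qed

lemma sh_probe:
  assumes "i \<le> j + k" "j \<le> i + k"
  shows "star (sh i (probe k)) * sh j (probe k) = (if i = j then 1 else 0)"
proof -
  have *: "star (sh i (probe k)) * sh j (probe k) = 0" if "i < j" "j \<le> i + k" for i j
  proof -
    have "sh j (probe k) = sh i (sh (j - i) (probe k))" using that by (simp add: sh_sh)
    then have "star (sh i (probe k)) * sh j (probe k) = sh i (star (probe k) * sh (j - i) (probe k))"
      by (simp add: sh_hom)
    then show ?thesis using that by (simp add: probe_orthogonal sh_hom)
  qed
  consider "i = j" | "i < j" | "j < i" by linarith
  then show ?thesis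
  proof cases
    case 1 then show ?thesis by (simp add: sh_hom probe_isometry flip: sh_hom(3))
  next
    case 2 then show ?thesis using * assms by simp
  next
    case 3
    then have "star (star (sh j (probe k)) * sh i (probe k)) = star 0" using * assms by simp
    then show ?thesis using 3 by (simp add: star_simps)
  qed
qed

lemma probe_extract:
  assumes h: "h \<in> hom c d" and "d \<le> g" "f + d \<le> c + g + k" "c + g \<le> f + d + k"
  shows "star (sh f (probe k)) * h * sh g (probe k) = (if f + d = c + g then h else 0)"
proof -
  have "h * sh g (probe k) = sh (c + (g - d)) (probe k) * h"
    using hom_intertwines_shifted[OF h, of "g - d"] assms(2) by simp
  then have "star (sh f (probe k)) * h * sh g (probe k)
      = (star (sh f (probe k)) * sh (c + (g - d)) (probe k)) * h"
    by (simp add: mult.assoc)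
  also have "star (sh f (probe k)) * sh (c + (g - d)) (probe k) = (if f = c + (g - d) then 1 else 0)"
    using assms by (intro sh_probe) auto
  finally show ?thesis using assms(2) by auto
qed

lemma hom_mult_ex:
  assumes "x \<in> hom a b" "y \<in> hom c d"
  shows "\<exists>e f. x * y \<in> hom e f \<and> e + b + d = a + c + f"
proof (intro exI conjI)
  have "x \<in> hom (a + (c - b)) (b + (c - b))" "y \<in> hom (c + (b - c)) (d + (b - c))"
    using assms by (auto intro: hom_raise)
  moreover have "b + (c - b) = c + (b - c)" by simp
  ultimately show "x * y \<in> hom (a + (c - b)) (d + (b - c))" by (metis hom_mult)
  show "a + (c - b) + b + d = a + c + (d + (b - c))" by simp
qed

lemma B_hom_induct [consumes 1, case_names closed add hom]:
  assumes "x \<in> B" and "closed X" and add: "\<And>x y. x \<in> X \<Longrightarrow> y \<in> X \<Longrightarrow> x + y \<in> X"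
    and hom: "\<And>a b h. h \<in> hom a b \<Longrightarrow> h \<in> X"
  shows "x \<in> X"
proof -
  define U where "U = (\<Union>a b. hom a b)"
  have U: "h \<in> U" if "h \<in> hom a b" for h a b using that by (auto simp: U_def)
  have "cstar_subalgebra (closure (cspan U))"
  proof (rule cstar_subalgebra_closure)
    fix x y assume x: "x \<in> cspan U" and y: "y \<in> cspan U"
    show "x * y \<in> cspan U"
      using x
    proof (induction rule: complex_vector.span_induct_alt)
      case base then show ?case by (simp add: complex_vector.span_zero)
    next
      case (step c x z)
      have "x * y \<in> cspan U"
        using y
      proof (induction rule: complex_vector.span_induct_alt)
        case base then show ?case by (simp add: complex_vector.span_zero)
      next
        case (step d y w)
        obtain a b c' d' where "x \<in> hom a b" "y \<in> hom c' d'"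
          using \<open>x \<in> U\<close> \<open>y \<in> U\<close> by (auto simp: U_def)
        then have "x * y \<in> U" using hom_mult_ex U by blast
        then have "d *\<^sub>C (x * y) + x * w \<in> cspan U"
          using step.IH by (intro complex_vector.span_add[OF complex_vector.span_scale[OF complex_vector.span_base]])
        then show ?case by (simp add: distrib_left mult_scaleC_right)
      qed
      then have "c *\<^sub>C (x * y) + z * y \<in> cspan U"
        using step.IH by (intro complex_vector.span_add[OF complex_vector.span_scale])
      then show ?case by (simp add: distrib_right mult_scaleC_left)
    qed
    show "x + y \<in> cspan U" using x y by (rule complex_vector.span_add)
  next
    fix x assume "x \<in> cspan U"
    then show "star x \<in> cspan U"
    proof (induction rule: complex_vector.span_induct_alt)
      case base then show ?case by (simp add: complex_vector.span_zero)
    next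
      case (step c x z)
      then have "star x \<in> U" by (auto simp: U_def intro: hom_star)
      then show ?case unfolding star_add star_scaleC
        using step.IH by (intro complex_vector.span_add[OF complex_vector.span_scale[OF complex_vector.span_base]])
    qed
  qed (auto intro: complex_vector.span_zero complex_vector.span_scale)
  moreover have "S ` idx \<subseteq> closure (cspan U)"
    using U[OF S_hom] complex_vector.span_base closure_subset[of "cspan U"] by blast
  ultimately have "B \<subseteq> closure (cspan U)"
    unfolding B_eq by (intro cstar_generated_least)
  moreover have "cspan U \<subseteq> X"
  proof
    fix x assume "x \<in> cspan U"
    then show "x \<in> X"
    proof (induction rule: complex_vector.span_induct_alt)
      case base show ?case by (rule hom[OF hom_zero[of 0 0]])
    next
      case (step c x y)
      then obtain a b where "x \<in> hom a b" by (auto simp: U_def)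
      then show ?case using step.IH by (intro add hom[OF hom_scaleC])
    qed
  qed
  ultimately show ?thesis
    using assms(1,2) closure_minimal[of "cspan U" X] by blast
qed

end

section \<open>Quasi-free automorphisms\<close>

lemma le_if_powers_le:
  fixes a b C :: real
  assumes "0 \<le> a" "0 \<le> b" and le: "\<And>j. a ^ 2 ^ j \<le> (C * 2 ^ j + 1) * b ^ 2 ^ j"
  shows "a \<le> b"
proof (rule ccontr)
  assume "\<not> a \<le> b"
  then have "b < a" by simp
  have "b \<noteq> 0" using le[of 0] \<open>b < a\<close> by auto
  then have b: "b > 0" using assms by simp
  define r where "r = b / a"
  have r: "0 < r" "r < 1" using b \<open>b < a\<close> by (simp_all add: r_def)
  have "(\<lambda>N. C * (of_nat N * r ^ N) + r ^ N) \<longlonglongrightarrow> C * 0 + 0"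
    using r by (intro tendsto_intros powser_times_n_limit_0 LIMSEQ_power_zero) auto
  then have "\<forall>\<^sub>F N in sequentially. C * (of_nat N * r ^ N) + r ^ N < 1"
    by (intro order_tendstoD(2)) auto
  then obtain N0 where N0: "\<And>N. N \<ge> N0 \<Longrightarrow> C * (of_nat N * r ^ N) + r ^ N < 1"
    by (auto simp: eventually_sequentially)
  let ?N = "(2::nat) ^ N0"
  have "C * (of_nat ?N * r ^ ?N) + r ^ ?N < 1"
    by (rule N0) (simp add: less_imp_le less_exp)
  moreover have "C * (of_nat ?N * r ^ ?N) + r ^ ?N = (C * 2 ^ N0 + 1) * r ^ ?N"
    by (simp add: distrib_right mult.assoc)
  moreover have "(C * 2 ^ N0 + 1) * r ^ ?N \<ge> 1"
    using le[of N0] b \<open>b < a\<close> by (simp add: r_def power_divide field_simps)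
  ultimately show False by linarith
qed

lemma norm_selfadjoint_power:
  fixes h :: "'a::cstar_algebra"
  assumes "star h = h"
  shows "norm (h ^ 2 ^ j) = norm h ^ 2 ^ j"
proof (induction j)
  case (Suc j)
  have "h ^ 2 ^ Suc j = star (h ^ 2 ^ j) * h ^ 2 ^ j"
    by (simp add: star_power assms mult_2 power_add)
  then show ?case by (simp add: cstar_identity Suc) (simp add: power2_eq_square mult_2 power_add)
qed simp

lemma norm_unitary_conj:
  fixes u v x :: "'a::cstar_algebra"
  assumes "star u * u = 1" "u * star u = 1" "star v * v = 1" "v * star v = 1"
  shows "norm (u * x * star v) = norm x"
proof (rule antisym)
  have n: "norm u = 1" "norm v = 1" using assms by (auto intro: norm_isometry)
  show "norm (u * x * star v) \<le> norm x"
    using norm_compress_le[of "star u" "star v" x] n by (simp add: star_star)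
  have "star u * (u * x * star v) * v = (star u * u) * x * (star v * v)"
    by (simp only: mult.assoc)
  then show "norm x \<le> norm (u * x * star v)"
    using norm_compress_le[of u v "u * x * star v"] n assms by simp
qed

text \<open>An isometric closed \<open>*\<close>-subalgebra of a product, viewed as a relation.\<close>

locale isometric_relation =
  fixes R :: "'a::cstar_algebra \<Rightarrow> 'a \<Rightarrow> bool"
  assumes zero: "R 0 0" and add: "R x y \<Longrightarrow> R x' y' \<Longrightarrow> R (x + x') (y + y')"
    and scale: "R x y \<Longrightarrow> R (c *\<^sub>C x) (c *\<^sub>C y)"
    and mult: "R x y \<Longrightarrow> R x' y' \<Longrightarrow> R (x * x') (y * y')"
    and star: "R x y \<Longrightarrow> R (star x) (star y)"
    and isometric: "R x y \<Longrightarrow> norm x = norm y"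
    and limit: "(\<And>i. R (X i) (Y i)) \<Longrightarrow> X \<longlonglongrightarrow> x \<Longrightarrow> Y \<longlonglongrightarrow> y \<Longrightarrow> R x y"
begin

lemma diff: "R x y \<Longrightarrow> R x' y' \<Longrightarrow> R (x - x') (y - y')"
  using add[OF _ scale, of x y x' y' "-1"] by (simp add: scaleC_minus1)

lemma right_unique: "R x y \<Longrightarrow> R x y' \<Longrightarrow> y = y'"
  using isometric[OF diff, of x y x y'] by simp

lemma left_unique: "R x y \<Longrightarrow> R x' y \<Longrightarrow> x = x'"
  using isometric[OF diff, of x y x' y] by simp

lemma converse: "isometric_relation (\<lambda>x y. R y x)"
  by standard (simp_all add: zero add scale mult star isometric, rule limit)

lemma limit_ex:
  assumes R: "\<And>i. R (X i) (Y i)" and X: "X \<longlonglongrightarrow> x"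
  shows "\<exists>y. Y \<longlonglongrightarrow> y \<and> R x y"
proof -
  have "norm (Y i - Y j) = norm (X i - X j)" for i j
    using isometric[OF diff[OF R R]] by simp
  then have "Cauchy Y"
    using LIMSEQ_imp_Cauchy[OF X] by (simp add: Cauchy_iff)
  then obtain y where "Y \<longlonglongrightarrow> y" by (auto simp: Cauchy_convergent_iff convergent_def)
  then show ?thesis using limit[OF R X] by blast
qed

lemma subalgebra_preimage:
  assumes G: "cstar_subalgebra G"
  shows "cstar_subalgebra {x. \<exists>y\<in>G. R x y}"
proof -
  have G': "0 \<in> G" "\<And>x y. x \<in> G \<Longrightarrow> y \<in> G \<Longrightarrow> x + y \<in> G" "\<And>c x. x \<in> G \<Longrightarrow> c *\<^sub>C x \<in> G"
    "\<And>x y. x \<in> G \<Longrightarrow> y \<in> G \<Longrightarrow> x * y \<in> G" "\<And>x. x \<in> G \<Longrightarrow> star x \<in> G" "closed G"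
    using G by (simp_all add: cstar_subalgebra_def)
  show ?thesis
    unfolding cstar_subalgebra_def
  proof (intro conjI ballI allI)
    show "0 \<in> {x. \<exists>y\<in>G. R x y}" using zero G' by blast
    show "x + y \<in> {x. \<exists>y\<in>G. R x y}" "x * y \<in> {x. \<exists>y\<in>G. R x y}"
      if "x \<in> {x. \<exists>y\<in>G. R x y}" "y \<in> {x. \<exists>y\<in>G. R x y}" for x y
      using that add mult G'(2,4) by blast+
    show "c *\<^sub>C x \<in> {x. \<exists>y\<in>G. R x y}" "star x \<in> {x. \<exists>y\<in>G. R x y}"
      if "x \<in> {x. \<exists>y\<in>G. R x y}" for c x
      using that scale star G'(3,5) by blast+
    show "closed {x. \<exists>y\<in>G. R x y}"
      unfolding closed_sequential_limits
    proof (intro allI impI, elim conjE)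
      fix X l assume X: "\<forall>i. X i \<in> {x. \<exists>y\<in>G. R x y}" and l: "X \<longlonglongrightarrow> l"
      have "\<exists>y. y \<in> G \<and> R (X i) y" for i using X by blast
      then obtain Y where Y: "\<And>i. Y i \<in> G" "\<And>i. R (X i) (Y i)" by metis
      obtain y where y: "Y \<longlonglongrightarrow> y" "R l y" using limit_ex[OF Y(2) l] by blast
      have "y \<in> G" using G'(6) Y(1) y(1) by (rule closed_sequentially)
      then show "l \<in> {x. \<exists>y\<in>G. R x y}" using y by blast
    qed
  qed
qed

lemma image_generated:
  assumes \<alpha>: "\<And>x. x \<in> B \<Longrightarrow> R x (\<alpha> x)" and "X \<subseteq> B" and B: "cstar_subalgebra B"
  shows "\<alpha> ` cstar_generated X = cstar_generated (\<alpha> ` X)"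
proof -
  interpret c: isometric_relation "\<lambda>x y. R y x" by (rule converse)
  have XB: "cstar_generated X \<subseteq> B" using assms by (intro cstar_generated_least)
  have "cstar_generated X \<subseteq> {x. \<exists>y\<in>cstar_generated (\<alpha> ` X). R x y}"
    using \<alpha> \<open>X \<subseteq> B\<close> cstar_generated_superset[of "\<alpha> ` X"]
    by (intro cstar_generated_least subalgebra_preimage cstar_subalgebra_generated) blast
  then have "\<alpha> ` cstar_generated X \<subseteq> cstar_generated (\<alpha> ` X)"
    using XB \<alpha> right_unique by (smt (verit) image_subset_iff mem_Collect_eq subset_iff)
  moreover have "cstar_generated (\<alpha> ` X) \<subseteq> {y. \<exists>x\<in>cstar_generated X. R x y}"
    using \<alpha> \<open>X \<subseteq> B\<close> cstar_generated_superset[of X]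
    by (intro cstar_generated_least c.subalgebra_preimage cstar_subalgebra_generated) blast
  then have "cstar_generated (\<alpha> ` X) \<subseteq> \<alpha> ` cstar_generated X"
    using XB \<alpha> right_unique by (smt (verit) image_iff mem_Collect_eq subset_iff)
  ultimately show ?thesis by blast
qed

end

context cuntz_family
begin

text \<open>The automorphism sends \<open>S\<^sub>\<mu>\<close> to \<open>cocycle u |\<mu>| * S\<^sub>\<mu>\<close>, hence acts on \<open>hom a b\<close> as
  \<open>twist u a b\<close>.\<close>

primrec cocycle :: "'a \<Rightarrow> nat \<Rightarrow> 'a" where
  "cocycle u 0 = 1"
| "cocycle u (Suc k) = u * shift (cocycle u k)"

definition twist :: "'a \<Rightarrow> nat \<Rightarrow> nat \<Rightarrow> 'a \<Rightarrow> 'a" where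
  "twist u a b x = cocycle u a * x * star (cocycle u b)"

inductive twist_rel :: "'a \<Rightarrow> nat \<Rightarrow> 'a \<Rightarrow> 'a \<Rightarrow> bool" for u M where
  hom: "x \<in> hom a b \<Longrightarrow> a \<le> b + M \<Longrightarrow> b \<le> a + M \<Longrightarrow> twist_rel u M x (twist u a b x)"
| add: "twist_rel u M x y \<Longrightarrow> twist_rel u M x' y' \<Longrightarrow> twist_rel u M (x + x') (y + y')"

lemma cocycle_Suc: "cocycle u (Suc k) = cocycle u k * sh k u"
proof (induction k)
  case (Suc k)
  have "cocycle u (Suc (Suc k)) = u * shift (cocycle u k * sh k u)"
    by (subst cocycle.simps(2)) (simp only: Suc)
  then show ?case by (simp add: shift_mult mult.assoc)
qed (simp add: shift_one)

lemma twist_zero: "twist u a b 0 = 0"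
  by (simp add: twist_def)

lemma twist_add: "twist u a b (x + y) = twist u a b x + twist u a b y"
  by (simp add: twist_def distrib_left distrib_right)

lemma twist_scaleC: "twist u a b (c *\<^sub>C x) = c *\<^sub>C twist u a b x"
  by (simp add: twist_def mult_scaleC_left mult_scaleC_right)

lemma star_twist: "star (twist u a b x) = twist u b a (star x)"
  by (simp add: twist_def star_simps mult.assoc)

context
  fixes u :: 'a
  assumes u_hom: "u \<in> hom 1 1" and u_unitary: "star u * u = 1" "u * star u = 1"
begin

lemma cocycle_hom: "cocycle u k \<in> hom k k"
proof (induction k)
  case (Suc k)
  have "u \<in> hom (Suc k) (Suc k)" using hom_raise[OF u_hom, of k] by simp
  moreover have "shift (cocycle u k) \<in> hom (Suc k) (Suc k)" using sh_hom_Suc[OF Suc, of 1] by simp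
  ultimately show ?case by (simp add: hom_mult)
qed (simp add: one_hom)

lemma cocycle_unitary: "star (cocycle u k) * cocycle u k = 1" "cocycle u k * star (cocycle u k) = 1"
proof (induction k)
  case (Suc k)
  have "star (cocycle u (Suc k)) * cocycle u (Suc k)
      = shift (star (cocycle u k)) * (star u * u) * shift (cocycle u k)"
    by (simp add: star_simps star_shift mult.assoc)
  also have "\<dots> = shift (star (cocycle u k) * cocycle u k)"
    by (simp add: u_unitary shift_mult)
  finally show "star (cocycle u (Suc k)) * cocycle u (Suc k) = 1" by (simp add: Suc shift_one)
  have "cocycle u (Suc k) * star (cocycle u (Suc k))
      = u * shift (cocycle u k * star (cocycle u k)) * star u"
    by (simp add: star_simps star_shift shift_mult mult.assoc)
  then show "cocycle u (Suc k) * star (cocycle u (Suc k)) = 1" by (simp add: Suc shift_one u_unitary)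
qed simp_all

lemma twist_Suc:
  assumes "x \<in> hom a b"
  shows "twist u (Suc a) (Suc b) x = twist u a b x"
proof -
  have "twist u (Suc a) (Suc b) x = cocycle u a * (sh a u * x) * sh b (star u) * star (cocycle u b)"
    by (simp add: twist_def cocycle_Suc star_simps sh_hom mult.assoc del: cocycle.simps)
  also have "sh a u * x = x * sh b u" using hom_intertwines[OF assms] by simp
  also have "cocycle u a * (x * sh b u) * sh b (star u) = cocycle u a * x * sh b (u * star u)"
    by (simp add: sh_hom mult.assoc)
  finally show ?thesis by (simp add: u_unitary sh_hom twist_def)
qed

lemma twist_raise: "x \<in> hom a b \<Longrightarrow> twist u (a + t) (b + t) x = twist u a b x"
  by (induction t) (simp_all add: twist_Suc hom_raise)

lemma twist_hom: "x \<in> hom a b \<Longrightarrow> twist u a b x \<in> hom a b"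
  unfolding twist_def using cocycle_hom hom_star hom_mult by blast

lemma norm_twist: "norm (twist u a b x) = norm x"
  unfolding twist_def by (intro norm_unitary_conj cocycle_unitary)

lemma twist_mult: "twist u a b x * twist u b c y = twist u a c (x * y)"
proof -
  have "twist u a b x * twist u b c y
      = cocycle u a * x * (star (cocycle u b) * cocycle u b) * y * star (cocycle u c)"
    by (simp add: twist_def mult.assoc)
  then show ?thesis by (simp add: cocycle_unitary twist_def mult.assoc)
qed

lemma twist_rel_hom_mult:
  assumes x: "x \<in> hom a b" "a \<le> b + M" "b \<le> a + M" and y: "y \<in> hom c d" "c \<le> d + N" "d \<le> c + N"
  shows "twist_rel u (M + N) (x * y) (twist u a b x * twist u c d y)"
proof -
  define t s where "t = c - b" and "s = b - c"
  have ts: "b + t = c + s" by (simp add: t_def s_def)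
  have x': "x \<in> hom (a + t) (c + s)" "twist u a b x = twist u (a + t) (c + s) x"
    using hom_raise[OF x(1), of t] twist_raise[OF x(1), of t] by (simp_all add: ts)
  have y': "y \<in> hom (c + s) (d + s)" "twist u c d y = twist u (c + s) (d + s) y"
    using hom_raise[OF y(1), of s] twist_raise[OF y(1), of s] by simp_all
  have "twist_rel u (M + N) (x * y) (twist u (a + t) (d + s) (x * y))"
    using hom_mult[OF x'(1) y'(1)] by (rule twist_rel.hom) (use x y ts in linarith)+
  then show ?thesis unfolding x'(2) y'(2) twist_mult .
qed

lemma twist_rel_mult:
  assumes "twist_rel u M x y" "twist_rel u N x' y'"
  shows "twist_rel u (M + N) (x * x') (y * y')"
  using assms(1)
proof (induction rule: twist_rel.induct)
  case (hom x a b)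
  show ?case
    using assms(2)
  proof (induction rule: twist_rel.induct)
    case (hom y c d)
    then show ?case using \<open>x \<in> hom a b\<close> \<open>a \<le> b + M\<close> \<open>b \<le> a + M\<close> by (intro twist_rel_hom_mult)
  next
    case (add y z y' z')
    then show ?case by (simp add: distrib_left twist_rel.add)
  qed
next
  case (add x y x'' y'')
  then show ?case by (simp add: distrib_right twist_rel.add)
qed

lemma twist_rel_star: "twist_rel u M x y \<Longrightarrow> twist_rel u M (star x) (star y)"
  by (induction rule: twist_rel.induct)
    (simp_all add: star_twist star_add twist_rel.add twist_rel.hom hom_star)

lemma twist_rel_scaleC: "twist_rel u M x y \<Longrightarrow> twist_rel u M (c *\<^sub>C x) (c *\<^sub>C y)"
proof (induction rule: twist_rel.induct)
  case (hom x a b)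
  then show ?case using twist_rel.hom[OF hom_scaleC, of x a b M u c] by (simp add: twist_scaleC)
qed (simp add: scaleC_add_right twist_rel.add)

lemma twist_rel_mono: "twist_rel u M x y \<Longrightarrow> M \<le> N \<Longrightarrow> twist_rel u N x y"
  by (induction rule: twist_rel.induct) (auto intro: twist_rel.intros)

lemma twist_rel_power: "twist_rel u M x y \<Longrightarrow> twist_rel u (M * N) (x ^ N) (y ^ N)"
proof (induction N)
  case 0
  show ?case using twist_rel.hom[OF one_hom[of 0], of 0 u] by (simp add: twist_def)
next
  case (Suc N)
  then show ?case using twist_rel_mult[of M x y "M * N" "x ^ N" "y ^ N"] by simp
qed

lemma twist_rel_decompose:
  assumes "twist_rel u M x y"
  shows "\<exists>k f. (\<forall>l\<le>2*M. f l \<in> hom (k + l) (k + M)) \<and> x = (\<Sum>l\<le>2*M. f l) \<and>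
    y = (\<Sum>l\<le>2*M. twist u (k + l) (k + M) (f l))"
  using assms
proof (induction rule: twist_rel.induct)
  case (hom x a b)
  define m where "m = a + M - b"
  have m: "m \<le> 2 * M" "b + m = a + M" using hom by (simp_all add: m_def)
  show ?case
  proof (intro exI conjI allI impI)
    show "(if l = m then x else 0) \<in> hom (b + l) (b + M)" for l
      using hom_raise[OF hom(1), of M] m by (simp add: hom_zero)
    show "x = (\<Sum>l\<le>2 * M. if l = m then x else 0)" using m by (simp add: sum.delta)
    have "(\<Sum>l\<le>2 * M. twist u (b + l) (b + M) (if l = m then x else 0))
        = (\<Sum>l\<le>2 * M. if l = m then twist u (b + m) (b + M) x else 0)"
      by (rule sum.cong) (simp_all add: twist_zero)
    also have "\<dots> = twist u a b x" using m twist_raise[OF hom(1), of M] by (simp add: sum.delta)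
    finally show "twist u a b x = (\<Sum>l\<le>2 * M. twist u (b + l) (b + M) (if l = m then x else 0))" ..
  qed
next
  case (add x y x' y')
  from add.IH(1) obtain k f where f: "\<And>l. l \<le> 2 * M \<Longrightarrow> f l \<in> hom (k + l) (k + M)"
    "x = (\<Sum>l\<le>2*M. f l)" "y = (\<Sum>l\<le>2*M. twist u (k + l) (k + M) (f l))" by blast
  from add.IH(2) obtain k' f' where f': "\<And>l. l \<le> 2 * M \<Longrightarrow> f' l \<in> hom (k' + l) (k' + M)"
    "x' = (\<Sum>l\<le>2*M. f' l)" "y' = (\<Sum>l\<le>2*M. twist u (k' + l) (k' + M) (f' l))" by blast
  have ac: "k + l + k' = k + k' + l" "k' + l + k = k + k' + l" for l by simp_all
  have h: "f l \<in> hom (k + k' + l) (k + k' + M)" "f' l \<in> hom (k + k' + l) (k + k' + M)"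
    "twist u (k + k' + l) (k + k' + M) (f l) = twist u (k + l) (k + M) (f l)"
    "twist u (k + k' + l) (k + k' + M) (f' l) = twist u (k' + l) (k' + M) (f' l)"
    if "l \<le> 2 * M" for l
  proof -
    show "f l \<in> hom (k + k' + l) (k + k' + M)"
      using hom_raise[OF f(1)[OF that], of k'] unfolding ac(1)[of l] ac(1)[of M] .
    show "f' l \<in> hom (k + k' + l) (k + k' + M)"
      using hom_raise[OF f'(1)[OF that], of k] unfolding ac(2)[of l] ac(2)[of M] .
    show "twist u (k + k' + l) (k + k' + M) (f l) = twist u (k + l) (k + M) (f l)"
      using twist_raise[OF f(1)[OF that], of k'] unfolding ac(1)[of l] ac(1)[of M] .
    show "twist u (k + k' + l) (k + k' + M) (f' l) = twist u (k' + l) (k' + M) (f' l)"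
      using twist_raise[OF f'(1)[OF that], of k] unfolding ac(2)[of l] ac(2)[of M] .
  qed
  show ?case
  proof (intro exI conjI allI impI)
    show "f l + f' l \<in> hom (k + k' + l) (k + k' + M)" if "l \<le> 2 * M" for l
      using h[OF that] by (intro hom_add)
    show "x + x' = (\<Sum>l\<le>2*M. f l + f' l)" by (simp add: f f' sum.distrib)
    show "y + y' = (\<Sum>l\<le>2*M. twist u (k + k' + l) (k + k' + M) (f l + f' l))"
      by (simp add: f(3) f'(3) twist_add sum.distrib h)
  qed
qed

lemma norm_component_le:
  assumes f: "\<And>l. l \<le> 2 * M \<Longrightarrow> f l \<in> hom (k + l) (k + M)" and l: "l \<le> 2 * M"
  shows "norm (f l) \<le> norm (\<Sum>l\<le>2*M. f l)"
proof -
  let ?v = "probe (2 * M)"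
  have "star (sh (k + l) ?v) * (\<Sum>l\<le>2*M. f l) * sh (k + M) ?v
      = (\<Sum>m\<le>2*M. star (sh (k + l) ?v) * f m * sh (k + M) ?v)"
    by (simp add: sum_distrib_left sum_distrib_right)
  also have "\<dots> = (\<Sum>m\<le>2*M. if m = l then f m else 0)"
    using l by (intro sum.cong refl) (subst probe_extract[OF f]; auto)
  also have "\<dots> = f l" using l by (simp add: sum.delta)
  finally show ?thesis
    using norm_compress_le[of "sh (k + l) ?v" "sh (k + M) ?v" "\<Sum>l\<le>2*M. f l"]
    by (simp add: norm_sh_probe)
qed

lemma twist_rel_norm_bounds:
  assumes "twist_rel u M x y"
  shows "norm x \<le> real (2 * M + 1) * norm y" "norm y \<le> real (2 * M + 1) * norm x"
proof -
  obtain k f where f: "\<And>l. l \<le> 2*M \<Longrightarrow> f l \<in> hom (k + l) (k + M)"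
    and x: "x = (\<Sum>l\<le>2*M. f l)" and y: "y = (\<Sum>l\<le>2*M. twist u (k + l) (k + M) (f l))"
    using twist_rel_decompose[OF assms] by blast
  have fx: "norm (f l) \<le> norm x" if "l \<le> 2 * M" for l
    unfolding x using f that by (intro norm_component_le)
  have fy: "norm (f l) \<le> norm y" if "l \<le> 2 * M" for l
    using norm_component_le[of M "\<lambda>l. twist u (k + l) (k + M) (f l)" k l] f that
    by (simp add: twist_hom norm_twist y)
  have "norm x \<le> real (card {..2*M}) * norm y"
    unfolding x by (rule sum_norm_bound) (use fy in \<open>simp add: x\<close>)
  then show "norm x \<le> real (2 * M + 1) * norm y" by simp
  have "norm y \<le> real (card {..2*M}) * norm x"
    unfolding y by (rule sum_norm_bound) (use fx in \<open>simp add: norm_twist\<close>)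
  then show "norm y \<le> real (2 * M + 1) * norm x" by simp
qed

text \<open>The bounds lose only a factor linear in the degree, which disappears on passing to high
  powers, because \<open>\<parallel>x\<parallel> ^ (2 N) = \<parallel>(x\<^sup>* x) ^ N\<parallel>\<close>.\<close>

lemma twist_rel_norm:
  assumes "twist_rel u M x y"
  shows "norm x = norm y"
proof -
  let ?h = "star x * x" and ?k = "star y * y"
  have h: "star ?h = ?h" "star ?k = ?k" by (simp_all add: star_simps)
  have r: "twist_rel u (2 * M * 2 ^ j) (?h ^ 2 ^ j) (?k ^ 2 ^ j)" for j
    using twist_rel_power[OF twist_rel_mult[OF twist_rel_star[OF assms] assms], of "2 ^ j"]
    by (simp add: mult_2)
  have *: "norm ?h ^ 2 ^ j \<le> (4 * real M * 2 ^ j + 1) * norm ?k ^ 2 ^ j"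
    "norm ?k ^ 2 ^ j \<le> (4 * real M * 2 ^ j + 1) * norm ?h ^ 2 ^ j" for j
    using twist_rel_norm_bounds[OF r[of j]] by (simp_all add: norm_selfadjoint_power h mult.assoc add.commute)
  have "norm ?h = norm ?k"
    by (rule antisym; rule le_if_powers_le[of _ _ "4 * real M"]) (simp_all only: * norm_ge_zero)
  then show ?thesis by (simp add: cstar_identity)
qed

definition twist_graph :: "'a \<Rightarrow> 'a \<Rightarrow> bool" where
  "twist_graph x y \<longleftrightarrow> (x, y) \<in> closure {(x, y). \<exists>M. twist_rel u M x y}"

lemma twist_graphI: "twist_rel u M x y \<Longrightarrow> twist_graph x y"
  unfolding twist_graph_def by (rule subsetD[OF closure_subset]) blast

lemma twist_graph_iff:
  "twist_graph x y \<longleftrightarrow> (\<exists>X Y. (\<forall>i. \<exists>M. twist_rel u M (X i) (Y i)) \<and> X \<longlonglongrightarrow> x \<and> Y \<longlonglongrightarrow> y)"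
proof
  assume "twist_graph x y"
  then obtain Z where Z: "\<And>i. Z i \<in> {(x, y). \<exists>M. twist_rel u M x y}" "Z \<longlonglongrightarrow> (x, y)"
    unfolding twist_graph_def closure_sequential by blast
  have "(\<lambda>i. fst (Z i)) \<longlonglongrightarrow> x" "(\<lambda>i. snd (Z i)) \<longlonglongrightarrow> y"
    using tendsto_fst[OF Z(2)] tendsto_snd[OF Z(2)] by simp_all
  moreover have "\<forall>i. \<exists>M. twist_rel u M (fst (Z i)) (snd (Z i))" using Z(1) by (auto simp: case_prod_beta)
  ultimately show "\<exists>X Y. (\<forall>i. \<exists>M. twist_rel u M (X i) (Y i)) \<and> X \<longlonglongrightarrow> x \<and> Y \<longlonglongrightarrow> y"
    by (intro exI[of _ "\<lambda>i. fst (Z i)"] exI[of _ "\<lambda>i. snd (Z i)"] conjI)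
next
  assume "\<exists>X Y. (\<forall>i. \<exists>M. twist_rel u M (X i) (Y i)) \<and> X \<longlonglongrightarrow> x \<and> Y \<longlonglongrightarrow> y"
  then obtain X Y where XY: "\<forall>i. \<exists>M. twist_rel u M (X i) (Y i)" "X \<longlonglongrightarrow> x" "Y \<longlonglongrightarrow> y" by blast
  show "twist_graph x y"
    unfolding twist_graph_def
    by (rule closureI_seq[where X = "\<lambda>i. (X i, Y i)"]) (use XY in \<open>auto intro: tendsto_Pair\<close>)
qed

lemma isometric_relation_twist_graph: "isometric_relation twist_graph"
proof
  have "twist_rel u 0 0 0" using twist_rel.hom[OF hom_zero[of 0 0], of 0 u] by (simp add: twist_zero)
  then show "twist_graph 0 0" by (rule twist_graphI)
next
  fix x y x' y' assume "twist_graph x y" "twist_graph x' y'"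
  then obtain X Y X' Y' where X: "\<forall>i. \<exists>M. twist_rel u M (X i) (Y i)" "X \<longlonglongrightarrow> x" "Y \<longlonglongrightarrow> y"
    and X': "\<forall>i. \<exists>M. twist_rel u M (X' i) (Y' i)" "X' \<longlonglongrightarrow> x'" "Y' \<longlonglongrightarrow> y'"
    unfolding twist_graph_iff by blast
  have "\<exists>M. twist_rel u M (X i + X' i) (Y i + Y' i)" for i
  proof -
    obtain M M' where "twist_rel u M (X i) (Y i)" "twist_rel u M' (X' i) (Y' i)" using X X' by blast
    then have "twist_rel u (M + M') (X i + X' i) (Y i + Y' i)"
      by (intro twist_rel.add; elim twist_rel_mono) simp_all
    then show ?thesis by blast
  qed
  then show "twist_graph (x + x') (y + y')"
    unfolding twist_graph_iff using X(2,3) X'(2,3)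
    by (intro exI[of _ "\<lambda>i. X i + X' i"] exI[of _ "\<lambda>i. Y i + Y' i"]) (simp add: tendsto_add)
  have "\<exists>M. twist_rel u M (X i * X' i) (Y i * Y' i)" for i
    using X(1) X'(1) twist_rel_mult by blast
  then show "twist_graph (x * x') (y * y')"
    unfolding twist_graph_iff using X(2,3) X'(2,3)
    by (intro exI[of _ "\<lambda>i. X i * X' i"] exI[of _ "\<lambda>i. Y i * Y' i"]) (simp add: tendsto_mult)
next
  fix x y c assume "twist_graph x y"
  then obtain X Y where X: "\<forall>i. \<exists>M. twist_rel u M (X i) (Y i)" "X \<longlonglongrightarrow> x" "Y \<longlonglongrightarrow> y"
    unfolding twist_graph_iff by blast
  have "\<exists>M. twist_rel u M (c *\<^sub>C X i) (c *\<^sub>C Y i)" for i using X(1) twist_rel_scaleC by blast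
  then show "twist_graph (c *\<^sub>C x) (c *\<^sub>C y)"
    unfolding twist_graph_iff using X(2,3)
    by (intro exI[of _ "\<lambda>i. c *\<^sub>C X i"] exI[of _ "\<lambda>i. c *\<^sub>C Y i"]) (simp add: tendsto_scaleC)
  have "\<exists>M. twist_rel u M (star (X i)) (star (Y i))" for i using X(1) twist_rel_star by blast
  then show "twist_graph (star x) (star y)"
    unfolding twist_graph_iff using X(2,3)
    by (intro exI[of _ "\<lambda>i. star (X i)"] exI[of _ "\<lambda>i. star (Y i)"]) (simp add: tendsto_star)
  have "norm (X i) = norm (Y i)" for i using X(1) twist_rel_norm by blast
  then show "norm x = norm y"
    using tendsto_norm[OF X(2)] tendsto_norm[OF X(3)] LIMSEQ_unique by fastforce
next
  fix X Y x y assume XY: "\<And>i. twist_graph (X i) (Y i)" "X \<longlonglongrightarrow> x" "Y \<longlonglongrightarrow> y"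
  have lim: "(\<lambda>i. (X i, Y i)) \<longlonglongrightarrow> (x, y)" using XY(2,3) by (rule tendsto_Pair)
  have mem: "(X i, Y i) \<in> closure {(x, y). \<exists>M. twist_rel u M x y}" for i
    using XY(1) by (simp only: twist_graph_def)
  show "twist_graph x y"
    unfolding twist_graph_def by (rule closed_sequentially[OF closed_closure mem lim])
qed

interpretation G: isometric_relation twist_graph
  by (rule isometric_relation_twist_graph)

lemma twist_rel_B: "twist_rel u M x y \<Longrightarrow> x \<in> B \<and> y \<in> B"
proof (induction rule: twist_rel.induct)
  case (hom x a b)
  show ?case
    using subsetD[OF hom_subset_B hom(1)] subsetD[OF hom_subset_B twist_hom[OF hom(1)]] by (rule conjI)
next
  case (add x y x' y')
  then show ?case by (simp only: B_closed_under(2))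
qed

lemma twist_graph_B:
  assumes "twist_graph x y"
  shows "x \<in> B" "y \<in> B"
proof -
  have "closure {(x, y). \<exists>M. twist_rel u M x y} \<subseteq> B \<times> B"
    using twist_rel_B by (intro closure_minimal closed_Times closed_B) blast
  then show "x \<in> B" "y \<in> B" using assms by (auto simp: twist_graph_def)
qed

lemma twist_graph_S: "i \<in> idx \<Longrightarrow> twist_graph (S i) (u * S i)"
proof -
  assume "i \<in> idx"
  then have "twist_rel u 1 (S i) (twist u 1 0 (S i))" by (intro twist_rel.hom S_hom) auto
  then show ?thesis by (intro twist_graphI[of 1]) (simp add: twist_def shift_one)
qed

lemma twist_graph_preimage_S: "i \<in> idx \<Longrightarrow> twist_graph (star u * S i) (S i)"
proof -
  assume "i \<in> idx"
  then have "star u * S i \<in> hom 1 0" by (intro hom_mult[OF hom_star[OF u_hom]] S_hom)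
  then have "twist_rel u 1 (star u * S i) (twist u 1 0 (star u * S i))" by (intro twist_rel.hom) auto
  moreover have "twist u 1 0 (star u * S i) = u * star u * S i"
    by (simp add: twist_def shift_one mult.assoc)
  ultimately show ?thesis by (intro twist_graphI[of 1]) (simp add: u_unitary)
qed

lemma quasi_free_automorphism:
  obtains \<alpha> where "cstar_automorphism B \<alpha>" "\<And>i. i \<in> idx \<Longrightarrow> \<alpha> (S i) = u * S i"
    "\<alpha> ` cuntz_diagonal n S = cuntz_diagonal n (\<lambda>i. u * S i)"
proof -
  interpret C: isometric_relation "\<lambda>x y. twist_graph y x" by (rule G.converse)
  have "cstar_generated (S ` idx) \<subseteq> {x. \<exists>y\<in>B. twist_graph x y}"
  proof (intro cstar_generated_least G.subalgebra_preimage subalgebra_B image_subsetI CollectI bexI)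
    fix i assume "i \<in> idx"
    then show "twist_graph (S i) (u * S i)" by (rule twist_graph_S)
    then show "u * S i \<in> B" by (rule twist_graph_B)
  qed
  then have "B \<subseteq> {x. \<exists>y\<in>B. twist_graph x y}" by (simp only: B_eq[symmetric])
  then have "\<forall>x\<in>B. \<exists>y. twist_graph x y" by blast
  then obtain \<alpha> where \<alpha>: "\<And>x. x \<in> B \<Longrightarrow> twist_graph x (\<alpha> x)" by metis
  have uniq: "\<alpha> x = y" if "twist_graph x y" for x y
    using G.right_unique[OF \<alpha>[OF twist_graph_B(1)[OF that]] that] .
  have "cstar_generated (S ` idx) \<subseteq> {y. \<exists>x\<in>B. twist_graph x y}"
  proof (intro cstar_generated_least C.subalgebra_preimage subalgebra_B image_subsetI CollectI bexI)
    fix i assume "i \<in> idx"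
    then show "twist_graph (star u * S i) (S i)" by (rule twist_graph_preimage_S)
    then show "star u * S i \<in> B" by (rule twist_graph_B)
  qed
  then have "B \<subseteq> {y. \<exists>x\<in>B. twist_graph x y}" by (simp only: B_eq[symmetric])
  then have "B \<subseteq> \<alpha> ` B" using uniq by blast
  moreover have "\<alpha> ` B \<subseteq> B" using twist_graph_B(2)[OF \<alpha>] by blast
  moreover have "inj_on \<alpha> B" by (rule inj_onI) (metis \<alpha> G.left_unique)
  ultimately have "bij_betw \<alpha> B B" by (simp add: bij_betw_def)
  then have aut: "cstar_automorphism B \<alpha>"
    unfolding cstar_automorphism_def using \<alpha> \<open>bij_betw \<alpha> B B\<close>
    by (intro conjI ballI allI uniq G.add G.scale G.mult G.star)
  have S: "\<alpha> (S i) = u * S i" if "i \<in> idx" for i using uniq twist_graph_S[OF that] .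
  have word: "twist_graph (word_isometry S \<mu>) (word_isometry (\<lambda>i. u * S i) \<mu>)" if "set \<mu> \<subseteq> idx" for \<mu>
    using that
  proof (induction \<mu>)
    case Nil
    have "twist_rel u 0 1 (twist u 0 0 1)" by (rule twist_rel.hom[OF one_hom]) auto
    then show ?case by (intro twist_graphI[of 0]) (simp add: twist_def)
  next
    case (Cons i \<mu>)
    then show ?case using G.mult[OF twist_graph_S[of i]] by simp
  qed
  have proj: "\<alpha> (word_projection S \<mu>) = word_projection (\<lambda>i. u * S i) \<mu>" if "\<mu> \<in> lists idx" for \<mu>
    using that unfolding word_projection_def by (intro uniq G.mult G.star word) auto
  have "word_projection S ` lists idx \<subseteq> B"
    unfolding word_projection_def
    by (rule image_subsetI) (intro B_closed_under(4,5) B_word, auto simp: words_def)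
  then have "\<alpha> ` cuntz_diagonal n S = cstar_generated (\<alpha> ` word_projection S ` lists idx)"
    unfolding cuntz_diagonal_def idx_def[symmetric]
    by (intro G.image_generated[OF \<alpha> _ subalgebra_B])
  also have "\<alpha> ` word_projection S ` lists idx = word_projection (\<lambda>i. u * S i) ` lists idx"
    by (simp add: image_image proj cong: image_cong)
  finally show ?thesis
    using that[OF aut S] by (simp add: cuntz_diagonal_def idx_def)
qed

end

end

section \<open>Maximality of the diagonal\<close>

lemma commutant_subalgebra:
  fixes X :: "'a::cstar_algebra set"
  shows "cstar_subalgebra {y. \<forall>x\<in>X. x * y = y * x \<and> x * star y = star y * x}"
proof -
  have "closed ((\<lambda>y. x * y - y * x) -` {0} \<inter> (\<lambda>y. x * star y - star y * x) -` {0})" for x :: 'a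
    by (intro closed_Int continuous_closed_vimage continuous_intros
        bounded_linear.continuous[OF bounded_linear_star] closed_singleton)
  then have "closed (\<Inter>x\<in>X. (\<lambda>y. x * y - y * x) -` {0} \<inter> (\<lambda>y. x * star y - star y * x) -` {0})"
    by (intro closed_INT) blast
  moreover have "{y. \<forall>x\<in>X. x * y = y * x \<and> x * star y = star y * x}
      = (\<Inter>x\<in>X. (\<lambda>y. x * y - y * x) -` {0} \<inter> (\<lambda>y. x * star y - star y * x) -` {0})"
    by auto
  ultimately have "closed {y. \<forall>x\<in>X. x * y = y * x \<and> x * star y = star y * x}" by simp
  moreover have "x * (y * z) = y * z * x \<and> x * star (y * z) = star (y * z) * x"
    if "x * y = y * x" "x * star y = star y * x" "x * z = z * x" "x * star z = star z * x" for x y z :: 'a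
  proof
    show "x * (y * z) = y * z * x"
      by (simp only: mult.assoc[symmetric] that(1)) (simp only: mult.assoc that(3))
    show "x * star (y * z) = star (y * z) * x"
      by (simp only: star_mult mult.assoc[symmetric] that(4)) (simp only: mult.assoc that(2))
  qed
  ultimately show ?thesis
    unfolding cstar_subalgebra_def
    by (simp add: star_simps distrib_left distrib_right mult_scaleC_left mult_scaleC_right)
qed

definition shift_seq :: "nat \<Rightarrow> (nat \<Rightarrow> nat) \<Rightarrow> nat \<Rightarrow> nat" where
  "shift_seq a p = (\<lambda>k. p (a + k))"

definition cons_seq :: "nat \<Rightarrow> (nat \<Rightarrow> nat) \<Rightarrow> nat \<Rightarrow> nat" where
  "cons_seq i p = case_nat i p"

lemma shift_seq_0 [simp]: "shift_seq 0 p = p"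
  by (simp add: shift_seq_def)

lemma shift_seq_shift_seq: "shift_seq a (shift_seq b p) = shift_seq (b + a) p"
  by (simp add: shift_seq_def add.assoc)

lemma shift_seq_cons_seq: "shift_seq (Suc a) (cons_seq i p) = shift_seq a p"
  by (simp add: shift_seq_def cons_seq_def)

definition aperiodic :: "(nat \<Rightarrow> nat) \<Rightarrow> bool" where
  "aperiodic p \<longleftrightarrow> (\<forall>a b. a \<noteq> b \<longrightarrow> shift_seq a p \<noteq> shift_seq b p)"

lemma aperiodic_shift_seq: "aperiodic p \<Longrightarrow> aperiodic (shift_seq c p)"
  by (simp add: aperiodic_def shift_seq_shift_seq)

lemma aperiodic_cons_seq:
  assumes "aperiodic p"
  shows "aperiodic (cons_seq i p)"
  unfolding aperiodic_def
proof (intro allI impI notI)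
  fix a b :: nat assume "a \<noteq> b" and eq: "shift_seq a (cons_seq i p) = shift_seq b (cons_seq i p)"
  have "shift_seq a p = shift_seq b p"
    using arg_cong[OF eq, of "shift_seq 1"] by (simp add: shift_seq_shift_seq shift_seq_cons_seq)
  then show False using assms \<open>a \<noteq> b\<close> by (simp add: aperiodic_def)
qed

lemma aperiodic_powers_of_2: "aperiodic (\<lambda>k. if \<exists>j. k = 2 ^ j then 2 else 1)" (is "aperiodic ?p")
  unfolding aperiodic_def
proof (intro allI impI notI)
  have *: False if "a < b" and eq: "shift_seq a ?p = shift_seq b ?p" for a b
  proof -
    define k where "k = 2 ^ b - a"
    have "b < 2 ^ b" by (rule less_exp)
    then have "a < 2 ^ b" using \<open>a < b\<close> by (rule less_trans[rotated])
    then have k: "a + k = 2 ^ b" by (simp add: k_def less_imp_le)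
    have "?p (a + k) = ?p (b + k)" using fun_cong[OF eq, of k] by (simp add: shift_seq_def)
    then obtain j where j: "b + k = 2 ^ j" unfolding k by (auto split: if_splits)
    have "(2::nat) ^ j < 2 * 2 ^ b"
      using k j \<open>b < 2 ^ b\<close> by linarith
    then have lt: "(2::nat) ^ b < 2 ^ j" "(2::nat) ^ j < 2 ^ Suc b"
      using k j \<open>a < b\<close> by (linarith, simp only: power_Suc)
    then have "b < j" "j < Suc b" by (simp_all only: power_strict_increasing_iff)
    then show False by simp
  qed
  fix a b :: nat assume "a \<noteq> b" "shift_seq a ?p = shift_seq b ?p"
  then show False using *[of a b] *[of b a] by (metis linorder_neqE_nat)
qed

lemma words_eventually_differ:
  fixes p q :: "nat \<Rightarrow> nat"
  assumes "p \<noteq> q"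
  obtains m where "\<And>k. k > m \<Longrightarrow> map p [0..<k] \<noteq> map q [0..<k]"
proof -
  obtain m where "p m \<noteq> q m" using assms by blast
  then have "map p [0..<k] \<noteq> map q [0..<k]" if "k > m" for k
    using that by (metis add_0 diff_zero length_upt map_equality_iff nth_upt)
  then show ?thesis by (rule that)
qed

context cuntz_family
begin

abbreviation diagonal :: "'a set" where "diagonal \<equiv> cuntz_diagonal n S"

lemma subalgebra_diagonal: "cstar_subalgebra diagonal"
  unfolding cuntz_diagonal_def by (rule cstar_subalgebra_generated)

lemma diagonal_closed_under:
  "0 \<in> diagonal" "x \<in> diagonal \<Longrightarrow> y \<in> diagonal \<Longrightarrow> x + y \<in> diagonal"
  "x \<in> diagonal \<Longrightarrow> c *\<^sub>C x \<in> diagonal" "x \<in> diagonal \<Longrightarrow> y \<in> diagonal \<Longrightarrow> x * y \<in> diagonal"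
  "x \<in> diagonal \<Longrightarrow> star x \<in> diagonal" "closed diagonal"
  using subalgebra_diagonal by (simp_all add: cstar_subalgebra_def)

lemma diagonal_sum: "(\<And>i. i \<in> I \<Longrightarrow> f i \<in> diagonal) \<Longrightarrow> sum f I \<in> diagonal"
  by (induction I rule: infinite_finite_induct) (simp_all add: diagonal_closed_under(1,2))

lemma words_lists: "\<mu> \<in> words k \<Longrightarrow> \<mu> \<in> lists idx"
  by (auto simp: words_def)

lemma lists_words: "\<mu> \<in> lists idx \<Longrightarrow> \<mu> \<in> words (length \<mu>)"
  by (auto simp: words_def)

lemma word_projection_diagonal: "\<mu> \<in> lists idx \<Longrightarrow> sw \<mu> * star (sw \<mu>) \<in> diagonal"
  unfolding cuntz_diagonal_def idx_def[symmetric]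
  by (rule subsetD[OF cstar_generated_superset]) (auto simp: word_projection_def)

lemma diagonal_subset_B: "diagonal \<subseteq> B"
  unfolding cuntz_diagonal_def idx_def[symmetric] word_projection_def
  by (intro cstar_generated_least subalgebra_B image_subsetI B_closed_under(4,5) B_word[OF lists_words])

lemma word_projections_commute:
  "\<mu> \<in> lists idx \<Longrightarrow> \<nu> \<in> lists idx \<Longrightarrow>
    sw \<mu> * star (sw \<mu>) * (sw \<nu> * star (sw \<nu>)) = sw \<nu> * star (sw \<nu>) * (sw \<mu> * star (sw \<mu>))"
proof (induction \<mu> arbitrary: \<nu>)
  case (Cons i \<mu>)
  show ?case
  proof (cases \<nu>)
    case [simp]: (Cons j \<nu>')
    have ij: "i \<in> idx" "j \<in> idx" "\<mu> \<in> lists idx" "\<nu>' \<in> lists idx" using Cons.prems by auto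
    show ?thesis
    proof (cases "i = j")
      case True
      have "star (S i) * (S i * x) = x" for x using ij by simp
      then have "sw (i # \<mu>) * star (sw (i # \<mu>)) * (sw \<nu> * star (sw \<nu>))
          = S i * (sw \<mu> * star (sw \<mu>) * (sw \<nu>' * star (sw \<nu>'))) * star (S i)"
        "sw \<nu> * star (sw \<nu>) * (sw (i # \<mu>) * star (sw (i # \<mu>)))
          = S i * (sw \<nu>' * star (sw \<nu>') * (sw \<mu> * star (sw \<mu>))) * star (S i)"
        using True by (simp_all add: star_simps mult.assoc)
      then show ?thesis using Cons.IH[OF ij(3,4)] by simp
    next
      case False
      then show ?thesis using ij by (simp add: star_simps mult.assoc S_star_S_assoc)
    qed
  qed simp
qed simp

lemma star_word_projection: "star (sw \<mu> * star (sw \<mu>)) = sw \<mu> * star (sw \<mu>)"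
  by (simp add: star_simps)

lemma commutes_with_diagonalI:
  assumes "\<And>\<mu>. \<mu> \<in> lists idx \<Longrightarrow> y * (sw \<mu> * star (sw \<mu>)) = sw \<mu> * star (sw \<mu>) * y"
    and "d \<in> diagonal"
  shows "y * d = d * y"
proof -
  have "diagonal \<subseteq> {d. \<forall>x\<in>{y}. x * d = d * x \<and> x * star d = star d * x}"
    unfolding cuntz_diagonal_def idx_def[symmetric] word_projection_def
    by (intro cstar_generated_least commutant_subalgebra image_subsetI CollectI ballI)
      (use assms(1) in \<open>auto simp only: star_word_projection\<close>)
  then show ?thesis using assms(2) by blast
qed

lemma diagonal_abelian: "x \<in> diagonal \<Longrightarrow> y \<in> diagonal \<Longrightarrow> x * y = y * x"
proof -
  assume x: "x \<in> diagonal" and y: "y \<in> diagonal"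
  have "sw \<mu> * star (sw \<mu>) * x = x * (sw \<mu> * star (sw \<mu>))" if "\<mu> \<in> lists idx" for \<mu>
    using x by (rule commutes_with_diagonalI[rotated]) (rule word_projections_commute[OF that])
  then show "x * y = y * x" using y by (intro commutes_with_diagonalI[of x y]) simp_all
qed

definition diag :: "nat \<Rightarrow> 'a \<Rightarrow> 'a" where
  "diag k x = (\<Sum>\<mu>\<in>words k. sw \<mu> * (star (sw \<mu>) * x * sw \<mu>) * star (sw \<mu>))"

lemma diag_Suc: "diag (Suc k) x = (\<Sum>i\<in>idx. S i * diag k (star (S i) * x * S i) * star (S i))"
  by (simp add: diag_def sum_words_Suc sum_distrib_left sum_distrib_right star_simps mult.assoc)

lemma hom_S_compress:
  assumes x: "x \<in> hom (Suc a) (Suc b)" and i: "i \<in> idx" and j: "j \<in> idx"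
  shows "star (S i) * x * S j \<in> hom a b"
  unfolding hom_def
proof (intro CollectI ballI)
  fix \<mu> \<nu> assume "\<mu> \<in> words a" "\<nu> \<in> words b"
  then have "star (sw (i # \<mu>)) * x * sw (j # \<nu>) \<in> scalars"
    using i j by (intro homD[OF x]) simp_all
  then show "star (sw \<mu>) * (star (S i) * x * S j) * sw \<nu> \<in> scalars"
    by (simp add: star_simps mult.assoc)
qed

lemma hom_0_scalars: "x \<in> hom 0 0 \<Longrightarrow> x \<in> scalars"
  using homD[of x 0 0 "[]" "[]"] by simp

lemma diag_stable: "h \<in> hom k k \<Longrightarrow> diag (Suc k) h = diag k h"
proof (induction k arbitrary: h)
  case 0
  then obtain c where "h = c *\<^sub>C 1" by (meson hom_0_scalars scalarsE)
  then show ?case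
    by (simp add: diag_def sum_words_Suc mult_scaleC_left mult_scaleC_right sum_ranges
        flip: complex_vector.scale_sum_right)
next
  case (Suc k)
  then show ?case
    unfolding diag_Suc[of "Suc k"] diag_Suc[of k] by (intro sum.cong refl) (simp add: hom_S_compress)
qed

lemma diag_stable_le:
  assumes h: "h \<in> hom k k" and "k \<le> m"
  shows "diag m h = diag k h"
  using \<open>k \<le> m\<close>
proof (induction m rule: dec_induct)
  case (step m)
  have "h \<in> hom m m" using hom_raise[OF h, of "m - k"] step by simp
  then show ?case using step.IH by (simp add: diag_stable)
qed simp

lemma diag_in_diagonal:
  assumes "h \<in> hom k k"
  shows "diag k h \<in> diagonal"
  unfolding diag_def
proof (rule diagonal_sum)
  fix \<mu> assume \<mu>: "\<mu> \<in> words k"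
  obtain c where c: "star (sw \<mu>) * h * sw \<mu> = c *\<^sub>C 1"
    using homD[OF assms \<mu> \<mu>] by (rule scalarsE)
  have "sw \<mu> * (star (sw \<mu>) * h * sw \<mu>) * star (sw \<mu>) = c *\<^sub>C (sw \<mu> * star (sw \<mu>))"
    unfolding c by (simp add: mult_scaleC_left mult_scaleC_right)
  then show "sw \<mu> * (star (sw \<mu>) * h * sw \<mu>) * star (sw \<mu>) \<in> diagonal"
    using word_projection_diagonal[OF words_lists[OF \<mu>]] by (simp add: diagonal_closed_under(3))
qed

text \<open>Compression by this isometry computes the diagonal part of an element of \<open>hom k k\<close>; being
  of the form \<open>p\<^sup>* x p\<close> it is contractive for trivial reasons.\<close>

definition doubling :: "nat \<Rightarrow> 'a" where
  "doubling k = (\<Sum>\<mu>\<in>words k. sw \<mu> * sw \<mu> * star (sw \<mu>))"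

lemma star_doubling_mult:
  "star (doubling k) * x = (\<Sum>\<mu>\<in>words k. sw \<mu> * star (sw \<mu>) * star (sw \<mu>) * x)"
  by (simp add: doubling_def star_simps sum_distrib_right mult.assoc)

lemma doubling_isometry: "star (doubling k) * doubling k = 1"
proof -
  have "star (doubling k) * doubling k
      = (\<Sum>\<mu>\<in>words k. star (doubling k) * (sw \<mu> * sw \<mu>) * star (sw \<mu>))"
    by (subst (2) doubling_def) (simp add: sum_distrib_left mult.assoc)
  also have "\<dots> = (\<Sum>\<mu>\<in>words k. sw \<mu> * star (sw \<mu>))"
  proof (rule sum.cong)
    fix \<mu> assume \<mu>: "\<mu> \<in> words k"
    have "star (doubling k) * (sw \<mu> * sw \<mu>) = (\<Sum>\<nu>\<in>words k. if \<nu> = \<mu> then sw \<mu> else 0)"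
      unfolding star_doubling_mult
      by (rule sum.cong) (auto simp: mult.assoc word_star_word_assoc[OF _ \<mu>] word_star_word[OF _ \<mu>])
    also have "\<dots> = sw \<mu>" using \<mu> by (simp add: sum.delta)
    finally show "star (doubling k) * (sw \<mu> * sw \<mu>) * star (sw \<mu>) = sw \<mu> * star (sw \<mu>)" by simp
  qed simp
  finally show ?thesis by (simp add: sum_word_projections)
qed

lemma doubling_compress:
  assumes h: "h \<in> hom k k"
  shows "star (doubling k) * h * doubling k = diag k h"
proof -
  have "star (doubling k) * h * doubling k
      = (\<Sum>\<mu>\<in>words k. star (doubling k) * (h * sw \<mu> * sw \<mu>) * star (sw \<mu>))"
    by (subst (2) doubling_def) (simp add: sum_distrib_left mult.assoc)
  also have "\<dots> = diag k h"
    unfolding diag_def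
  proof (rule sum.cong)
    fix \<mu> assume \<mu>: "\<mu> \<in> words k"
    have "star (doubling k) * (h * sw \<mu> * sw \<mu>)
        = (\<Sum>\<nu>\<in>words k. if \<nu> = \<mu> then sw \<mu> * (star (sw \<mu>) * h * sw \<mu>) else 0)"
      unfolding star_doubling_mult
    proof (rule sum.cong)
      fix \<nu> assume \<nu>: "\<nu> \<in> words k"
      obtain c where c: "star (sw \<nu>) * h * sw \<mu> = c *\<^sub>C 1"
        using homD[OF h \<nu> \<mu>] by (rule scalarsE)
      have "sw \<nu> * star (sw \<nu>) * star (sw \<nu>) * (h * sw \<mu> * sw \<mu>)
          = sw \<nu> * star (sw \<nu>) * (star (sw \<nu>) * h * sw \<mu>) * sw \<mu>"
        by (simp only: mult.assoc)
      also have "\<dots> = sw \<nu> * (star (sw \<nu>) * h * sw \<mu>) * (star (sw \<nu>) * sw \<mu>)"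
        unfolding c by (simp add: mult_scaleC_left mult_scaleC_right mult.assoc)
      finally show "sw \<nu> * star (sw \<nu>) * star (sw \<nu>) * (h * sw \<mu> * sw \<mu>)
          = (if \<nu> = \<mu> then sw \<mu> * (star (sw \<mu>) * h * sw \<mu>) else 0)"
        by (simp add: word_star_word[OF \<nu> \<mu>])
    qed simp
    also have "\<dots> = sw \<mu> * (star (sw \<mu>) * h * sw \<mu>)" using \<mu> by (simp add: sum.delta)
    finally show "star (doubling k) * (h * sw \<mu> * sw \<mu>) * star (sw \<mu>)
        = sw \<mu> * (star (sw \<mu>) * h * sw \<mu>) * star (sw \<mu>)" by simp
  qed simp
  finally show ?thesis .
qed


definition seq_word :: "(nat \<Rightarrow> nat) \<Rightarrow> nat \<Rightarrow> 'a" where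
  "seq_word p k = sw (map p [0..<k])"

definition admissible :: "(nat \<Rightarrow> nat) \<Rightarrow> bool" where
  "admissible p \<longleftrightarrow> range p \<subseteq> idx \<and> aperiodic p"

lemma prefix_words: "admissible p \<Longrightarrow> map p [0..<k] \<in> words k"
  by (auto simp: admissible_def words_def)

lemma admissible_shift_seq: "admissible p \<Longrightarrow> admissible (shift_seq a p)"
  unfolding admissible_def by (intro conjI aperiodic_shift_seq) (auto simp: shift_seq_def)

lemma admissible_cons_seq: "admissible p \<Longrightarrow> i \<in> idx \<Longrightarrow> admissible (cons_seq i p)"
  unfolding admissible_def
  by (intro conjI aperiodic_cons_seq) (auto simp: cons_seq_def image_subset_iff split: nat.splits)

lemma ex_admissible: "\<exists>p. admissible p"
  using aperiodic_powers_of_2 by (intro exI[of _ "\<lambda>k. if \<exists>j. k = 2 ^ j then 2 else 1"])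
    (auto simp: admissible_def)

lemma norm_seq_word: "admissible p \<Longrightarrow> norm (seq_word p k) \<le> 1"
  using norm_word[OF prefix_words] by (simp add: seq_word_def)

lemma seq_word_isometry: "admissible p \<Longrightarrow> star (seq_word p k) * seq_word p k = 1"
  using word_star_word[OF prefix_words prefix_words] by (simp add: seq_word_def)

lemma seq_word_add: "seq_word p (a + k) = seq_word p a * seq_word (shift_seq a p) k"
proof -
  have "map p [0..<a + k] = map p [0..<a] @ map (shift_seq a p) [0..<k]"
    by (rule nth_equalityI) (auto simp: nth_append shift_seq_def)
  then show ?thesis by (simp add: seq_word_def)
qed

lemma seq_word_Suc: "seq_word p (Suc k) = S (p 0) * seq_word (shift_seq 1 p) k"
  using seq_word_add[of p 1 k] by (simp add: seq_word_def)

lemma seq_word_cons_seq: "seq_word (cons_seq i p) (Suc k) = S i * seq_word p k"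
  using shift_seq_cons_seq[of 0 i p] by (simp add: seq_word_Suc) (simp add: cons_seq_def)

lemma seq_words_orthogonal:
  assumes "admissible p" "admissible q" "p \<noteq> q"
  obtains m where "\<And>i j. i > m \<Longrightarrow> j > m \<Longrightarrow> star (seq_word p i) * seq_word q j = 0"
proof -
  obtain m where m: "\<And>k. k > m \<Longrightarrow> map p [0..<k] \<noteq> map q [0..<k]"
    using words_eventually_differ[OF assms(3)] by blast
  have "star (seq_word p i) * seq_word q j = 0" if "i > m" "j > m" for i j
  proof -
    have e: "i = Suc m + (i - Suc m)" "j = Suc m + (j - Suc m)" using that by simp_all
    have "star (seq_word p (Suc m)) * seq_word q (Suc m) = 0"
      using word_star_word[OF prefix_words[OF assms(1)] prefix_words[OF assms(2)], of "Suc m"]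
        m[of "Suc m"] by (simp add: seq_word_def del: upt_Suc)
    then have "star (seq_word p (Suc m)) * (seq_word q (Suc m) * x) = 0" for x
      by (simp flip: mult.assoc)
    then show ?thesis
      by (subst e(1), subst e(2)) (simp only: seq_word_add star_mult mult.assoc mult_zero_right)
  qed
  then show ?thesis by (rule that)
qed

lemma compress_limit_in:
  assumes contr: "\<And>k. norm (P k) \<le> 1" "\<And>k. norm (Q k) \<le> 1"
    and C: "closed C" "\<And>x y. x \<in> C \<Longrightarrow> y \<in> C \<Longrightarrow> x + y \<in> C"
    and hom: "\<And>a b h. h \<in> hom a b \<Longrightarrow> \<exists>l\<in>C. (\<lambda>k. star (P k) * h * Q k) \<longlonglongrightarrow> l"
    and x: "x \<in> B"
  shows "\<exists>l\<in>C. (\<lambda>k. star (P k) * x * Q k) \<longlonglongrightarrow> l"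
proof -
  define L where "L k x = star (P k) * x * Q k" for k x
  have lip: "norm (L k x - L k y) \<le> 1 * norm (x - y)" for k x y
    using compress_lipschitz[OF contr] by (simp add: L_def)
  let ?X = "{x \<in> B. \<exists>l\<in>C. (\<lambda>k. L k x) \<longlonglongrightarrow> l}"
  have "x \<in> ?X"
    using x
  proof (induction rule: B_hom_induct)
    case closed
    show ?case
      unfolding closed_sequential_limits
    proof (intro allI impI, elim conjE)
      fix X y assume X: "\<forall>i. X i \<in> ?X" and y: "X \<longlonglongrightarrow> y"
      have "X i \<in> {x \<in> B. convergent (\<lambda>k. L k x)}" for i using X by (auto simp: convergent_def)
      then have yc: "y \<in> {x \<in> B. convergent (\<lambda>k. L k x)}"
        by (rule closed_sequentially[OF closed_convergent[OF closed_B lip] _ y])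
      then obtain l where l: "(\<lambda>k. L k y) \<longlonglongrightarrow> l" by (auto simp: convergent_def)
      have "\<exists>l. l \<in> C \<and> (\<lambda>k. L k (X i)) \<longlonglongrightarrow> l" for i using X by blast
      then obtain m where m: "\<And>i. m i \<in> C" "\<And>i. (\<lambda>k. L k (X i)) \<longlonglongrightarrow> m i" by metis
      have bound: "norm (m i - l) \<le> norm (X i - y)" for i
        by (rule LIMSEQ_le_const2[OF tendsto_norm[OF tendsto_diff[OF m(2) l]]])
          (intro exI[of _ 0] allI impI, use lip[of _ "X i" y] in simp)
      have "(\<lambda>i. norm (X i - y)) \<longlonglongrightarrow> 0" using y by (simp add: LIM_zero_iff tendsto_norm_zero)
      then have "(\<lambda>i. m i - l) \<longlonglongrightarrow> 0"
        by (rule Lim_null_comparison[OF always_eventually[OF allI[OF bound]]])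
      then have "m \<longlonglongrightarrow> l" by (simp add: LIM_zero_iff)
      then have "l \<in> C" by (rule closed_sequentially[OF C(1) m(1)])
      then show "y \<in> ?X" using l yc by blast
    qed
  next
    case (add x y)
    then obtain l m where "l \<in> C" "(\<lambda>k. L k x) \<longlonglongrightarrow> l" "m \<in> C" "(\<lambda>k. L k y) \<longlonglongrightarrow> m" by blast
    then have "l + m \<in> C" "(\<lambda>k. L k (x + y)) \<longlonglongrightarrow> l + m"
      using C(2) tendsto_add[of "\<lambda>k. L k x" l sequentially "\<lambda>k. L k y" m]
      by (simp_all add: L_def distrib_left distrib_right)
    then show ?case using add B_closed_under(2) by blast
  next
    case (hom a b h)
    then show ?case using assms(5)[OF hom] hom_subset_B unfolding L_def by blast
  qed
  then show ?thesis by (simp add: L_def)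
qed

text \<open>Compressions by these isometries converge to the conditional expectation onto the
  diagonal.\<close>

definition diagonal_probe :: "nat \<Rightarrow> 'a" where
  "diagonal_probe k = sh k (probe k) * doubling k"

lemma norm_diagonal_probe: "norm (diagonal_probe k) \<le> 1"
  unfolding diagonal_probe_def
  using norm_sh_probe[of k k] norm_isometry[OF doubling_isometry, of k] by (intro norm_mult_le_1) simp_all

lemma diagonal_probe_compress:
  assumes h: "h \<in> hom a b" and k: "a \<le> k" "b \<le> k"
  shows "star (diagonal_probe k) * h * diagonal_probe k = (if a = b then diag a h else 0)"
proof -
  have "star (diagonal_probe k) * h * diagonal_probe k
      = star (doubling k) * (star (sh k (probe k)) * h * sh k (probe k)) * doubling k"
    by (simp add: diagonal_probe_def star_mult mult.assoc)
  also have "star (sh k (probe k)) * h * sh k (probe k) = (if k + b = a + k then h else 0)"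
    using k by (intro probe_extract[OF h]) auto
  also have "star (doubling k) * (if k + b = a + k then h else 0) * doubling k
      = (if a = b then diag a h else 0)"
  proof (cases "a = b")
    case True
    then have "h \<in> hom a a" "h \<in> hom k k" using h hom_raise[OF h, of "k - a"] k by simp_all
    then show ?thesis
      using True k diag_stable_le[of h a k] by (simp add: doubling_compress)
  qed simp
  finally show ?thesis .
qed

lemma diag_compress:
  assumes \<mu>: "\<mu> \<in> words k"
  shows "star (sw \<mu>) * diag k x * sw \<mu> = star (sw \<mu>) * x * sw \<mu>"
proof -
  have "star (sw \<mu>) * diag k x * sw \<mu>
      = (\<Sum>\<nu>\<in>words k. if \<nu> = \<mu> then star (sw \<mu>) * x * sw \<mu> else 0)"
    unfolding diag_def sum_distrib_left sum_distrib_right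
    by (rule sum.cong)
      (auto simp: mult.assoc word_star_word[OF _ \<mu>] word_star_word[OF \<mu>] word_star_word_assoc[OF \<mu>])
  also have "\<dots> = star (sw \<mu>) * x * sw \<mu>" using \<mu> by (simp add: sum.delta)
  finally show ?thesis .
qed

lemma seq_word_compress_hom:
  assumes p: "admissible p" and h: "h \<in> hom a b"
  shows "\<forall>\<^sub>F k in sequentially.
    star (seq_word p k) * (h - (if a = b then diag a h else 0)) * seq_word p k = 0"
proof (cases "a = b")
  case True
  have z: "star (seq_word p a) * (h - diag a h) * seq_word p a = 0"
    using diag_compress[OF prefix_words[OF p], of a h] by (simp add: seq_word_def algebra_simps)
  have "star (seq_word p k) * (h - diag a h) * seq_word p k = 0" if "k \<ge> a" for k
  proof -
    define w where "w = seq_word (shift_seq a p) (k - a)"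
    have "seq_word p k = seq_word p a * w"
      using seq_word_add[of p a "k - a"] that by (simp add: w_def)
    then have "star (seq_word p k) * (h - diag a h) * seq_word p k
        = star w * (star (seq_word p a) * (h - diag a h) * seq_word p a) * w"
      by (simp only: star_mult mult.assoc)
    then show ?thesis by (simp add: z)
  qed
  then show ?thesis using True by (auto simp: eventually_sequentially)
next
  case False
  then have ne: "shift_seq a p \<noteq> shift_seq b p"
    using p by (simp add: admissible_def aperiodic_def)
  obtain m where m: "\<And>i j. i > m \<Longrightarrow> j > m \<Longrightarrow>
      star (seq_word (shift_seq a p) i) * seq_word (shift_seq b p) j = 0"
    using seq_words_orthogonal[OF admissible_shift_seq[OF p] admissible_shift_seq[OF p] ne] by blast
  obtain c where c: "star (seq_word p a) * h * seq_word p b = c *\<^sub>C 1"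
    using homD[OF h prefix_words[OF p] prefix_words[OF p]]
    unfolding seq_word_def[symmetric] by (rule scalarsE)
  have "star (seq_word p k) * h * seq_word p k = 0" if k: "k > a + b + m" for k
  proof -
    define w w' where "w = seq_word (shift_seq a p) (k - a)" and "w' = seq_word (shift_seq b p) (k - b)"
    have "seq_word p k = seq_word p a * w" "seq_word p k = seq_word p b * w'"
      using seq_word_add[of p a "k - a"] seq_word_add[of p b "k - b"] k by (simp_all add: w_def w'_def)
    then have "star (seq_word p k) * h * seq_word p k
        = star w * (star (seq_word p a) * h * seq_word p b) * w'"
      by (metis star_mult mult.assoc)
    also have "\<dots> = c *\<^sub>C (star w * w')"
      unfolding c by (simp add: mult_scaleC_left mult_scaleC_right)
    also have "star w * w' = 0" unfolding w_def w'_def using k by (intro m) simp_all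
    finally show ?thesis by simp
  qed
  then show ?thesis using False by (auto simp: eventually_sequentially intro!: exI[of _ "Suc (a + b + m)"])
qed

lemma diagonal_expectation:
  assumes x: "x \<in> B"
  obtains d where "d \<in> diagonal"
    "\<And>p. admissible p \<Longrightarrow> (\<lambda>k. star (seq_word p k) * (x - d) * seq_word p k) \<longlonglongrightarrow> 0"
proof -
  define L where "L k x = star (diagonal_probe k) * x * diagonal_probe k" for k x
  have L_lip: "norm (L k x - L k y) \<le> 1 * norm (x - y)" for k x y
    using compress_lipschitz[OF norm_diagonal_probe norm_diagonal_probe] by (simp add: L_def)
  have L_add: "L k (x + y) = L k x + L k y" for k x y by (simp add: L_def distrib_left distrib_right)
  define T where "T x = lim (\<lambda>k. L k x)" for x
  have L_hom: "(\<lambda>k. L k h) \<longlonglongrightarrow> (if a = b then diag a h else 0)" if "h \<in> hom a b" for a b h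
  proof (rule tendsto_eventually)
    show "\<forall>\<^sub>F k in sequentially. L k h = (if a = b then diag a h else 0)"
      unfolding L_def eventually_sequentially
      using diagonal_probe_compress[OF that] by (intro exI[of _ "a + b"]) auto
  qed
  have ex: "\<exists>d\<in>diagonal. (\<lambda>k. L k y) \<longlonglongrightarrow> d" if "y \<in> B" for y
    unfolding L_def
  proof (rule compress_limit_in[OF norm_diagonal_probe norm_diagonal_probe diagonal_closed_under(6,2) _ that])
    fix a b h assume h: "h \<in> hom a b"
    have "(if a = b then diag a h else 0) \<in> diagonal"
      using h diag_in_diagonal[of h a] by (auto simp: diagonal_closed_under(1))
    then show "\<exists>d\<in>diagonal. (\<lambda>k. star (diagonal_probe k) * h * diagonal_probe k) \<longlonglongrightarrow> d"
      using L_hom[OF h] unfolding L_def by blast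
  qed
  have T: "(\<lambda>k. L k y) \<longlonglongrightarrow> T y" "T y \<in> diagonal" if "y \<in> B" for y
    using ex[OF that] unfolding T_def by (auto dest: limI)
  have T_lip: "norm (T y - T z) \<le> norm (y - z)" if "y \<in> B" "z \<in> B" for y z
    using tendsto_norm[OF tendsto_diff[OF T(1) T(1)], OF that] L_lip[of _ y z]
    by (intro LIMSEQ_le_const2) auto
  have T_add: "T (y + z) = T y + T z" if "y \<in> B" "z \<in> B" for y z
  proof -
    have "(\<lambda>k. L k (y + z)) \<longlonglongrightarrow> T y + T z" unfolding L_add using that by (intro tendsto_add T(1))
    then show ?thesis unfolding T_def by (rule limI)
  qed
  have T_hom: "T h = (if a = b then diag a h else 0)" if "h \<in> hom a b" for a b h
    unfolding T_def by (rule limI[OF L_hom[OF that]])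
  have "T x \<in> diagonal" using x by (rule T(2))
  moreover have "(\<lambda>k. star (seq_word p k) * (x - T x) * seq_word p k) \<longlonglongrightarrow> 0" if p: "admissible p" for p
  proof -
    define N where "N k y = star (seq_word p k) * (y - T y) * seq_word p k" for k y
    have "x \<in> {y \<in> B. (\<lambda>k. N k y) \<longlonglongrightarrow> 0}"
      using x
    proof (induction rule: B_hom_induct)
      case closed
      show ?case
      proof (rule closed_null[where K = 2])
        fix k y z assume yz: "y \<in> B" "z \<in> B"
        have "norm (N k y - N k z) \<le> norm ((y - T y) - (z - T z))"
          unfolding N_def using p by (intro compress_lipschitz norm_seq_word)
        also have "(y - T y) - (z - T z) = (y - z) - (T y - T z)" by simp
        also have "norm \<dots> \<le> norm (y - z) + norm (T y - T z)" by (rule norm_triangle_ineq4)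
        finally show "norm (N k y - N k z) \<le> 2 * norm (y - z)" using T_lip[OF yz] by simp
      qed (rule closed_B)
    next
      case (add y z)
      then have "N k (y + z) = N k y + N k z" for k
        by (simp add: N_def T_add algebra_simps)
      then show ?case using add tendsto_add[of "\<lambda>k. N k y" 0 sequentially "\<lambda>k. N k z" 0]
        by (simp add: B_closed_under)
    next
      case (hom a b h)
      have "(\<lambda>k. N k h) \<longlonglongrightarrow> 0"
        unfolding N_def T_hom[OF hom] by (rule tendsto_eventually[OF seq_word_compress_hom[OF p hom]])
      then show ?case using hom hom_subset_B by blast
    qed
    then show ?thesis by (simp add: N_def)
  qed
  ultimately show ?thesis by (rule that)
qed

text \<open>Simplicity of \<open>B\<close> enters only here: elements killed by a suitable family of asymptotic
  matrix coefficients form a proper closed ideal.\<close>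

lemma null_ideal_trivial:
  fixes T :: "((nat \<Rightarrow> 'a) \<times> (nat \<Rightarrow> 'a)) set"
  defines "J \<equiv> {y \<in> B. \<forall>(P, Q)\<in>T. (\<lambda>k. star (P k) * y * Q k) \<longlonglongrightarrow> 0}"
  assumes contr: "\<And>P Q k. (P, Q) \<in> T \<Longrightarrow> norm (P k) \<le> 1 \<and> norm (Q k) \<le> 1"
    and sym: "\<And>P Q. (P, Q) \<in> T \<Longrightarrow> (Q, P) \<in> T"
    and left: "\<And>y i P Q. y \<in> J \<Longrightarrow> i \<in> idx \<Longrightarrow> (P, Q) \<in> T \<Longrightarrow> (\<lambda>k. star (P k) * (S i * y) * Q k) \<longlonglongrightarrow> 0"
    and left_star: "\<And>y i P Q. y \<in> J \<Longrightarrow> i \<in> idx \<Longrightarrow> (P, Q) \<in> T \<Longrightarrow>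
      (\<lambda>k. star (P k) * (star (S i) * y) * Q k) \<longlonglongrightarrow> 0"
    and proper: "(P0, Q0) \<in> T" "\<not> (\<lambda>k. star (P0 k) * Q0 k) \<longlonglongrightarrow> 0"
    and y: "y \<in> J"
  shows "y = 0"
proof -
  have JD: "(\<lambda>k. star (P k) * y * Q k) \<longlonglongrightarrow> 0" if "y \<in> J" "(P, Q) \<in> T" for y P Q
    using that by (auto simp: J_def)
  have JB: "J \<subseteq> B" by (auto simp: J_def)
  have JI: "y \<in> J" if "y \<in> B" "\<And>P Q. (P, Q) \<in> T \<Longrightarrow> (\<lambda>k. star (P k) * y * Q k) \<longlonglongrightarrow> 0" for y
    using that by (auto simp: J_def)
  have J0: "0 \<in> J" by (rule JI) (simp_all add: B_closed_under)
  have J_add: "x + y \<in> J" if "x \<in> J" "y \<in> J" for x y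
  proof (rule JI)
    fix P Q assume PQ: "(P, Q) \<in> T"
    show "(\<lambda>k. star (P k) * (x + y) * Q k) \<longlonglongrightarrow> 0"
      using tendsto_add[OF JD[OF that(1) PQ] JD[OF that(2) PQ]] by (simp add: distrib_left distrib_right)
  qed (use that JB B_closed_under(2) in blast)
  have J_scale: "c *\<^sub>C x \<in> J" if "x \<in> J" for c x
  proof (rule JI)
    fix P Q assume PQ: "(P, Q) \<in> T"
    show "(\<lambda>k. star (P k) * (c *\<^sub>C x) * Q k) \<longlonglongrightarrow> 0"
      using tendsto_scaleC[OF JD[OF that PQ], of c] by (simp add: mult_scaleC_left mult_scaleC_right)
  qed (use that JB B_closed_under(3) in blast)
  have J_star: "star x \<in> J" if "x \<in> J" for x
  proof (rule JI)
    fix P Q assume PQ: "(P, Q) \<in> T"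
    show "(\<lambda>k. star (P k) * star x * Q k) \<longlonglongrightarrow> 0"
      using tendsto_star[OF JD[OF that sym[OF PQ]]] by (simp add: star_simps mult.assoc)
  qed (use that JB B_closed_under(5) in blast)
  have J_closed: "closed J"
  proof -
    have "closed {y \<in> B. (\<lambda>k. star (P k) * y * Q k) \<longlonglongrightarrow> 0}" if "(P, Q) \<in> T" for P Q
      by (rule closed_null[OF closed_B, where K = 1])
        (simp add: compress_lipschitz contr[OF that])
    then have "closed (B \<inter> (\<Inter>(P, Q)\<in>T. {y \<in> B. (\<lambda>k. star (P k) * y * Q k) \<longlonglongrightarrow> 0}))"
      by (intro closed_Int closed_B closed_INT) auto
    moreover have "B \<inter> (\<Inter>(P, Q)\<in>T. {y \<in> B. (\<lambda>k. star (P k) * y * Q k) \<longlonglongrightarrow> 0}) = J"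
      by (auto simp: J_def)
    ultimately show ?thesis by simp
  qed
  define M where "M = {b \<in> B. \<forall>y\<in>J. b * y \<in> J \<and> star b * y \<in> J}"
  have "cstar_subalgebra M"
    unfolding cstar_subalgebra_def
  proof (intro conjI ballI allI)
    show "0 \<in> M" by (simp add: M_def J0 B_closed_under)
  next
    fix x y assume xy: "x \<in> M" "y \<in> M"
    show "x + y \<in> M" using xy by (simp add: M_def star_simps distrib_right J_add B_closed_under)
    show "x * y \<in> M" using xy by (simp add: M_def star_simps mult.assoc B_closed_under)
  next
    fix c x assume "x \<in> M"
    then show "c *\<^sub>C x \<in> M" by (simp add: M_def star_simps mult_scaleC_left J_scale B_closed_under)
  next
    fix x assume "x \<in> M"
    then show "star x \<in> M" by (simp add: M_def star_simps B_closed_under)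
  next
    have cont: "closed ((\<lambda>b. b * y) -` J \<inter> (\<lambda>b. star b * y) -` J)" for y
      by (intro closed_Int continuous_closed_vimage J_closed continuous_intros
          bounded_linear.continuous[OF bounded_linear_star])
    have "closed (B \<inter> (\<Inter>y\<in>J. (\<lambda>b. b * y) -` J \<inter> (\<lambda>b. star b * y) -` J))"
      using cont by (intro closed_Int[OF closed_B] closed_INT) blast
    moreover have "M = B \<inter> (\<Inter>y\<in>J. (\<lambda>b. b * y) -` J \<inter> (\<lambda>b. star b * y) -` J)"
      by (auto simp: M_def)
    ultimately show "closed M" by simp
  qed
  moreover have "S i \<in> M" if i: "i \<in> idx" for i
  proof -
    have "S i * y \<in> J" if "y \<in> J" for y
      by (rule JI) (use i that JB B_generator B_closed_under(4) left in blast)+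
    moreover have "star (S i) * y \<in> J" if "y \<in> J" for y
      by (rule JI) (use i that JB B_generator B_closed_under(4,5) left_star in blast)+
    ultimately show ?thesis using i by (simp add: M_def B_generator)
  qed
  ultimately have "B \<subseteq> M" unfolding B_eq by (intro cstar_generated_least) auto
  then have L: "b * y \<in> J" if "b \<in> B" "y \<in> J" for b y using that by (auto simp: M_def)
  have R: "y * b \<in> J" if "b \<in> B" "y \<in> J" for b y
    using J_star[OF L[OF B_closed_under(5)[OF that(1)] J_star[OF that(2)]]] by (simp add: star_simps)
  have "closed_two_sided_ideal B J"
    unfolding closed_two_sided_ideal_def using JB J0 J_add J_scale L R J_closed by simp
  then have "J = {0} \<or> J = B" using simple by (simp add: simple_cstar_algebra_def)
  moreover have "1 \<notin> J" using JD[OF _ proper(1), of 1] proper(2) by auto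
  ultimately show ?thesis using y B_one by auto
qed

lemma commutant_compress_null:
  assumes y: "\<And>d. d \<in> diagonal \<Longrightarrow> y * d = d * y"
    and null: "\<And>p. admissible p \<Longrightarrow> (\<lambda>k. star (seq_word p k) * y * seq_word p k) \<longlonglongrightarrow> 0"
    and p: "admissible p" and q: "admissible q"
  shows "(\<lambda>k. star (seq_word p (i + k)) * y * seq_word q (j + k)) \<longlonglongrightarrow> 0"
proof (cases "p = q")
  case False
  obtain m where m: "\<And>i j. i > m \<Longrightarrow> j > m \<Longrightarrow> star (seq_word p i) * seq_word q j = 0"
    using seq_words_orthogonal[OF p q False] by blast
  have "star (seq_word p (i + k)) * y * seq_word q (j + k) = 0" if "k > m" for k
  proof -
    let ?s = "seq_word p (i + k)"
    have "?s * star ?s \<in> diagonal"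
      unfolding seq_word_def by (rule word_projection_diagonal[OF words_lists[OF prefix_words[OF p]]])
    then have c: "y * (?s * star ?s) = ?s * star ?s * y" by (rule y)
    have "star ?s * y = star ?s * ?s * star ?s * y" by (simp add: seq_word_isometry p)
    also have "\<dots> = star ?s * (y * (?s * star ?s))" unfolding c by (simp add: mult.assoc)
    finally have "star ?s * y = star ?s * (y * (?s * star ?s))" .
    from arg_cong[OF this, of "\<lambda>z. z * seq_word q (j + k)"]
    have "star ?s * y * seq_word q (j + k) = star ?s * y * ?s * (star ?s * seq_word q (j + k))"
      by (simp only: mult.assoc)
    then show ?thesis using m[of "i + k" "j + k"] that by simp
  qed
  then have "\<forall>\<^sub>F k in sequentially. star (seq_word p (i + k)) * y * seq_word q (j + k) = 0"
    by (auto simp: eventually_sequentially intro!: exI[of _ "Suc m"])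
  then show ?thesis by (rule tendsto_eventually)
next
  case [simp]: True
  define m where "m = min i j"
  have "(\<lambda>k. star (seq_word q (k + m)) * y * seq_word q (k + m)) \<longlonglongrightarrow> 0"
    by (rule LIMSEQ_ignore_initial_segment[OF null[OF q]])
  then have lim: "(\<lambda>k. norm (star (seq_word q (m + k)) * y * seq_word q (m + k))) \<longlonglongrightarrow> 0"
    by (simp add: tendsto_norm_zero_iff add.commute)
  have bound: "norm (star (seq_word q (i + k)) * y * seq_word q (j + k))
      \<le> norm (star (seq_word q (m + k)) * y * seq_word q (m + k))" for k
  proof -
    define v w where "v = seq_word (shift_seq (m + k) q) (i - m)"
      and "w = seq_word (shift_seq (m + k) q) (j - m)"
    have e: "m + k + (i - m) = i + k" "m + k + (j - m) = j + k" by (simp_all add: m_def)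
    have vw: "seq_word q (i + k) = seq_word q (m + k) * v" "seq_word q (j + k) = seq_word q (m + k) * w"
      using seq_word_add[of q "m + k" "i - m"] seq_word_add[of q "m + k" "j - m"]
      unfolding e v_def w_def by blast+
    have "norm v \<le> 1" "norm w \<le> 1"
      unfolding v_def w_def by (intro norm_seq_word admissible_shift_seq q)+
    then show ?thesis
      using norm_compress_le[of v w "star (seq_word q (m + k)) * y * seq_word q (m + k)"]
      unfolding vw star_mult by (simp only: mult.assoc)
  qed
  have "(\<lambda>k. star (seq_word q (i + k)) * y * seq_word q (j + k)) \<longlonglongrightarrow> 0"
    by (rule Lim_null_comparison[OF always_eventually[OF allI[OF bound]] lim])
  then show ?thesis by simp
qed

lemma diagonal_maximal:
  assumes x: "x \<in> B" and comm: "\<And>d. d \<in> diagonal \<Longrightarrow> x * d = d * x"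
  shows "x \<in> diagonal"
proof -
  obtain e where e: "e \<in> diagonal"
    "\<And>p. admissible p \<Longrightarrow> (\<lambda>k. star (seq_word p k) * (x - e) * seq_word p k) \<longlonglongrightarrow> 0"
    using diagonal_expectation[OF x] by blast
  define T where "T = {(\<lambda>k. seq_word p (i + k), \<lambda>k. seq_word q (j + k)) | p q i j.
    admissible p \<and> admissible q}"
  define J where "J = {y \<in> B. \<forall>(P, Q)\<in>T. (\<lambda>k. star (P k) * y * Q k) \<longlonglongrightarrow> 0}"
  have TI: "(\<lambda>k. seq_word p (i + k), \<lambda>k. seq_word q (j + k)) \<in> T"
    if "admissible p" "admissible q" for p q i j using that unfolding T_def by blast
  have JD: "(\<lambda>k. star (seq_word p (i + k)) * y * seq_word q (j + k)) \<longlonglongrightarrow> 0"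
    if "y \<in> J" "admissible p" "admissible q" for y p q i j
    using that(1) TI[OF that(2,3), of i j] by (auto simp: J_def)
  obtain p0 where p0: "admissible p0" using ex_admissible by blast
  have "x - e = 0"
  proof (rule null_ideal_trivial[where T = T])
    show "x - e \<in> {y \<in> B. \<forall>(P, Q)\<in>T. (\<lambda>k. star (P k) * y * Q k) \<longlonglongrightarrow> 0}"
    proof (intro CollectI conjI B_diff x subsetD[OF diagonal_subset_B e(1)])
      have c: "(x - e) * d = d * (x - e)" if "d \<in> diagonal" for d
        using comm[OF that] diagonal_abelian[OF e(1) that] by (simp add: left_diff_distrib right_diff_distrib)
      show "\<forall>(P, Q)\<in>T. (\<lambda>k. star (P k) * (x - e) * Q k) \<longlonglongrightarrow> 0"
        unfolding T_def using commutant_compress_null[OF c e(2)] by auto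
    qed
  next
    fix P Q k assume "(P, Q) \<in> T"
    then show "norm (P k) \<le> 1 \<and> norm (Q k) \<le> 1" unfolding T_def using norm_seq_word by auto
  next
    fix P Q assume "(P, Q) \<in> T"
    then show "(Q, P) \<in> T" unfolding T_def by blast
  next
    show "((\<lambda>k. seq_word p0 (0 + k)), (\<lambda>k. seq_word p0 (0 + k))) \<in> T" by (rule TI[OF p0 p0])
    show "\<not> (\<lambda>k. star (seq_word p0 (0 + k)) * seq_word p0 (0 + k)) \<longlonglongrightarrow> 0"
      by (simp add: seq_word_isometry p0 LIMSEQ_const_iff)
  next
    fix y i P Q assume y: "y \<in> {y \<in> B. \<forall>(P, Q)\<in>T. (\<lambda>k. star (P k) * y * Q k) \<longlonglongrightarrow> 0}"
      and i: "i \<in> idx" and "(P, Q) \<in> T"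
    then obtain p q a b where PQ: "P = (\<lambda>k. seq_word p (a + k))" "Q = (\<lambda>k. seq_word q (b + k))"
      and pq: "admissible p" "admissible q" unfolding T_def by blast
    have yJ: "y \<in> J" using y by (simp only: J_def)
    have p0: "p 0 \<in> idx" using pq(1) by (auto simp: admissible_def)
    have "star (P (Suc k)) * (S i * y) * Q (Suc k)
        = (if p 0 = i then star (seq_word (shift_seq 1 p) (a + k)) * y * seq_word q (Suc b + k) else 0)" for k
      unfolding PQ add_Suc_right seq_word_Suc[of p]
      by (simp add: star_mult mult.assoc S_star_S_assoc[OF p0 i])
    then have "(\<lambda>k. star (P (Suc k)) * (S i * y) * Q (Suc k)) \<longlonglongrightarrow> 0"
      using JD[OF yJ admissible_shift_seq[OF pq(1)] pq(2), of 1 a "Suc b"]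
      by (cases "p 0 = i") simp_all
    then show "(\<lambda>k. star (P k) * (S i * y) * Q k) \<longlonglongrightarrow> 0" by (rule LIMSEQ_imp_Suc)
    have "star (P k) * (star (S i) * y) * Q k
        = star (seq_word (cons_seq i p) (Suc a + k)) * y * seq_word q (b + k)" for k
      unfolding PQ add_Suc seq_word_cons_seq by (simp add: star_mult mult.assoc)
    then show "(\<lambda>k. star (P k) * (star (S i) * y) * Q k) \<longlonglongrightarrow> 0"
      using JD[OF yJ admissible_cons_seq[OF pq(1) i] pq(2), of "Suc a" b] by simp
  qed
  then show ?thesis using e(1) by simp
qed

lemma masa_diagonal: "masa B diagonal"
  unfolding masa_def
proof (intro conjI allI impI)
  show "abelian_cstar_subalgebra_of B diagonal"
    unfolding abelian_cstar_subalgebra_of_def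
    using subalgebra_diagonal diagonal_subset_B diagonal_abelian by simp
next
  fix A assume A: "abelian_cstar_subalgebra_of B A \<and> diagonal \<subseteq> A"
  have "x \<in> diagonal" if "x \<in> A" for x
  proof (rule diagonal_maximal)
    show "x \<in> B" using A that by (auto simp: abelian_cstar_subalgebra_of_def)
    show "x * d = d * x" if "d \<in> diagonal" for d
      using A \<open>x \<in> A\<close> that unfolding abelian_cstar_subalgebra_of_def by blast
  qed
  then show "A = diagonal" using A by blast
qed

end

section \<open>Inner conjugacy of diagonals\<close>

lemma norm_unitary: "u \<in> unitaries A \<Longrightarrow> norm (u::'a::cstar_algebra) = 1"
  by (rule norm_isometry) (simp add: unitaries_def)

context cuntz_family
begin

lemma words_1: "words (Suc 0) = (\<lambda>i. [i]) ` idx"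
  by (auto simp: words_def length_Suc_conv)

lemma sum_words_1: "(\<Sum>\<mu>\<in>words (Suc 0). f \<mu>) = (\<Sum>i\<in>idx. f [i])"
  by (simp add: sum_words_Suc)

lemma hom_1_1D: "x \<in> hom 1 1 \<Longrightarrow> i \<in> idx \<Longrightarrow> j \<in> idx \<Longrightarrow> star (S i) * x * S j \<in> scalars"
  using homD[of x 1 1 "[i]" "[j]"] by (simp add: words_1)

lemma hom_1_1_expansion: "x = (\<Sum>i\<in>idx. \<Sum>j\<in>idx. S i * (star (S i) * x * S j) * star (S j))"
  using word_expansion[where x = x and a = 1 and b = 1] by (simp add: sum_words_1)

lemma F1_eq: "cuntz_F1 n S = hom 1 1"
proof
  show "cuntz_F1 n S \<subseteq> hom 1 1"
  proof
    fix x assume "x \<in> cuntz_F1 n S"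
    then show "x \<in> hom 1 1"
      unfolding cuntz_F1_def
    proof (induction rule: complex_vector.span_induct_alt)
      case base show ?case by (rule hom_zero)
    next
      case (step c x y)
      then obtain i j where ij: "i \<in> idx" "j \<in> idx" "x = S i * star (S j)" by (auto simp: idx_def)
      have "x \<in> hom 1 1" unfolding ij(3) by (rule hom_mult[OF S_hom[OF ij(1)] hom_star[OF S_hom[OF ij(2)]]])
      then show ?case using step.IH by (intro hom_add hom_scaleC)
    qed
  qed
  show "hom 1 1 \<subseteq> cuntz_F1 n S"
  proof
    fix x assume x: "x \<in> hom 1 1"
    have "S i * (star (S i) * x * S j) * star (S j) \<in> cuntz_F1 n S" if ij: "i \<in> idx" "j \<in> idx" for i j
    proof -
      obtain c where c: "star (S i) * x * S j = c *\<^sub>C 1" using hom_1_1D[OF x ij] by (rule scalarsE)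
      have "S i * star (S j) \<in> cuntz_F1 n S"
        unfolding cuntz_F1_def using ij by (intro complex_vector.span_base) (auto simp: idx_def)
      then have "c *\<^sub>C (S i * star (S j)) \<in> cuntz_F1 n S"
        unfolding cuntz_F1_def by (rule complex_vector.span_scale)
      then show ?thesis unfolding c by (simp add: mult_scaleC_left mult_scaleC_right)
    qed
    then have "(\<Sum>i\<in>idx. \<Sum>j\<in>idx. S i * (star (S i) * x * S j) * star (S j)) \<in> cuntz_F1 n S"
      unfolding cuntz_F1_def by (intro complex_vector.span_sum)
    then show "x \<in> cuntz_F1 n S" by (simp only: hom_1_1_expansion[symmetric])
  qed
qed

lemma sh_eq_sum: "sh k y = (\<Sum>\<mu>\<in>words k. sw \<mu> * y * star (sw \<mu>))"
proof -
  have "sh k y = (\<Sum>\<mu>\<in>words k. sh k y * (sw \<mu> * star (sw \<mu>)))"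
    by (simp add: sum_word_projections flip: sum_distrib_left)
  also have "\<dots> = (\<Sum>\<mu>\<in>words k. sw \<mu> * y * star (sw \<mu>))"
    by (rule sum.cong) (simp_all add: sh_word flip: mult.assoc)
  finally show ?thesis .
qed

lemma sh_S_projection_diagonal:
  assumes i: "i \<in> idx"
  shows "sh k (S i * star (S i)) \<in> diagonal"
  unfolding sh_eq_sum
proof (rule diagonal_sum)
  fix \<mu> assume "\<mu> \<in> words k"
  then have "\<mu> @ [i] \<in> lists idx" using i words_lists by auto
  from word_projection_diagonal[OF this]
  show "sw \<mu> * (S i * star (S i)) * star (sw \<mu>) \<in> diagonal" by (simp add: star_simps mult.assoc)
qed

lemma unitary_hom_family:
  assumes v: "v \<in> unitaries (hom 1 1)"
  shows "cuntz_family n (\<lambda>i. v * S i) B"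
proof -
  have vh: "v \<in> hom 1 1" and vu: "star v * v = 1" "v * star v = 1"
    using v by (simp_all add: unitaries_def)
  let ?T = "\<lambda>i. v * S i"
  let ?G = "cstar_generated (?T ` idx)"
  have iso: "star (?T i) * ?T i = 1" if "i \<in> idx" for i
  proof -
    have "star (?T i) * ?T i = star (S i) * (star v * v) * S i" by (simp add: star_mult mult.assoc)
    then show ?thesis using that by (simp add: vu)
  qed
  have sum: "(\<Sum>i\<in>idx. ?T i * star (?T i)) = 1"
  proof -
    have "(\<Sum>i\<in>idx. ?T i * star (?T i)) = v * (\<Sum>i\<in>idx. S i * star (S i)) * star v"
      by (simp add: star_mult sum_distrib_left sum_distrib_right mult.assoc)
    then show ?thesis by (simp add: sum_ranges vu)
  qed
  have "v \<in> B" using vh hom_subset_B by blast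
  then have "?G \<subseteq> B"
    by (intro cstar_generated_least subalgebra_B image_subsetI B_closed_under(4) B_generator)
  moreover have "B \<subseteq> ?G"
  proof -
    have G: "cstar_subalgebra ?G" by (rule cstar_subalgebra_generated)
    have Gc: "0 \<in> ?G" "\<And>x y. x \<in> ?G \<Longrightarrow> y \<in> ?G \<Longrightarrow> x + y \<in> ?G" "\<And>c x. x \<in> ?G \<Longrightarrow> c *\<^sub>C x \<in> ?G"
      "\<And>x y. x \<in> ?G \<Longrightarrow> y \<in> ?G \<Longrightarrow> x * y \<in> ?G" "\<And>x. x \<in> ?G \<Longrightarrow> star x \<in> ?G"
      using G by (simp_all add: cstar_subalgebra_def)
    have T: "?T i \<in> ?G" if "i \<in> idx" for i
      by (rule subsetD[OF cstar_generated_superset imageI[OF that]])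
    have Gsum: "sum f I \<in> ?G" if "\<And>i. i \<in> I \<Longrightarrow> f i \<in> ?G" for f and I :: "nat set"
      using that by (induction I rule: infinite_finite_induct) (simp_all add: Gc(1,2))
    have "star v = v * star v * star v" by (simp add: vu)
    also have "\<dots> = v * (\<Sum>i\<in>idx. \<Sum>j\<in>idx. S i * (star (S i) * star v * S j) * star (S j)) * star v"
      by (simp only: hom_1_1_expansion[symmetric])
    also have "\<dots> = (\<Sum>i\<in>idx. \<Sum>j\<in>idx. ?T i * (star (S i) * star v * S j) * star (?T j))"
      by (simp only: sum_distrib_left sum_distrib_right star_mult mult.assoc)
    also have "\<dots> \<in> ?G"
    proof (intro Gsum)
      fix i j assume ij: "i \<in> idx" "j \<in> idx"
      obtain c where c: "star (S i) * star v * S j = c *\<^sub>C 1"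
        using hom_1_1D[OF hom_star[OF vh] ij] by (rule scalarsE)
      have "?T i * (star (S i) * star v * S j) * star (?T j) = c *\<^sub>C (?T i * star (?T j))"
        unfolding c by (simp add: mult_scaleC_left mult_scaleC_right)
      then show "?T i * (star (S i) * star v * S j) * star (?T j) \<in> ?G"
        using T[OF ij(1)] T[OF ij(2)] by (simp add: Gc)
    qed
    finally have vG: "star v \<in> ?G" .
    have "S i \<in> ?G" if "i \<in> idx" for i
    proof -
      have "star v * ?T i = S i" by (simp add: vu flip: mult.assoc)
      then show ?thesis using Gc(4)[OF vG T[OF that]] by simp
    qed
    then show ?thesis unfolding B_eq by (intro cstar_generated_least G) auto
  qed
  ultimately have "B = ?G" by simp
  then have "is_cuntz_algebra n ?T B"
    using iso sum simple by (simp add: is_cuntz_algebra_def idx_def)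
  then show ?thesis by unfold_locales (rule n_ge_2)
qed

lemma shift_unitary_hom:
  assumes v: "v \<in> unitaries (hom 1 1)"
  shows "(\<Sum>i\<in>idx. v * S i * y * star (v * S i)) = shift y"
proof -
  have vh: "v \<in> hom 1 1" and vu: "v * star v = 1" using v by (simp_all add: unitaries_def)
  have "(\<Sum>i\<in>idx. v * S i * y * star (v * S i)) = v * shift y * star v"
    by (simp add: shift_def sum_distrib_left sum_distrib_right star_mult mult.assoc)
  also have "v * shift y = shift y * v" using hom_intertwines[OF vh, of y] by simp
  finally show ?thesis by (simp add: mult.assoc vu)
qed

lemma sh_projection_twisted_diagonal:
  assumes v: "v \<in> unitaries (hom 1 1)" and i: "i \<in> idx"
  shows "sh k (v * S i * star (v * S i)) \<in> cuntz_diagonal n (\<lambda>i. v * S i)"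
proof -
  interpret T: cuntz_family n "\<lambda>i. v * S i" B by (rule unitary_hom_family[OF v])
  have "T.shift y = shift y" for y
    unfolding T.shift_def by (rule shift_unitary_hom[OF v])
  then have "T.shift = shift" by (rule ext)
  then show ?thesis using T.sh_S_projection_diagonal[OF i, of k] by simp
qed

definition core :: "'a set" where "core = closure (\<Union>k. hom k k)"

lemma subalgebra_core: "cstar_subalgebra core"
  unfolding core_def
proof (rule cstar_subalgebra_closure)
  fix x y assume "x \<in> (\<Union>k. hom k k)" "y \<in> (\<Union>k. hom k k)"
  then obtain k l where "x \<in> hom k k" "y \<in> hom l l" by blast
  then have "x \<in> hom (k + l) (k + l)" "y \<in> hom (k + l) (k + l)"
    using hom_raise[of x k k l] hom_raise[of y l l k] by (simp_all add: add.commute)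
  then have "x + y \<in> hom (k + l) (k + l)" "x * y \<in> hom (k + l) (k + l)"
    by (rule hom_add, rule hom_mult)
  then show "x + y \<in> (\<Union>k. hom k k)" "x * y \<in> (\<Union>k. hom k k)" by blast+
qed (auto intro: hom_zero hom_scaleC hom_star)

lemma twisted_diagonal_core:
  assumes v: "v \<in> hom 1 1"
  shows "cuntz_diagonal n (\<lambda>i. v * S i) \<subseteq> core"
proof -
  have w: "word_isometry (\<lambda>i. v * S i) \<mu> \<in> hom (length \<mu>) 0" if "\<mu> \<in> lists idx" for \<mu>
    using that
  proof (induction \<mu>)
    case Nil show ?case using one_hom[of 0] by simp
  next
    case (Cons i \<mu>)
    have "v * S i \<in> hom 1 0" using Cons by (intro hom_mult[OF v S_hom])
    then have "v * S i \<in> hom (1 + length \<mu>) (0 + length \<mu>)" by (rule hom_raise)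
    then show ?case using hom_mult[OF _ Cons.IH] by simp
  qed
  have "word_projection (\<lambda>i. v * S i) \<mu> \<in> core" if "\<mu> \<in> lists idx" for \<mu>
    using hom_mult[OF w[OF that] hom_star[OF w[OF that]]] closure_subset[of "\<Union>k. hom k k"]
    unfolding word_projection_def core_def by blast
  then show ?thesis
    unfolding cuntz_diagonal_def idx_def[symmetric]
    by (intro cstar_generated_least subalgebra_core image_subsetI)
qed

text \<open>The two truncated offsets \<open>a - s\<close> and \<open>b - t\<close> allow compressions of every integer degree
  while keeping the family stable under multiplication by the generators and their adjoints.\<close>

definition offset_probe :: "nat \<Rightarrow> nat \<Rightarrow> nat \<Rightarrow> 'a" where
  "offset_probe a s k = sh (k + a - s) (probe k)"

lemma norm_offset_probe: "norm (offset_probe a s k) \<le> 1"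
  by (simp add: offset_probe_def norm_sh_probe)

lemma core_commutes_asymptotically:
  assumes "d \<in> core"
  shows "(\<lambda>k. offset_probe a s k * d - d * offset_probe a s k) \<longlonglongrightarrow> 0"
proof -
  let ?X = "{d \<in> UNIV. (\<lambda>k. offset_probe a s k * d - d * offset_probe a s k) \<longlonglongrightarrow> 0}"
  have "closed ?X"
  proof (rule closed_null[where K = 2])
    fix k and x y :: 'a
    let ?p = "offset_probe a s k"
    have "norm (?p * x - x * ?p - (?p * y - y * ?p)) = norm (?p * (x - y) - (x - y) * ?p)"
      by (simp add: algebra_simps)
    also have "\<dots> \<le> norm (?p * (x - y)) + norm ((x - y) * ?p)" by (rule norm_triangle_ineq4)
    also have "\<dots> \<le> 1 * norm (x - y) + norm (x - y) * 1"
      using norm_offset_probe[of a s k]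
      by (intro add_mono order_trans[OF norm_mult_ineq] mult_mono) simp_all
    finally show "norm (?p * x - x * ?p - (?p * y - y * ?p)) \<le> 2 * norm (x - y)" by simp
  qed simp
  moreover have "h \<in> ?X" if h: "h \<in> hom c c" for h c
  proof -
    have "offset_probe a s k * h - h * offset_probe a s k = 0" if "k \<ge> c + s" for k
      using hom_intertwines_shifted[OF h, of "k + a - s - c" "probe k"] that
      by (simp add: offset_probe_def)
    then have "\<forall>\<^sub>F k in sequentially. offset_probe a s k * h - h * offset_probe a s k = 0"
      by (auto simp: eventually_sequentially)
    then show ?thesis by (simp add: tendsto_eventually)
  qed
  then have "(\<Union>c. hom c c) \<subseteq> ?X" by blast
  ultimately have "core \<subseteq> ?X" unfolding core_def by (intro closure_minimal)
  then show ?thesis using assms by blast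
qed

lemma star_core: "d \<in> core \<Longrightarrow> star d \<in> core"
  using subalgebra_core by (simp add: cstar_subalgebra_def)

lemma core_commutes_asymptotically_star:
  assumes "d \<in> core"
  shows "(\<lambda>k. star (offset_probe a s k) * d - d * star (offset_probe a s k)) \<longlonglongrightarrow> 0"
  using tendsto_minus[OF tendsto_star[OF core_commutes_asymptotically[OF star_core[OF assms], of a s]]]
  by (simp add: star_simps)

definition bounded_orbit :: "'a \<Rightarrow> bool" where
  "bounded_orbit z \<longleftrightarrow> (\<exists>K. \<forall>j. norm (sh j z) \<le> K)"

lemma bounded_orbit_isometry: "star v * v = 1 \<Longrightarrow> bounded_orbit v"
  unfolding bounded_orbit_def
  by (intro exI[of _ 1] allI eq_refl norm_isometry) (simp add: sh_hom flip: sh_hom(3))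

lemma bounded_orbit_star: "bounded_orbit z \<Longrightarrow> bounded_orbit (star z)"
  unfolding bounded_orbit_def by (simp flip: sh_hom(7))

lemma bounded_orbit_mult: "bounded_orbit x \<Longrightarrow> bounded_orbit y \<Longrightarrow> bounded_orbit (x * y)"
  unfolding bounded_orbit_def
proof (elim exE)
  fix K L assume K: "\<forall>j. norm (sh j x) \<le> K" and L: "\<forall>j. norm (sh j y) \<le> L"
  have "norm (sh j (x * y)) \<le> K * L" for j
  proof -
    have "norm (sh j (x * y)) \<le> norm (sh j x) * norm (sh j y)"
      unfolding sh_hom by (rule norm_mult_ineq)
    also have "\<dots> \<le> K * L"
      using K L order_trans[OF norm_ge_zero K[rule_format]] by (intro mult_mono) auto
    finally show ?thesis .
  qed
  then show "\<exists>K. \<forall>j. norm (sh j (x * y)) \<le> K" by blast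
qed

lemma bounded_orbit_diff: "bounded_orbit x \<Longrightarrow> bounded_orbit y \<Longrightarrow> bounded_orbit (x - y)"
  unfolding bounded_orbit_def
proof (elim exE)
  fix K L assume K: "\<forall>j. norm (sh j x) \<le> K" and L: "\<forall>j. norm (sh j y) \<le> L"
  have "norm (sh j (x - y)) \<le> K + L" for j
    unfolding sh_hom using K L by (intro order_trans[OF norm_triangle_ineq4] add_mono) auto
  then show "\<exists>K. \<forall>j. norm (sh j (x - y)) \<le> K" by blast
qed

text \<open>The closure of the homogeneous elements of degree \<open>\<alpha> - \<beta>\<close> satisfies the intertwining
  relation in the limit.\<close>

definition asymptotic_intertwiners :: "nat \<Rightarrow> nat \<Rightarrow> 'a set" where
  "asymptotic_intertwiners \<alpha> \<beta> = {W. \<forall>z. bounded_orbit z \<longrightarrow>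
    (\<lambda>j. W * sh (\<beta> + j) z - sh (\<alpha> + j) z * W) \<longlonglongrightarrow> 0}"

lemma closed_asymptotic_intertwiners: "closed (asymptotic_intertwiners \<alpha> \<beta>)"
proof -
  have "closed {W \<in> UNIV. (\<lambda>j. W * sh (\<beta> + j) z - sh (\<alpha> + j) z * W) \<longlonglongrightarrow> 0}" if z: "bounded_orbit z" for z
  proof -
    obtain K where K: "\<And>j. norm (sh j z) \<le> K" using z unfolding bounded_orbit_def by blast
    have K0: "K \<ge> 0" using order_trans[OF norm_ge_zero K] .
    show ?thesis
    proof (rule closed_null[where K = "2 * K"])
      fix j and x y :: 'a
      let ?p = "sh (\<beta> + j) z" and ?q = "sh (\<alpha> + j) z"
      have "norm (x * ?p - ?q * x - (y * ?p - ?q * y)) = norm ((x - y) * ?p - ?q * (x - y))"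
        by (simp add: algebra_simps)
      also have "\<dots> \<le> norm ((x - y) * ?p) + norm (?q * (x - y))" by (rule norm_triangle_ineq4)
      also have "\<dots> \<le> norm (x - y) * K + K * norm (x - y)"
        using K K0 by (intro add_mono order_trans[OF norm_mult_ineq] mult_mono) simp_all
      finally show "norm (x * ?p - ?q * x - (y * ?p - ?q * y)) \<le> 2 * K * norm (x - y)"
        by (simp add: mult.commute[of "norm (x - y)" K])
    qed simp
  qed
  then have "closed (\<Inter>z\<in>{z. bounded_orbit z}.
      {W \<in> UNIV. (\<lambda>j. W * sh (\<beta> + j) z - sh (\<alpha> + j) z * W) \<longlonglongrightarrow> 0})"
    by (intro closed_INT) blast
  moreover have "(\<Inter>z\<in>{z. bounded_orbit z}.
      {W \<in> UNIV. (\<lambda>j. W * sh (\<beta> + j) z - sh (\<alpha> + j) z * W) \<longlonglongrightarrow> 0}) = asymptotic_intertwiners \<alpha> \<beta>"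
    by (auto simp: asymptotic_intertwiners_def)
  ultimately show ?thesis by simp
qed

lemma offset_probe_limit:
  assumes w: "w \<in> B"
  shows "\<exists>W\<in>asymptotic_intertwiners (a + t) (b + s).
    (\<lambda>k. star (offset_probe a s k) * w * offset_probe b t k) \<longlonglongrightarrow> W"
proof (rule compress_limit_in[OF norm_offset_probe norm_offset_probe closed_asymptotic_intertwiners _ _ w])
  fix x y assume xy: "x \<in> asymptotic_intertwiners (a + t) (b + s)" "y \<in> asymptotic_intertwiners (a + t) (b + s)"
  show "x + y \<in> asymptotic_intertwiners (a + t) (b + s)"
    unfolding asymptotic_intertwiners_def
  proof (intro CollectI allI impI)
    fix z assume "bounded_orbit z"
    with xy have "(\<lambda>j. x * sh (b + s + j) z - sh (a + t + j) z * x) \<longlonglongrightarrow> 0"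
      "(\<lambda>j. y * sh (b + s + j) z - sh (a + t + j) z * y) \<longlonglongrightarrow> 0"
      by (simp_all add: asymptotic_intertwiners_def)
    from tendsto_add[OF this]
    show "(\<lambda>j. (x + y) * sh (b + s + j) z - sh (a + t + j) z * (x + y)) \<longlonglongrightarrow> 0"
      by (simp add: algebra_simps)
  qed
next
  fix c d h assume h: "h \<in> hom c d"
  define l where "l = (if a + t + d = c + b + s then h else 0)"
  have "l \<in> asymptotic_intertwiners (a + t) (b + s)"
  proof (cases "a + t + d = c + b + s")
    case True
    have "h * sh (b + s + j) z - sh (a + t + j) z * h = 0" if "j \<ge> d" for j z
    proof -
      have "b + s + j = d + (b + s + j - d)" "a + t + j = c + (b + s + j - d)" using True that by simp_all
      then show ?thesis using hom_intertwines_shifted[OF h, of "b + s + j - d" z] by simp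
    qed
    then have "\<forall>\<^sub>F j in sequentially. h * sh (b + s + j) z - sh (a + t + j) z * h = 0" for z
      by (auto simp: eventually_sequentially)
    then show ?thesis using True by (simp add: l_def asymptotic_intertwiners_def tendsto_eventually)
  qed (simp add: l_def asymptotic_intertwiners_def)
  moreover have "(\<lambda>k. star (offset_probe a s k) * h * offset_probe b t k) \<longlonglongrightarrow> l"
  proof (rule tendsto_eventually)
    have "star (offset_probe a s k) * h * offset_probe b t k = l"
      if k: "k \<ge> a + b + c + d + s + t" for k
    proof -
      have "star (offset_probe a s k) * h * offset_probe b t k
          = (if k + a - s + d = c + (k + b - t) then h else 0)"
        unfolding offset_probe_def using k by (intro probe_extract[OF h]) linarith+
      moreover have "k + a - s + d = c + (k + b - t) \<longleftrightarrow> a + t + d = c + b + s" using k by linarith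
      ultimately show ?thesis by (simp add: l_def)
    qed
    then show "\<forall>\<^sub>F k in sequentially. star (offset_probe a s k) * h * offset_probe b t k = l"
      unfolding eventually_sequentially by blast
  qed
  ultimately show "\<exists>l\<in>asymptotic_intertwiners (a + t) (b + s).
      (\<lambda>k. star (offset_probe a s k) * h * offset_probe b t k) \<longlonglongrightarrow> l" by blast
qed

lemma some_component_nonzero:
  assumes w: "w \<in> B" "w \<noteq> 0"
  shows "\<exists>a s b t. \<not> (\<lambda>k. star (offset_probe a s k) * w * offset_probe b t k) \<longlonglongrightarrow> 0"
proof (rule ccontr)
  assume "\<nexists>a s b t. \<not> (\<lambda>k. star (offset_probe a s k) * w * offset_probe b t k) \<longlonglongrightarrow> 0"
  then have null: "(\<lambda>k. star (offset_probe a s k) * w * offset_probe b t k) \<longlonglongrightarrow> 0" for a s b t by blast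
  define T where "T = {(offset_probe a s, offset_probe b t) | a s b t. True}"
  have TI: "(offset_probe a s, offset_probe b t) \<in> T" for a s b t unfolding T_def by blast
  have "w = 0"
  proof (rule null_ideal_trivial[where T = T])
    show "w \<in> {y \<in> B. \<forall>(P, Q)\<in>T. (\<lambda>k. star (P k) * y * Q k) \<longlonglongrightarrow> 0}"
      using w(1) null unfolding T_def by auto
  next
    fix P Q k assume "(P, Q) \<in> T"
    then show "norm (P k) \<le> 1 \<and> norm (Q k) \<le> 1" unfolding T_def using norm_offset_probe by auto
  next
    fix P Q assume "(P, Q) \<in> T"
    then show "(Q, P) \<in> T" unfolding T_def by blast
  next
    show "(offset_probe 0 0, offset_probe 0 0) \<in> T" by (rule TI)
    show "\<not> (\<lambda>k. star (offset_probe 0 0 k) * offset_probe 0 0 k) \<longlonglongrightarrow> 0"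
      by (simp add: offset_probe_def sh_probe LIMSEQ_const_iff)
  next
    fix y i P Q assume y: "y \<in> {y \<in> B. \<forall>(P, Q)\<in>T. (\<lambda>k. star (P k) * y * Q k) \<longlonglongrightarrow> 0}"
      and i: "i \<in> idx" and "(P, Q) \<in> T"
    then obtain a s b t where PQ: "P = offset_probe a s" "Q = offset_probe b t" unfolding T_def by blast
    have y0: "(\<lambda>k. star (offset_probe a s k) * y * offset_probe b t k) \<longlonglongrightarrow> 0" for a s b t
      using y TI[of a s b t] by auto
    have e1: "star (P k) * (S i * y) * Q k = S i * (star (offset_probe a (Suc s) k) * y * Q k)"
      if "k \<ge> Suc s" for k
    proof -
      have e: "k + a - s = Suc (k + a - Suc s)" using that by simp
      have "star (P k) * S i = S i * star (offset_probe a (Suc s) k)"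
        unfolding PQ offset_probe_def sh_hom e by (simp add: shift_S[OF i])
      then show ?thesis by (simp add: mult.assoc flip: mult.assoc[of _ "S i"])
    qed
    have "\<forall>\<^sub>F k in sequentially. S i * (star (offset_probe a (Suc s) k) * y * Q k) = star (P k) * (S i * y) * Q k"
      by (rule eventually_sequentiallyI[of "Suc s"]) (rule e1[symmetric])
    from Lim_transform_eventually[OF tendsto_mult[OF tendsto_const y0, of "S i" a "Suc s" b t, folded PQ(2)] this]
    show "(\<lambda>k. star (P k) * (S i * y) * Q k) \<longlonglongrightarrow> 0" by simp
    have e2: "star (P k) * (star (S i) * y) * Q k = star (S i) * (star (offset_probe (Suc a) s k) * y * Q k)"
      if "k \<ge> s" for k
    proof -
      have e: "k + Suc a - s = Suc (k + a - s)" using that by simp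
      have "star (S i) * star (offset_probe (Suc a) s k) = star (P k) * star (S i)"
        unfolding PQ offset_probe_def sh_hom e by (simp add: S_star_shift[OF i])
      then show ?thesis by (simp only: mult.assoc[symmetric])
    qed
    have "\<forall>\<^sub>F k in sequentially.
        star (S i) * (star (offset_probe (Suc a) s k) * y * Q k) = star (P k) * (star (S i) * y) * Q k"
      by (rule eventually_sequentiallyI[of s]) (rule e2[symmetric])
    from Lim_transform_eventually[OF tendsto_mult[OF tendsto_const y0, of "star (S i)" "Suc a" s b t, folded PQ(2)] this]
    show "(\<lambda>k. star (P k) * (star (S i) * y) * Q k) \<longlonglongrightarrow> 0" by simp
  qed
  then show False using w(2) by simp
qed

text \<open>If \<open>w\<close> conjugates one diagonal into the other, a nonzero homogeneous component \<open>W\<close> of \<open>w\<close>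
  intertwines \<open>\<phi>\<^sup>j(x)\<close> with elements \<open>d\<close> of the second diagonal, and it also asymptotically
  intertwines \<open>\<phi>\<^sup>j(y)\<close> with itself. As \<open>d\<close> commutes with \<open>\<phi>\<^sup>j(y)\<close>, the commutator
  \<open>W \<phi>\<^sup>j([x, y])\<close> tends to \<open>0\<close>, which forces \<open>[x, y] = 0\<close>.\<close>

lemma conjugate_diagonals_commute:
  assumes u: "u \<in> unitaries (hom 1 1)" and v: "v \<in> unitaries (hom 1 1)" and w: "w \<in> unitaries B"
    and conj: "conj_by w ` cuntz_diagonal n (\<lambda>i. u * S i) \<subseteq> cuntz_diagonal n (\<lambda>i. v * S i)"
    and i: "i \<in> idx" and j: "j \<in> idx"
  shows "u * S i * star (u * S i) * (v * S j * star (v * S j))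
    = v * S j * star (v * S j) * (u * S i * star (u * S i))"
proof -
  let ?Du = "cuntz_diagonal n (\<lambda>i. u * S i)" and ?Dv = "cuntz_diagonal n (\<lambda>i. v * S i)"
  define x y z where "x = u * S i * star (u * S i)" and "y = v * S j * star (v * S j)"
    and "z = x * y - y * x"
  have uh: "u \<in> hom 1 1" "star u * u = 1" and vh: "v \<in> hom 1 1" "star v * v = 1"
    using u v by (simp_all add: unitaries_def)
  have wB: "w \<in> B" and wu: "star w * w = 1" "w * star w = 1" using w by (simp_all add: unitaries_def)
  have w1: "norm w = 1" by (rule norm_unitary[OF w])
  interpret V: cuntz_family n "\<lambda>i. v * S i" B by (rule unitary_hom_family[OF v])
  have iso: "star (u * S i) * (u * S i) = 1" "star (v * S j) * (v * S j) = 1"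
  proof -
    have "star (u * S i) * (u * S i) = star (S i) * (star u * u) * S i"
      "star (v * S j) * (v * S j) = star (S j) * (star v * v) * S j"
      by (simp_all only: star_mult mult.assoc)
    then show "star (u * S i) * (u * S i) = 1" "star (v * S j) * (v * S j) = 1"
      using i j uh vh by simp_all
  qed
  have bx: "bounded_orbit x" "bounded_orbit y"
    unfolding x_def y_def using iso
    by (intro bounded_orbit_mult bounded_orbit_star bounded_orbit_isometry; simp)+
  have bz: "bounded_orbit z" unfolding z_def by (intro bounded_orbit_diff bounded_orbit_mult bx)
  have Th: "u * S i \<in> hom 1 0" "v * S j \<in> hom 1 0"
    using hom_mult[OF uh(1) S_hom[OF i]] hom_mult[OF vh(1) S_hom[OF j]] .
  have xh: "x \<in> hom 1 1" "y \<in> hom 1 1"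
    unfolding x_def y_def using hom_mult[OF Th(1) hom_star[OF Th(1)]] hom_mult[OF Th(2) hom_star[OF Th(2)]] .
  then have "x * y + (-1) *\<^sub>C (y * x) \<in> hom 1 1" by (intro hom_add hom_scaleC hom_mult)
  then have zh: "z \<in> hom 1 1" by (simp add: z_def scaleC_minus1)
  obtain a s b t where nz: "\<not> (\<lambda>k. star (offset_probe a s k) * w * offset_probe b t k) \<longlonglongrightarrow> 0"
    using some_component_nonzero[OF wB] w1 by force
  define \<alpha> \<beta> where "\<alpha> = a + t" and "\<beta> = b + s"
  obtain W where W: "W \<in> asymptotic_intertwiners \<alpha> \<beta>"
    and lim: "(\<lambda>k. star (offset_probe a s k) * w * offset_probe b t k) \<longlonglongrightarrow> W"
    using offset_probe_limit[OF wB, of a t b s] by (auto simp: \<alpha>_def \<beta>_def)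
  have "W \<noteq> 0" using nz lim by auto
  define R where "R g m = W * sh (\<beta> + m) g - sh (\<alpha> + m) g * W" for g m
  have R: "R g \<longlonglongrightarrow> 0" if "bounded_orbit g" for g
    using W that unfolding R_def asymptotic_intertwiners_def by simp
  define d where "d m = w * sh (\<beta> + m) x * star w" for m
  have xD: "sh m x \<in> ?Du" for m unfolding x_def by (rule sh_projection_twisted_diagonal[OF u i])
  have yD: "sh m y \<in> ?Dv" for m unfolding y_def by (rule sh_projection_twisted_diagonal[OF v j])
  have dD: "d m \<in> ?Dv" for m using conj xD unfolding d_def conj_by_def by blast
  have core: "sh m x \<in> core" "d m \<in> core" for m
    using xD dD twisted_diagonal_core[OF uh(1)] twisted_diagonal_core[OF vh(1)] by blast+
  have dw: "d m * w = w * sh (\<beta> + m) x" for m by (simp add: d_def mult.assoc wu)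
  have dW: "d m * W = W * sh (\<beta> + m) x" for m
  proof -
    let ?P = "offset_probe a s" and ?Q = "offset_probe b t" and ?e = "sh (\<beta> + m) x"
    have "(\<lambda>k. (star (?P k) * d m - d m * star (?P k)) * (w * ?Q k)) \<longlonglongrightarrow> 0"
    proof (rule Lim_null_comparison[OF always_eventually[OF allI]])
      show "norm ((star (?P k) * d m - d m * star (?P k)) * (w * ?Q k))
          \<le> norm (star (?P k) * d m - d m * star (?P k))" for k
        using mult_left_mono[OF norm_mult_le_1[of w "?Q k"], of "norm (star (?P k) * d m - d m * star (?P k))"]
          norm_mult_ineq[of "star (?P k) * d m - d m * star (?P k)" "w * ?Q k"] w1 norm_offset_probe[of b t k]
        by simp
      show "(\<lambda>k. norm (star (?P k) * d m - d m * star (?P k))) \<longlonglongrightarrow> 0"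
        by (rule tendsto_norm_zero[OF core_commutes_asymptotically_star[OF core(2)]])
    qed
    from tendsto_add[OF this tendsto_mult[OF tendsto_const[of "d m"] lim]]
    have 1: "(\<lambda>k. star (?P k) * (d m * w) * ?Q k) \<longlonglongrightarrow> d m * W"
      by (simp add: algebra_simps)
    have "(\<lambda>k. star (?P k) * w * (?Q k * ?e - ?e * ?Q k)) \<longlonglongrightarrow> 0"
    proof (rule Lim_null_comparison[OF always_eventually[OF allI]])
      show "norm (star (?P k) * w * (?Q k * ?e - ?e * ?Q k)) \<le> norm (?Q k * ?e - ?e * ?Q k)" for k
        using mult_right_mono[OF norm_mult_le_1[of "star (?P k)" w], of "norm (?Q k * ?e - ?e * ?Q k)"]
          norm_mult_ineq[of "star (?P k) * w" "?Q k * ?e - ?e * ?Q k"] w1 norm_offset_probe[of a s k]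
        by simp
      show "(\<lambda>k. norm (?Q k * ?e - ?e * ?Q k)) \<longlonglongrightarrow> 0"
        by (rule tendsto_norm_zero[OF core_commutes_asymptotically[OF core(1)]])
    qed
    from tendsto_diff[OF tendsto_mult[OF lim tendsto_const[of ?e]] this]
    have 2: "(\<lambda>k. star (?P k) * (w * ?e) * ?Q k) \<longlonglongrightarrow> W * ?e"
      by (simp add: algebra_simps)
    show ?thesis using LIMSEQ_unique[OF 1 2[folded dw]] .
  qed
  obtain K where K: "\<And>m. norm (sh m x) \<le> K" using bx(1) unfolding bounded_orbit_def by blast
  have dK: "norm (d m) \<le> K" for m
    unfolding d_def using norm_unitary_conj[of w w "sh (\<beta> + m) x"] wu K by simp
  have bounded_mult: "(\<lambda>m. f m * g m) \<longlonglongrightarrow> 0" "(\<lambda>m. g m * f m) \<longlonglongrightarrow> 0"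
    if "f \<longlonglongrightarrow> 0" "\<And>m. norm (g m) \<le> L" for f g :: "nat \<Rightarrow> 'a" and L
  proof -
    have g: "Bfun g sequentially" using that(2) by (intro BfunI always_eventually) blast
    show "(\<lambda>m. f m * g m) \<longlonglongrightarrow> 0" "(\<lambda>m. g m * f m) \<longlonglongrightarrow> 0"
      using bounded_bilinear.Zfun_prod_Bfun[OF bounded_bilinear_mult _ g, of f]
        bounded_bilinear.Bfun_prod_Zfun[OF bounded_bilinear_mult g, of f] that(1)
      by (simp_all add: tendsto_Zfun_iff)
  qed
  have eq: "W * sh (\<beta> + m) z = d m * R y m - R y m * sh (\<beta> + m) x" for m
  proof -
    have comm: "d m * sh (\<alpha> + m) y = sh (\<alpha> + m) y * d m" by (rule V.diagonal_abelian[OF dD yD])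
    have "d m * R y m = W * sh (\<beta> + m) x * sh (\<beta> + m) y - sh (\<alpha> + m) y * (d m * W)"
      unfolding R_def right_diff_distrib mult.assoc[symmetric] comm[symmetric] dW[symmetric] ..
    also have "sh (\<alpha> + m) y * (d m * W) = sh (\<alpha> + m) y * W * sh (\<beta> + m) x"
      by (simp add: dW mult.assoc)
    finally have "d m * R y m - R y m * sh (\<beta> + m) x
        = W * sh (\<beta> + m) x * sh (\<beta> + m) y - W * sh (\<beta> + m) y * sh (\<beta> + m) x"
      by (simp add: R_def left_diff_distrib)
    also have "\<dots> = W * sh (\<beta> + m) z"
      by (simp add: z_def sh_hom right_diff_distrib mult.assoc)
    finally show ?thesis ..
  qed
  have A: "(\<lambda>m. W * sh (\<beta> + m) z) \<longlonglongrightarrow> 0"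
    unfolding eq using tendsto_diff[OF bounded_mult(2)[OF R[OF bx(2)] dK] bounded_mult(1)[OF R[OF bx(2)] K]]
    by simp
  have coeff: "star (S p) * z * S q = 0" if pq: "p \<in> idx" "q \<in> idx" for p q
  proof -
    obtain c where c: "star (S p) * z * S q = c *\<^sub>C 1" using hom_1_1D[OF zh pq] by (rule scalarsE)
    have bS: "bounded_orbit (star (S p))" "bounded_orbit (z * S q)"
      using bounded_orbit_star[OF bounded_orbit_isometry[OF isometry[OF pq(1)]]]
        bounded_orbit_mult[OF bz bounded_orbit_isometry[OF isometry[OF pq(2)]]] .
    obtain L where L: "\<And>m. norm (sh m (z * S q)) \<le> L" using bS(2) unfolding bounded_orbit_def by blast
    have n1: "norm (sh m (star (S p))) \<le> 1" "norm (sh m (S q)) \<le> 1" for m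
      using norm_isometry[of "sh m (S p)"] norm_isometry[of "sh m (S q)"] pq
      by (simp_all add: sh_hom norm_star[of "sh m (S p)", unfolded sh_hom] flip: sh_hom(3))
    have "(\<lambda>m. sh (\<alpha> + m) (star (S p)) * (W * sh (\<beta> + m) z) * sh (\<beta> + m) (S q)) \<longlonglongrightarrow> 0"
      by (intro bounded_mult(1)[OF bounded_mult(2)[OF A n1(1)] n1(2)])
    moreover have "sh (\<alpha> + m) (star (S p)) * (W * sh (\<beta> + m) z) * sh (\<beta> + m) (S q)
        = c *\<^sub>C W - R (star (S p)) m * sh (\<beta> + m) (z * S q)" for m
    proof -
      have "R (star (S p)) m * sh (\<beta> + m) (z * S q)
          = W * sh (\<beta> + m) (star (S p) * z * S q)
            - sh (\<alpha> + m) (star (S p)) * (W * sh (\<beta> + m) z) * sh (\<beta> + m) (S q)"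
        by (simp add: R_def left_diff_distrib sh_hom mult.assoc)
      also have "W * sh (\<beta> + m) (star (S p) * z * S q) = c *\<^sub>C W"
        unfolding c by (simp add: sh_hom mult_scaleC_right)
      finally show ?thesis by simp
    qed
    ultimately have "(\<lambda>m. c *\<^sub>C W - R (star (S p)) m * sh (\<beta> + m) (z * S q)) \<longlonglongrightarrow> 0" by simp
    from tendsto_add[OF this bounded_mult(1)[OF R[OF bS(1)], of "\<lambda>m. sh (\<beta> + m) (z * S q)", OF L]]
    have "(\<lambda>m. c *\<^sub>C W) \<longlonglongrightarrow> 0" by simp
    then have "c *\<^sub>C W = 0" by (simp add: LIMSEQ_const_iff)
    then have "c = 0" using \<open>W \<noteq> 0\<close> by simp
    then show ?thesis by (simp add: c)
  qed
  have "z = (\<Sum>p\<in>idx. \<Sum>q\<in>idx. S p * (star (S p) * z * S q) * star (S q))"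
    by (rule hom_1_1_expansion)
  also have "\<dots> = 0" by (simp add: coeff)
  finally show ?thesis by (simp add: z_def x_def y_def)
qed

end

section \<open>Cosets of the normalizer\<close>

lemma conj_by_mult: "conj_by (s * t) x = conj_by s (conj_by t (x::'a::cstar_algebra))"
  by (simp add: conj_by_def star_mult mult.assoc)

lemma conj_by_star_cancel:
  assumes "t \<in> unitaries A"
  shows "conj_by t (conj_by (star t) x) = (x::'a::cstar_algebra)" "conj_by (star t) (conj_by t x) = x"
proof -
  have t: "star t * t = 1" "t * star t = 1" using assms by (simp_all add: unitaries_def)
  have "conj_by t (conj_by (star t) x) = (t * star t) * x * (t * star t)"
    "conj_by (star t) (conj_by t x) = (star t * t) * x * (star t * t)"
    by (simp_all add: conj_by_def star_star mult.assoc)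
  then show "conj_by t (conj_by (star t) x) = x" "conj_by (star t) (conj_by t x) = x"
    by (simp_all add: t)
qed

lemma conj_by_hom:
  assumes "star t * t = 1"
  shows "conj_by t x * conj_by t y = conj_by t (x * (y::'a::cstar_algebra))"
proof -
  have "conj_by t x * conj_by t y = t * x * (star t * t) * y * star t"
    by (simp add: conj_by_def mult.assoc)
  then show ?thesis by (simp add: assms conj_by_def mult.assoc)
qed

context cuntz_family
begin

definition normalizer :: "'a set" where
  "normalizer = unitary_normalizer (hom 1 1) (cuntz_D1 n S)"

lemma unitaries_mult:
  assumes "s \<in> unitaries (hom 1 1)" "t \<in> unitaries (hom 1 1)"
  shows "s * t \<in> unitaries (hom 1 1)"
proof -
  have s: "s \<in> hom 1 1" "star s * s = 1" "s * star s = 1" and t: "t \<in> hom 1 1" "star t * t = 1" "t * star t = 1"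
    using assms by (simp_all add: unitaries_def)
  have "star (s * t) * (s * t) = star t * (star s * s) * t" "s * t * star (s * t) = s * (t * star t) * star s"
    by (simp_all only: star_mult mult.assoc)
  then show ?thesis using hom_mult[OF s(1) t(1)] by (simp add: unitaries_def s t)
qed

lemma unitaries_star: "t \<in> unitaries (hom 1 1) \<Longrightarrow> star t \<in> unitaries (hom 1 1)"
  using hom_star[of t 1 1] by (simp add: unitaries_def star_star)

lemma D1_eq:
  "cuntz_D1 n S = {z \<in> hom 1 1. \<forall>j\<in>idx. z * (S j * star (S j)) = S j * star (S j) * z}"
    (is "_ = ?R")
proof
  have P: "S j * star (S j) \<in> diagonal" if "j \<in> idx" for j
    using word_projection_diagonal[of "[j]"] that by simp
  show "cuntz_D1 n S \<subseteq> ?R"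
    using diagonal_abelian P by (auto simp: cuntz_D1_def F1_eq)
  show "?R \<subseteq> cuntz_D1 n S"
  proof
    fix z assume z: "z \<in> ?R"
    have "z = (\<Sum>j\<in>idx. S j * star (S j)) * z" by (simp add: sum_ranges)
    also have "\<dots> = (\<Sum>j\<in>idx. S j * (star (S j) * z * S j) * star (S j))"
    proof -
      have "S j * (star (S j) * z * S j) * star (S j) = S j * star (S j) * z" if j: "j \<in> idx" for j
      proof -
        have "S j * (star (S j) * z * S j) * star (S j) = S j * star (S j) * (z * (S j * star (S j)))"
          by (simp only: mult.assoc)
        also have "\<dots> = S j * star (S j) * (S j * star (S j) * z)" using z j by simp
        finally show ?thesis using j by (simp add: mult.assoc)
      qed
      then show ?thesis by (simp add: sum_distrib_right)
    qed
    also have "\<dots> \<in> diagonal"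
    proof (rule diagonal_sum)
      fix j assume j: "j \<in> idx"
      obtain c where c: "star (S j) * z * S j = c *\<^sub>C 1"
        using hom_1_1D[of z j j] z j by (auto elim: scalarsE)
      show "S j * (star (S j) * z * S j) * star (S j) \<in> diagonal"
        unfolding c using diagonal_closed_under(3)[OF P[OF j], of c]
        by (simp add: mult_scaleC_left mult_scaleC_right)
    qed
    finally show "z \<in> cuntz_D1 n S" using z by (simp add: cuntz_D1_def F1_eq)
  qed
qed

lemma D1_expansion:
  assumes z: "z \<in> cuntz_D1 n S"
  obtains c where "z = (\<Sum>i\<in>idx. c i *\<^sub>C (S i * star (S i)))"
proof -
  have "\<exists>c. S i * star (S i) * z = c *\<^sub>C (S i * star (S i))" if i: "i \<in> idx" for i
  proof -
    obtain c where c: "star (S i) * z * S i = c *\<^sub>C 1"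
      using hom_1_1D[of z i i] z i by (auto simp: D1_eq elim: scalarsE)
    have zc: "S i * star (S i) * z = z * (S i * star (S i))" using z i by (simp add: D1_eq)
    have "S i * star (S i) * z = S i * star (S i) * (S i * star (S i) * z)"
      using i by (simp add: mult.assoc)
    also have "\<dots> = S i * star (S i) * (z * (S i * star (S i)))" by (simp only: zc)
    also have "\<dots> = S i * (star (S i) * z * S i) * star (S i)"
      by (simp only: mult.assoc)
    finally show ?thesis unfolding c by (auto simp: mult_scaleC_left mult_scaleC_right)
  qed
  then obtain c where c: "\<And>i. i \<in> idx \<Longrightarrow> S i * star (S i) * z = c i *\<^sub>C (S i * star (S i))" by metis
  have "z = (\<Sum>i\<in>idx. S i * star (S i)) * z" by (simp add: sum_ranges)
  also have "\<dots> = (\<Sum>i\<in>idx. c i *\<^sub>C (S i * star (S i)))" unfolding sum_distrib_right by (simp add: c)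
  finally show ?thesis by (rule that)
qed

lemma conj_D1_subset:
  assumes t: "t \<in> unitaries (hom 1 1)"
    and comm: "\<And>i j. i \<in> idx \<Longrightarrow> j \<in> idx \<Longrightarrow>
      conj_by t (S i * star (S i)) * (S j * star (S j)) = S j * star (S j) * conj_by t (S i * star (S i))"
  shows "conj_by t ` cuntz_D1 n S \<subseteq> cuntz_D1 n S"
proof (rule image_subsetI)
  fix z assume z: "z \<in> cuntz_D1 n S"
  obtain c where c: "z = (\<Sum>i\<in>idx. c i *\<^sub>C (S i * star (S i)))" using z by (rule D1_expansion)
  have "conj_by t z = (\<Sum>i\<in>idx. c i *\<^sub>C conj_by t (S i * star (S i)))"
    by (simp add: c conj_by_def sum_distrib_left sum_distrib_right mult_scaleC_left mult_scaleC_right)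
  then have "conj_by t z * (S j * star (S j)) = S j * star (S j) * conj_by t z" if "j \<in> idx" for j
    using comm[OF _ that] by (simp add: sum_distrib_left sum_distrib_right mult_scaleC_left mult_scaleC_right)
  moreover have "t \<in> hom 1 1" "z \<in> hom 1 1" using t z by (simp_all add: unitaries_def D1_eq)
  then have "conj_by t z \<in> hom 1 1" unfolding conj_by_def by (meson hom_mult hom_star)
  ultimately show "conj_by t z \<in> cuntz_D1 n S" by (simp add: D1_eq)
qed

lemma normalizerI:
  assumes t: "t \<in> unitaries (hom 1 1)"
    and comm: "\<And>i j. i \<in> idx \<Longrightarrow> j \<in> idx \<Longrightarrow>
      conj_by t (S i * star (S i)) * (S j * star (S j)) = S j * star (S j) * conj_by t (S i * star (S i))"
  shows "t \<in> normalizer"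
proof -
  have tu: "star t * t = 1" "star (star t) * star t = 1" using t by (simp_all add: unitaries_def star_star)
  have comm': "conj_by (star t) (S i * star (S i)) * (S j * star (S j))
      = S j * star (S j) * conj_by (star t) (S i * star (S i))" if "i \<in> idx" "j \<in> idx" for i j
  proof -
    have "conj_by (star t) (conj_by t (S j * star (S j)) * (S i * star (S i)))
        = conj_by (star t) (S i * star (S i) * conj_by t (S j * star (S j)))"
      using comm[OF that(2,1)] by simp
    then show ?thesis
      by (simp add: conj_by_hom[OF tu(2), symmetric] conj_by_star_cancel[OF t])
  qed
  have "conj_by (star t) ` cuntz_D1 n S \<subseteq> cuntz_D1 n S"
    using unitaries_star[OF t] comm' by (rule conj_D1_subset)
  then have "conj_by t ` conj_by (star t) ` cuntz_D1 n S \<subseteq> conj_by t ` cuntz_D1 n S" by (rule image_mono)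
  then have "cuntz_D1 n S \<subseteq> conj_by t ` cuntz_D1 n S"
    by (simp add: image_image conj_by_star_cancel[OF t])
  then show ?thesis
    using conj_D1_subset[OF assms] t by (simp add: normalizer_def unitary_normalizer_def)
qed

lemma normalizer_mult: "s \<in> normalizer \<Longrightarrow> t \<in> normalizer \<Longrightarrow> s * t \<in> normalizer"
  unfolding normalizer_def unitary_normalizer_def
  by (simp add: unitaries_mult[unfolded One_nat_def] conj_by_mult flip: image_image)

lemma normalizer_star: "t \<in> normalizer \<Longrightarrow> star t \<in> normalizer"
proof -
  assume "t \<in> normalizer"
  then have t: "t \<in> unitaries (hom 1 1)" "conj_by t ` cuntz_D1 n S = cuntz_D1 n S"
    by (simp_all add: normalizer_def unitary_normalizer_def)
  have "conj_by (star t) ` cuntz_D1 n S = conj_by (star t) ` conj_by t ` cuntz_D1 n S" by (simp only: t(2))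
  also have "\<dots> = cuntz_D1 n S" by (simp add: image_image conj_by_star_cancel[OF t(1)])
  finally show ?thesis using unitaries_star[OF t(1)] by (simp add: normalizer_def unitary_normalizer_def)
qed

lemma one_unitary: "1 \<in> unitaries (hom 1 1)"
  using one_hom by (simp add: unitaries_def)

lemma one_normalizer: "1 \<in> normalizer"
  using one_unitary by (simp add: normalizer_def unitary_normalizer_def conj_by_def)

lemma normalizer_commute:
  assumes "t \<in> normalizer" "i \<in> idx" "j \<in> idx"
  shows "conj_by t (S i * star (S i)) * (S j * star (S j)) = S j * star (S j) * conj_by t (S i * star (S i))"
proof -
  have "S i * star (S i) \<in> diagonal" using word_projection_diagonal[of "[i]"] assms by simp
  moreover have "S i * star (S i) \<in> hom 1 1" using hom_mult[OF S_hom hom_star[OF S_hom]] assms by simp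
  ultimately have "S i * star (S i) \<in> cuntz_D1 n S" by (simp add: cuntz_D1_def F1_eq)
  then have "conj_by t (S i * star (S i)) \<in> cuntz_D1 n S"
    using assms(1) by (auto simp: normalizer_def unitary_normalizer_def)
  then show ?thesis using assms(3) by (simp add: D1_eq)
qed

lemma coset_eq_iff:
  assumes u: "u \<in> unitaries (hom 1 1)" and v: "v \<in> unitaries (hom 1 1)"
  shows "(\<lambda>h. u * h) ` normalizer = (\<lambda>h. v * h) ` normalizer \<longleftrightarrow> star v * u \<in> normalizer"
proof
  have vu: "star v * v = 1" "v * star v = 1" using v by (simp_all add: unitaries_def)
  assume "(\<lambda>h. u * h) ` normalizer = (\<lambda>h. v * h) ` normalizer"
  moreover have "u * 1 \<in> (\<lambda>h. u * h) ` normalizer" using one_normalizer by (rule imageI)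
  ultimately obtain h where h: "u = v * h" "h \<in> normalizer" by auto
  have "star v * u = h" by (simp add: h(1) vu flip: mult.assoc)
  then show "star v * u \<in> normalizer" using h(2) by simp
next
  have vu: "v * star v = 1" "u * star u = 1" using u v by (simp_all add: unitaries_def)
  assume t: "star v * u \<in> normalizer"
  have "u * h = v * (star v * u * h)" "v * h = u * (star (star v * u) * h)" for h
    using vu by (simp_all add: star_mult star_star flip: mult.assoc)
  then show "(\<lambda>h. u * h) ` normalizer = (\<lambda>h. v * h) ` normalizer"
    using normalizer_mult[OF t] normalizer_mult[OF normalizer_star[OF t]]
    by (metis (no_types, lifting) image_subset_iff imageI subset_antisym)
qed

lemma inner_conjugate_coset_eq:
  assumes u: "u \<in> unitaries (hom 1 1)" and v: "v \<in> unitaries (hom 1 1)"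
    and "inner_conjugate B (cuntz_diagonal n (\<lambda>i. u * S i)) (cuntz_diagonal n (\<lambda>i. v * S i))"
  shows "(\<lambda>h. u * h) ` normalizer = (\<lambda>h. v * h) ` normalizer"
proof -
  obtain w where w: "w \<in> unitaries B"
    "conj_by w ` cuntz_diagonal n (\<lambda>i. u * S i) = cuntz_diagonal n (\<lambda>i. v * S i)"
    using assms(3) by (auto simp: inner_conjugate_def)
  have sv: "star (star v) * star v = 1" using v by (simp add: unitaries_def star_star)
  have "star v * u \<in> normalizer"
  proof (rule normalizerI)
    show "star v * u \<in> unitaries (hom 1 1)" by (intro unitaries_mult unitaries_star u v)
    fix i j assume ij: "i \<in> idx" "j \<in> idx"
    have e: "v * S j * star (v * S j) = conj_by v (S j * star (S j))"
      "u * S i * star (u * S i) = conj_by u (S i * star (S i))"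
      by (simp_all add: conj_by_def star_mult mult.assoc)
    have "conj_by (star v) (conj_by u (S i * star (S i)) * conj_by v (S j * star (S j)))
        = conj_by (star v) (conj_by v (S j * star (S j)) * conj_by u (S i * star (S i)))"
      using conjugate_diagonals_commute[OF u v w(1) eq_refl[OF w(2)] ij] by (simp only: e)
    then show "conj_by (star v * u) (S i * star (S i)) * (S j * star (S j))
        = S j * star (S j) * conj_by (star v * u) (S i * star (S i))"
      by (simp add: conj_by_hom[OF sv, symmetric] conj_by_star_cancel[OF v] conj_by_mult)
  qed
  then show ?thesis using coset_eq_iff[OF u v] by simp
qed

lemma cosets_eq: "cuntz_cosets n S = (\<lambda>u. (\<lambda>h. u * h) ` normalizer) ` unitaries (hom 1 1)"
  unfolding cuntz_cosets_def left_cosets_def F1_eq normalizer_def by auto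

definition rotation :: "real \<Rightarrow> 'a" where
  "rotation \<theta> = complex_of_real (cos \<theta>) *\<^sub>C (S 1 * star (S 1) + S 2 * star (S 2))
    + complex_of_real (sin \<theta>) *\<^sub>C (S 2 * star (S 1) - S 1 * star (S 2))
    + (1 - (S 1 * star (S 1) + S 2 * star (S 2)))"

lemma star_rotation: "star (rotation \<theta>) = rotation (- \<theta>)"
  by (simp add: rotation_def star_simps complex_vector.scale_right_diff_distrib algebra_simps)

lemma rotation_unitary_half: "rotation \<theta> * rotation (- \<theta>) = 1"
proof -
  define p r where "p = S 1 * star (S 1) + S 2 * star (S 2)" and "r = S 2 * star (S 1) - S 1 * star (S 2)"
  have m: "p * p = p" "p * r = r" "r * p = r" "r * r = - p"
    unfolding p_def r_def by (simp_all add: algebra_simps S_star_S_assoc del: One_nat_def)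
  let ?c = "complex_of_real (cos \<theta>)" and ?s = "complex_of_real (sin \<theta>)"
  have rot: "rotation \<theta> = ?c *\<^sub>C p + ?s *\<^sub>C r + (1 - p)" "rotation (- \<theta>) = ?c *\<^sub>C p - ?s *\<^sub>C r + (1 - p)"
    by (simp_all add: rotation_def p_def r_def)
  have "rotation \<theta> * rotation (- \<theta>) = (?c * ?c + ?s * ?s) *\<^sub>C p + (1 - p)"
    unfolding rot
    by (simp add: algebra_simps mult_scaleC_left mult_scaleC_right m scaleC_add_left scaleC_add_right
        complex_vector.scale_right_diff_distrib scaleC_scaleC)
  also have "?c * ?c + ?s * ?s = complex_of_real ((cos \<theta>)\<^sup>2 + (sin \<theta>)\<^sup>2)"
    by (simp only: of_real_add of_real_mult power2_eq_square)
  finally show ?thesis by (simp add: scaleC_one)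
qed

lemma rotation_unitary: "rotation \<theta> \<in> unitaries (hom 1 1)"
proof -
  have s: "S i * star (S j) \<in> hom 1 1" if "i \<in> idx" "j \<in> idx" for i j
    using that by (intro hom_mult[OF S_hom hom_star[OF S_hom]])
  have d: "x - y \<in> hom 1 1" if "x \<in> hom 1 1" "y \<in> hom 1 1" for x y
    using hom_add[OF that(1) hom_scaleC[OF that(2)], of "-1"] by (simp add: scaleC_minus1)
  have "rotation \<theta> \<in> hom 1 1"
    unfolding rotation_def by (intro hom_add hom_scaleC d s one_hom idx)
  then show ?thesis
    using rotation_unitary_half[of \<theta>] rotation_unitary_half[of "- \<theta>"]
    by (simp add: unitaries_def star_rotation)
qed

lemma rotation_S:
  "rotation \<theta> * S 1 = complex_of_real (cos \<theta>) *\<^sub>C S 1 + complex_of_real (sin \<theta>) *\<^sub>C S 2"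
  "rotation \<theta> * S 2 = complex_of_real (cos \<theta>) *\<^sub>C S 2 - complex_of_real (sin \<theta>) *\<^sub>C S 1"
  by (simp_all add: rotation_def distrib_right left_diff_distrib mult_scaleC_left mult.assoc S_star_S
      complex_vector.scale_minus_right del: One_nat_def)

lemma rotation_coset_inj:
  assumes \<theta>: "0 < \<theta>" "\<theta> < 1" and \<eta>: "0 < \<eta>" "\<eta> < 1"
    and eq: "(\<lambda>h. rotation \<theta> * h) ` normalizer = (\<lambda>h. rotation \<eta> * h) ` normalizer"
  shows "\<theta> = \<eta>"
proof -
  define t where "t = star (rotation \<eta>) * rotation \<theta>"
  have t: "t \<in> normalizer" unfolding t_def using coset_eq_iff[OF rotation_unitary rotation_unitary] eq by simp
  let ?c = "\<lambda>x. complex_of_real (cos x)" and ?s = "\<lambda>x. complex_of_real (sin x)"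
  have e: "star (S i) * t * S j = star (rotation \<eta> * S i) * (rotation \<theta> * S j)" for i j
    by (simp add: t_def star_mult mult.assoc)
  have t11: "star (S 1) * t * S 1 = (?c \<theta> * ?c \<eta> + ?s \<theta> * ?s \<eta>) *\<^sub>C 1"
    and t21: "star (S 2) * t * S 1 = (?s \<theta> * ?c \<eta> - ?c \<theta> * ?s \<eta>) *\<^sub>C 1"
    unfolding e rotation_S
    by (simp_all add: star_simps distrib_left distrib_right left_diff_distrib right_diff_distrib
        mult_scaleC_left mult_scaleC_right S_star_S scaleC_scaleC scaleC_add_left
        complex_vector.scale_left_diff_distrib mult.commute del: One_nat_def)
  let ?\<delta> = "\<theta> - \<eta>"
  have "?c \<theta> * ?c \<eta> + ?s \<theta> * ?s \<eta> = ?c ?\<delta>" "?s \<theta> * ?c \<eta> - ?c \<theta> * ?s \<eta> = ?s ?\<delta>"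
    by (simp_all add: cos_diff sin_diff)
  then have t11': "star (S 1) * t * S 1 = ?c ?\<delta> *\<^sub>C 1" and t21': "star (S 2) * t * S 1 = ?s ?\<delta> *\<^sub>C 1"
    using t11 t21 by simp_all
  have i: "1 \<in> idx" "2 \<in> idx" by (rule idx)+
  have "star (S 1) * (conj_by t (S 1 * star (S 1)) * (S 2 * star (S 2))) * S 2
      = star (S 1) * (S 2 * star (S 2) * conj_by t (S 1 * star (S 1))) * S 2"
    by (simp only: normalizer_commute[OF t i])
  also have "\<dots> = 0" using i by (simp add: S_star_S_assoc mult.assoc del: One_nat_def)
  also have "star (S 1) * (conj_by t (S 1 * star (S 1)) * (S 2 * star (S 2))) * S 2
      = (star (S 1) * t * S 1) * star (star (S 2) * t * S 1)"
    using i by (simp add: conj_by_def star_mult star_star mult.assoc del: One_nat_def)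
  finally have "(?c ?\<delta> * ?s ?\<delta>) *\<^sub>C (1::'a) = 0"
    unfolding t11' t21' by (auto simp: star_scaleC mult_scaleC_left mult_scaleC_right scaleC_scaleC)
  then have "cos ?\<delta> * sin ?\<delta> = 0"
    by (metis complex_vector.scale_eq_0_iff of_real_eq_0_iff of_real_mult zero_neq_one)
  moreover have "cos ?\<delta> > 0" using \<theta> \<eta> pi_gt3 by (intro cos_gt_zero_pi) auto
  ultimately have s: "sin ?\<delta> = 0" by simp
  show "\<theta> = \<eta>"
  proof (rule ccontr)
    assume "\<theta> \<noteq> \<eta>"
    then have "sin ?\<delta> > 0 \<or> sin (- ?\<delta>) > 0"
      using \<theta> \<eta> pi_gt3 sin_gt_zero[of ?\<delta>] sin_gt_zero[of "- ?\<delta>"] by linarith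
    then show False using s sin_minus[of ?\<delta>] by linarith
  qed
qed

lemma uncountable_cosets: "uncountable (cuntz_cosets n S)"
proof
  assume c: "countable (cuntz_cosets n S)"
  let ?f = "\<lambda>\<theta>. (\<lambda>h. rotation \<theta> * h) ` normalizer"
  have "?f ` {0<..<1} \<subseteq> cuntz_cosets n S" unfolding cosets_eq using rotation_unitary by auto
  then have "countable (?f ` {0<..<1})" using c by (rule countable_subset)
  moreover have "inj_on ?f {0<..<1}" by (rule inj_onI) (use rotation_coset_inj in auto)
  ultimately have "countable {0<..<1::real}" by (rule countable_image_inj_on)
  then show False using uncountable_open_interval[of 0 1] by simp
qed

section \<open>Outer automorphisms\<close>

lemma word_projection_Cons: "word_projection T (i # \<mu>) = T i * word_projection T \<mu> * star (T i)"
  by (simp add: word_projection_def star_mult mult.assoc)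

lemma minus_one_unitary: "- 1 \<in> unitaries (hom 1 1)"
  using hom_scaleC[OF one_hom, of "-1" 1] by (simp add: unitaries_def star_minus scaleC_minus1)

lemma minus_diagonal: "cuntz_diagonal n (\<lambda>i. - 1 * S i) = diagonal"
proof -
  have "word_projection (\<lambda>i. - 1 * S i) \<mu> = word_projection S \<mu>" for \<mu>
  proof (induction \<mu>)
    case (Cons i \<mu>)
    then show ?case unfolding word_projection_Cons by (simp add: star_minus)
  qed (simp add: word_projection_def)
  then show ?thesis by (simp add: cuntz_diagonal_def)
qed

lemma gauge_not_inner:
  assumes w: "w \<in> unitaries B" and gauge: "\<And>i. i \<in> idx \<Longrightarrow> conj_by w (S i) = - S i"
  shows False
proof -
  have wB: "w \<in> B" and wu: "star w * w = 1" using w by (simp_all add: unitaries_def)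
  have wS: "w * S i = - (S i * w)" if "i \<in> idx" for i
  proof -
    have "w * S i = conj_by w (S i) * w" by (simp add: conj_by_def wu mult.assoc)
    then show ?thesis using gauge[OF that] by simp
  qed
  have wS': "w * star (S i) = - (star (S i) * w)" if "i \<in> idx" for i
  proof -
    have "star (conj_by w (S i)) = conj_by w (star (S i))" by (simp add: conj_by_def star_simps mult.assoc)
    then have "conj_by w (star (S i)) = - star (S i)" using gauge[OF that] by (simp add: star_minus)
    moreover have "w * star (S i) = conj_by w (star (S i)) * w" by (simp add: conj_by_def wu mult.assoc)
    ultimately show ?thesis by simp
  qed
  have "w * (sw \<mu> * star (sw \<mu>)) = sw \<mu> * star (sw \<mu>) * w" if "\<mu> \<in> lists idx" for \<mu>
    using that
  proof (induction \<mu>)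
    case (Cons i \<mu>)
    let ?p = "sw \<mu> * star (sw \<mu>)"
    have i: "i \<in> idx" and IH: "w * ?p = ?p * w" using Cons by auto
    have "w * (sw (i # \<mu>) * star (sw (i # \<mu>))) = w * S i * ?p * star (S i)"
      by (simp add: star_mult mult.assoc)
    also have "\<dots> = - (S i * (w * ?p) * star (S i))" by (simp add: wS[OF i] mult.assoc)
    also have "\<dots> = - (S i * ?p * (w * star (S i)))" unfolding IH by (simp only: mult.assoc)
    also have "\<dots> = sw (i # \<mu>) * star (sw (i # \<mu>)) * w" by (simp add: wS'[OF i] star_mult mult.assoc)
    finally show ?case .
  qed simp
  then have "w \<in> diagonal" using diagonal_maximal[OF wB] commutes_with_diagonalI[of w] by blast
  moreover have "diagonal \<subseteq> core" using twisted_diagonal_core[OF one_hom[of 1]] by simp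
  ultimately have "w \<in> closure (\<Union>k. hom k k)" by (auto simp: core_def)
  then have "\<exists>h\<in>(\<Union>k. hom k k). dist h w < 1/4"
    unfolding closure_approachable by (rule allE[of _ "1/4"]) simp
  then obtain h where "h \<in> (\<Union>k. hom k k)" "dist h w < 1/4" by blast
  then obtain k where h: "h \<in> hom k k" "norm (w - h) < 1/4" by (auto simp: dist_norm norm_minus_commute)
  let ?s = "sw (replicate k (Suc 0))"
  have s: "replicate k (Suc 0) \<in> words k" using replicate_words by simp
  obtain c where c: "star ?s * h * ?s = c *\<^sub>C 1" using homD[OF h(1) s s] by (rule scalarsE)
  have "star ?s * w * ?s = w \<or> star ?s * w * ?s = - w"
  proof -
    have "star (sw (replicate k (Suc 0))) * w * sw (replicate k (Suc 0)) = w
        \<or> star (sw (replicate k (Suc 0))) * w * sw (replicate k (Suc 0)) = - w" for k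
    proof (induction k)
      case (Suc k)
      let ?s = "sw (replicate k (Suc 0))"
      have "star (sw (replicate (Suc k) (Suc 0))) * w * sw (replicate (Suc k) (Suc 0))
          = star ?s * (star (S (Suc 0)) * (w * S (Suc 0))) * ?s" by (simp add: star_mult mult.assoc)
      also have "star (S (Suc 0)) * (w * S (Suc 0)) = - w" using wS[of "Suc 0"] by simp
      finally have "star (sw (replicate (Suc k) (Suc 0))) * w * sw (replicate (Suc k) (Suc 0)) = - (star ?s * w * ?s)"
        by simp
      then show ?case using Suc by auto
    qed simp
    then show ?thesis .
  qed
  moreover have "norm (star ?s * w * ?s - c *\<^sub>C 1) < 1/4"
    using compress_lipschitz[of ?s ?s w h] norm_word[OF s] h(2) by (simp add: c)
  ultimately obtain c' where c': "norm (w - c' *\<^sub>C 1) < 1/4"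
  proof (elim disjE)
    assume "star ?s * w * ?s = - w" and n: "norm (star ?s * w * ?s - c *\<^sub>C 1) < 1/4"
    then have "norm (- w - c *\<^sub>C 1) < 1/4" by simp
    moreover have "- w - c *\<^sub>C 1 = - (w - (- c) *\<^sub>C 1)" by (simp add: complex_vector.scale_minus_left)
    ultimately have "norm (w - (- c) *\<^sub>C 1) < 1/4" by (metis norm_minus_cancel)
    then show ?thesis by (rule that)
  qed (auto intro: that)
  have "star (S (Suc 0)) * w * S (Suc 0) = - w" using wS[of "Suc 0"] by (simp add: mult.assoc)
  then have "norm (- w - c' *\<^sub>C 1) < 1/4"
    using compress_lipschitz[of "S (Suc 0)" "S (Suc 0)" w "c' *\<^sub>C 1"] c' norm_isometry[OF isometry[of "Suc 0"]]
    by (simp add: mult_scaleC_left mult_scaleC_right)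
  then have "norm ((w - c' *\<^sub>C 1) - (- w - c' *\<^sub>C 1)) < 1/4 + 1/4"
    by (rule order_le_less_trans[OF norm_triangle_ineq4 add_strict_mono[OF c']])
  then have "norm (2 *\<^sub>R w) < 1/2" by (simp add: scaleR_2)
  then show False using norm_unitary[OF w] by simp
qed

lemma outer_conjugate_diagonal_self: "outer_conjugate B diagonal diagonal"
proof -
  have m: "- 1 \<in> hom 1 1" "star (- 1) * - 1 = (1::'a)" "- 1 * star (- 1) = (1::'a)"
    using minus_one_unitary by (auto simp: unitaries_def)
  obtain \<alpha> where \<alpha>: "cstar_automorphism B \<alpha>" "\<And>i. i \<in> idx \<Longrightarrow> \<alpha> (S i) = - 1 * S i"
    "\<alpha> ` diagonal = cuntz_diagonal n (\<lambda>i. - 1 * S i)"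
    using quasi_free_automorphism[OF m] by blast
  have "\<not> inner_automorphism B \<alpha>"
  proof
    assume "inner_automorphism B \<alpha>"
    then obtain w where "w \<in> unitaries B" "\<forall>x\<in>B. \<alpha> x = conj_by w x" by (auto simp: inner_automorphism_def)
    then show False using gauge_not_inner[of w] \<alpha>(2) B_generator by force
  qed
  then show ?thesis
    unfolding outer_conjugate_def outer_automorphism_def using \<alpha>(1,3) minus_diagonal by auto
qed

lemma outer_conjugate_twisted_diagonal:
  assumes u: "u \<in> unitaries (hom 1 1)"
    and nontriv: "(\<lambda>h. u * h) ` normalizer \<noteq> normalizer"
  shows "outer_conjugate B (cuntz_diagonal n (\<lambda>i. u * S i)) diagonal"
proof -
  have uh: "u \<in> hom 1 1" "star u * u = 1" "u * star u = 1" using u by (simp_all add: unitaries_def)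
  let ?D = "cuntz_diagonal n (\<lambda>i. u * S i)"
  interpret T: cuntz_family n "\<lambda>i. u * S i" B by (rule unitary_hom_family[OF u])
  have "star (u * S i) * star u * (u * S j) \<in> scalars" if ij: "i \<in> idx" "j \<in> idx" for i j
  proof -
    have "star (u * S i) * star u * (u * S j) = star (S i) * star u * (star u * u) * S j"
      by (simp only: star_mult mult.assoc)
    then show ?thesis using hom_1_1D[OF hom_star[OF uh(1)] ij] by (simp add: uh)
  qed
  then have "star u \<in> T.hom 1 1" by (simp add: T.hom_def T.words_1)
  then obtain \<beta> where \<beta>: "cstar_automorphism B \<beta>" "\<beta> ` ?D = cuntz_diagonal n (\<lambda>i. star u * (u * S i))"
    using T.quasi_free_automorphism[of "star u"] uh by (metis star_star)
  have D: "cuntz_diagonal n (\<lambda>i. star u * (u * S i)) = diagonal"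
    by (simp add: uh flip: mult.assoc)
  have "\<not> inner_automorphism B \<beta>"
  proof
    assume "inner_automorphism B \<beta>"
    then obtain w where w: "w \<in> unitaries B" "\<forall>x\<in>B. \<beta> x = conj_by w x" by (auto simp: inner_automorphism_def)
    have "conj_by w ` ?D = \<beta> ` ?D" using w(2) T.diagonal_subset_B by (auto intro!: image_cong)
    then have "inner_conjugate B ?D (cuntz_diagonal n (\<lambda>i. 1 * S i))"
      using w(1) \<beta>(2) D by (auto simp: inner_conjugate_def)
    then have "(\<lambda>h. u * h) ` normalizer = (\<lambda>h. 1 * h) ` normalizer"
      by (rule inner_conjugate_coset_eq[OF u one_unitary])
    then show False using nontriv by simp
  qed
  then show ?thesis
    unfolding outer_conjugate_def outer_automorphism_def using \<beta> D by auto
qed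

end

theorem corollary3p8:
  fixes n :: nat and S :: "nat \<Rightarrow> 'a::cstar_algebra" and B :: "'a set"
  assumes "n \<ge> 2" and "is_cuntz_algebra n S B"
  shows "(\<exists>A1 A2. masa B A1 \<and> masa B A2 \<and> outer_conjugate B A1 A2 \<and> \<not> inner_conjugate B A1 A2) \<and>
    uncountable (cuntz_cosets n S) \<and>
    (\<exists>M :: 'a set \<Rightarrow> 'a set.
       (\<forall>C\<in>cuntz_cosets n S. masa B (M C) \<and> outer_conjugate B (M C) (cuntz_diagonal n S)) \<and>
       (\<forall>C\<in>cuntz_cosets n S. \<forall>C'\<in>cuntz_cosets n S.
          C \<noteq> C' \<longrightarrow> \<not> inner_conjugate B (M C) (M C')))"
proof -
  interpret cuntz_family n S B by unfold_locales (rule assms)+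
  have "\<forall>C\<in>cuntz_cosets n S. \<exists>u. u \<in> unitaries (hom 1 1) \<and> C = (\<lambda>h. u * h) ` normalizer \<and>
      (C = normalizer \<longrightarrow> u = 1)"
  proof
    fix C assume "C \<in> cuntz_cosets n S"
    then show "\<exists>u. u \<in> unitaries (hom 1 1) \<and> C = (\<lambda>h. u * h) ` normalizer \<and> (C = normalizer \<longrightarrow> u = 1)"
      using one_unitary by (cases "C = normalizer") (auto simp: cosets_eq)
  qed
  then obtain rep where rep: "\<And>C. C \<in> cuntz_cosets n S \<Longrightarrow> rep C \<in> unitaries (hom 1 1)"
    "\<And>C. C \<in> cuntz_cosets n S \<Longrightarrow> C = (\<lambda>h. rep C * h) ` normalizer"
    "\<And>C. C \<in> cuntz_cosets n S \<Longrightarrow> C = normalizer \<Longrightarrow> rep C = 1" by metis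
  define M where "M C = cuntz_diagonal n (\<lambda>i. rep C * S i)" for C
  have masa: "masa B (M C)" if "C \<in> cuntz_cosets n S" for C
    unfolding M_def by (rule cuntz_family.masa_diagonal[OF unitary_hom_family[OF rep(1)[OF that]]])
  have outer: "outer_conjugate B (M C) diagonal" if C: "C \<in> cuntz_cosets n S" for C
  proof (cases "C = normalizer")
    case True
    then show ?thesis using outer_conjugate_diagonal_self rep(3)[OF C] by (simp add: M_def)
  next
    case False
    then show ?thesis
      unfolding M_def using rep(1,2)[OF C] by (intro outer_conjugate_twisted_diagonal) auto
  qed
  have inner: "C = C'" if "C \<in> cuntz_cosets n S" "C' \<in> cuntz_cosets n S" "inner_conjugate B (M C) (M C')" for C C'
    using inner_conjugate_coset_eq[OF rep(1)[OF that(1)] rep(1)[OF that(2)]] that(3)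
      rep(2)[OF that(1)] rep(2)[OF that(2)] by (simp add: M_def)
  have N: "normalizer \<in> cuntz_cosets n S" unfolding cosets_eq by (rule image_eqI[OF _ one_unitary]) simp
  then have MN: "M normalizer = diagonal" using rep(3) by (simp add: M_def)
  have "cuntz_cosets n S \<noteq> {normalizer}" using uncountable_cosets by auto
  then obtain C where C: "C \<in> cuntz_cosets n S" "C \<noteq> normalizer" using N by blast
  have "masa B (M C) \<and> masa B diagonal \<and> outer_conjugate B (M C) diagonal \<and> \<not> inner_conjugate B (M C) diagonal"
    using masa[OF C(1)] masa_diagonal outer[OF C(1)] inner[OF C(1) N] C(2) MN by auto
  then show ?thesis using masa outer inner uncountable_cosets by blast
qed

end
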